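(* Let $(\Sigma,I)$ be a fixed independence alphabet, and let $G$ be either the graph group $G(\Sigma,I)$ or the right-angled Coxeter group $C(\Sigma,I)$. Then shortlex normal forms in $G$ can be calculated in logspace; that is, there is a deterministic logspace transducer which, on input a word $w$ over the generators ($w\in(\Sigma\cup\overline{\Sigma})^*$ if $G=G(\Sigma,I)$, and $w\in\Sigma^*$ if $G=C(\Sigma,I)$), outputs the shortlex normal form of the element of $G$ represented by $w$.
   Context: An independence alphabet is a pair $(\Sigma,I)$ with $\Sigma$ a finite set and $I\subseteq\Sigma\times\Sigma$ an irreflexive and symmetric relation. The graph group (right-angled Artin group) is $G(\Sigma,I)=F(\Sigma)/\{ab=ba\mid (a,b)\in I\}$, where $F(\Sigma)$ is the free group on $\Sigma$; its elements are represented by words over $\Gamma=\Sigma\cup\overline{\Sigma}$, where $\overline{\Sigma}$ is a disjoint copy of $\Sigma$ and $\overline{a}$ represents $a^{-1}$. The right-angled Coxeter group $C(\Sigma,I)$ is the group generated by $\Sigma$ with defining relations $a^2=1$ for all $a\in\Sigma$ and $ab=ba$ for all $(a,b)\in I$; its elements are represented by words over $\Sigma$. In either case fix a linear order on the representing alphabet. A geodesic for $g\in G$ is a word of minimal length over this alphabet among those representing $g$, and the shortlex normal form of $g$ is the lexicographically first word among all geodesics for $g$. A deterministic logspace transducer is a deterministic Turing machine with a read-only input tape, a read/write work tape of length $\mathcal{O}(\log n)$ (where $n$ is the input length), and a write-only output tape written sequentially from left to right. The group is fixed and is not part of the input. *)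

theory Defs
  imports "HOL-Algebra.Group" "HOL-Library.Landau_Symbols"
begin

section \<open>Group presentations\<close>

text \<open>
  The letters over a generating set \<open>S\<close> are \<open>S <+> S\<close>: \<open>Inl a\<close> stands for the
  generator \<open>a\<close> and \<open>Inr a\<close> for its formal inverse.
\<close>

type_synonym 'a letter = "'a + 'a"

definition letters :: "'a set \<Rightarrow> 'a letter set" where
  "letters S = S <+> S"

fun bar :: "'a letter \<Rightarrow> 'a letter" where
  "bar (Inl a) = Inr a"
| "bar (Inr a) = Inl a"

text \<open>
  The least congruence on words over \<open>letters S\<close> that contains free cancellation
  and the relations \<open>R\<close>, each relation being a pair of words.
\<close>

inductive_set pres_cong :: "'a set \<Rightarrow> ('a letter list \<times> 'a letter list) set
    \<Rightarrow> ('a letter list \<times> 'a letter list) set" for S R where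
  refl: "w \<in> lists (letters S) \<Longrightarrow> (w, w) \<in> pres_cong S R"
| sym: "(u, v) \<in> pres_cong S R \<Longrightarrow> (v, u) \<in> pres_cong S R"
| trans: "(u, v) \<in> pres_cong S R \<Longrightarrow> (v, w) \<in> pres_cong S R \<Longrightarrow> (u, w) \<in> pres_cong S R"
| cancel: "u \<in> lists (letters S) \<Longrightarrow> v \<in> lists (letters S) \<Longrightarrow> x \<in> letters S
    \<Longrightarrow> (u @ [x, bar x] @ v, u @ v) \<in> pres_cong S R"
| relation: "u \<in> lists (letters S) \<Longrightarrow> v \<in> lists (letters S)
    \<Longrightarrow> l \<in> lists (letters S) \<Longrightarrow> r \<in> lists (letters S) \<Longrightarrow> (l, r) \<in> R
    \<Longrightarrow> (u @ l @ v, u @ r @ v) \<in> pres_cong S R"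

definition word_class :: "'a set \<Rightarrow> ('a letter list \<times> 'a letter list) set
    \<Rightarrow> 'a letter list \<Rightarrow> 'a letter list set" where
  "word_class S R w = pres_cong S R `` {w}"

definition presented_group :: "'a set \<Rightarrow> ('a letter list \<times> 'a letter list) set
    \<Rightarrow> 'a letter list set monoid" where
  "presented_group S R =
    \<lparr>carrier = lists (letters S) // pres_cong S R,
     mult = (\<lambda>A B. \<Union>u\<in>A. \<Union>v\<in>B. word_class S R (u @ v)),
     one = word_class S R []\<rparr>"

lemma bar_letters [simp]: "bar x \<in> letters S \<longleftrightarrow> x \<in> letters S"
  by (cases x) (auto simp: letters_def)

lemma bar_bar [simp]: "bar (bar x) = x"
  by (cases x) auto

lemma pres_cong_lists:
  "(u, v) \<in> pres_cong S R \<Longrightarrow> u \<in> lists (letters S) \<and> v \<in> lists (letters S)"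
  by (induction rule: pres_cong.induct) auto

lemma equiv_pres_cong: "equiv (lists (letters S)) (pres_cong S R)"
proof (rule equivI)
  show "pres_cong S R \<subseteq> lists (letters S) \<times> lists (letters S)"
    using pres_cong_lists by fast
  show "refl_on (lists (letters S)) (pres_cong S R)"
    by (auto simp: refl_on_def intro: pres_cong.refl)
  show "sym (pres_cong S R)"
    by (rule symI) (rule pres_cong.sym)
  show "trans (pres_cong S R)"
    by (rule transI) (rule pres_cong.trans)
qed

lemma pres_cong_context:
  assumes "(u, v) \<in> pres_cong S R" "p \<in> lists (letters S)" "q \<in> lists (letters S)"
  shows "(p @ u @ q, p @ v @ q) \<in> pres_cong S R"
  using assms
proof (induction rule: pres_cong.induct)
  case (refl w)
  then show ?case by (intro pres_cong.refl) auto
next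
  case (sym u v)
  then show ?case by (blast intro: pres_cong.sym)
next
  case (trans u v w)
  then show ?case by (blast intro: pres_cong.trans)
next
  case (cancel u v x)
  then show ?case using pres_cong.cancel[of "p @ u" S "v @ q" x R] by simp
next
  case (relation u v l r)
  then show ?case using pres_cong.relation[of "p @ u" S "v @ q" l r R] by simp
qed

lemma pres_cong_append:
  assumes "(u, u') \<in> pres_cong S R" "(v, v') \<in> pres_cong S R"
  shows "(u @ v, u' @ v') \<in> pres_cong S R"
proof -
  note l = pres_cong_lists[OF assms(1)] pres_cong_lists[OF assms(2)]
  have "(u @ v, u' @ v) \<in> pres_cong S R"
    using pres_cong_context[OF assms(1), of "[]" v] l by simp
  moreover have "(u' @ v, u' @ v') \<in> pres_cong S R"
    using pres_cong_context[OF assms(2), of u' "[]"] l by simp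
  ultimately show ?thesis by (rule pres_cong.trans)
qed

lemma word_class_eq_iff:
  "u \<in> lists (letters S) \<Longrightarrow> v \<in> lists (letters S) \<Longrightarrow>
    word_class S R u = word_class S R v \<longleftrightarrow> (u, v) \<in> pres_cong S R"
  unfolding word_class_def by (rule eq_equiv_class_iff[OF equiv_pres_cong])

lemma carrier_presented_group:
  "carrier (presented_group S R) = word_class S R ` lists (letters S)"
  by (auto simp: presented_group_def quotient_def word_class_def)

lemma one_presented_group: "\<one>\<^bsub>presented_group S R\<^esub> = word_class S R []"
  by (simp add: presented_group_def)

lemma mult_word_class:
  assumes "u \<in> lists (letters S)" "v \<in> lists (letters S)"
  shows "word_class S R u \<otimes>\<^bsub>presented_group S R\<^esub> word_class S R v = word_class S R (u @ v)"
proof -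
  have "word_class S R (u' @ v') = word_class S R (u @ v)"
    if "u' \<in> word_class S R u" "v' \<in> word_class S R v" for u' v'
  proof -
    have c: "(u, u') \<in> pres_cong S R" "(v, v') \<in> pres_cong S R"
      using that by (auto simp: word_class_def)
    show ?thesis
      using pres_cong_append[OF c] pres_cong_lists[OF c(1)] pres_cong_lists[OF c(2)]
      by (subst word_class_eq_iff) (auto intro: pres_cong.sym)
  qed
  moreover have "u \<in> word_class S R u" "v \<in> word_class S R v"
    using pres_cong.refl[OF assms(1)] pres_cong.refl[OF assms(2)] by (simp_all add: word_class_def)
  ultimately have "(\<Union>u' \<in> word_class S R u. \<Union>v' \<in> word_class S R v. word_class S R (u' @ v')) =
      word_class S R (u @ v)"
    by blast
  then show ?thesis
    by (simp add: presented_group_def)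
qed

lemma inverse_word:
  "w \<in> lists (letters S) \<Longrightarrow> (map bar (rev w) @ w, []) \<in> pres_cong S R"
proof (induction w)
  case Nil
  show ?case by (simp add: pres_cong.refl)
next
  case (Cons x w)
  have l: "map bar (rev w) \<in> lists (letters S)"
    using Cons.prems by (auto simp: lists_eq_set)
  have "(map bar (rev w) @ [bar x, bar (bar x)] @ w, map bar (rev w) @ w) \<in> pres_cong S R"
    using Cons.prems l by (intro pres_cong.cancel) auto
  moreover have "(map bar (rev w) @ w, []) \<in> pres_cong S R"
    using Cons by simp
  ultimately have "(map bar (rev w) @ [bar x, bar (bar x)] @ w, []) \<in> pres_cong S R"
    by (rule pres_cong.trans)
  then show ?case by simp
qed

lemma group_presented_group: "group (presented_group S R)" (is "group ?G")
proof (rule groupI)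
  fix A B C
  assume "A \<in> carrier ?G" "B \<in> carrier ?G" "C \<in> carrier ?G"
  then obtain u v w where w: "u \<in> lists (letters S)" "v \<in> lists (letters S)" "w \<in> lists (letters S)"
    and eq: "A = word_class S R u" "B = word_class S R v" "C = word_class S R w"
    by (auto simp only: carrier_presented_group)
  show "A \<otimes>\<^bsub>?G\<^esub> B \<otimes>\<^bsub>?G\<^esub> C = A \<otimes>\<^bsub>?G\<^esub> (B \<otimes>\<^bsub>?G\<^esub> C)"
    using w by (simp only: eq mult_word_class append_in_lists_conv append_assoc simp_thms)
next
  fix A B
  assume "A \<in> carrier ?G" "B \<in> carrier ?G"
  then obtain u v where w: "u \<in> lists (letters S)" "v \<in> lists (letters S)"
    and eq: "A = word_class S R u" "B = word_class S R v"
    by (auto simp only: carrier_presented_group)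
  have "word_class S R (u @ v) \<in> carrier ?G"
    using w by (simp only: carrier_presented_group append_in_lists_conv imageI simp_thms)
  then show "A \<otimes>\<^bsub>?G\<^esub> B \<in> carrier ?G"
    using w by (simp only: eq mult_word_class)
next
  show "\<one>\<^bsub>?G\<^esub> \<in> carrier ?G"
    by (simp add: carrier_presented_group one_presented_group)
next
  fix A
  assume "A \<in> carrier ?G"
  then obtain w where w: "w \<in> lists (letters S)" and eq: "A = word_class S R w"
    by (auto simp only: carrier_presented_group)
  show "\<one>\<^bsub>?G\<^esub> \<otimes>\<^bsub>?G\<^esub> A = A"
    using mult_word_class[OF lists.Nil w] by (simp only: eq one_presented_group append_Nil)
  have w': "map bar (rev w) \<in> lists (letters S)"
    using w by (auto simp: lists_eq_set)
  have "word_class S R (map bar (rev w) @ w) = word_class S R []"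
    using w w' inverse_word[OF w] by (subst word_class_eq_iff) auto
  then have "word_class S R (map bar (rev w)) \<otimes>\<^bsub>?G\<^esub> A = \<one>\<^bsub>?G\<^esub>"
    by (simp only: eq one_presented_group mult_word_class[OF w' w])
  moreover have "word_class S R (map bar (rev w)) \<in> carrier ?G"
    using w' by (simp only: carrier_presented_group imageI)
  ultimately show "\<exists>B \<in> carrier ?G. B \<otimes>\<^bsub>?G\<^esub> A = \<one>\<^bsub>?G\<^esub>"
    by (rule bexI)
qed

section \<open>Graph groups and right-angled Coxeter groups\<close>

definition independence_alphabet :: "'a set \<Rightarrow> ('a \<times> 'a) set \<Rightarrow> bool" where
  "independence_alphabet S I \<longleftrightarrow> finite S \<and> I \<subseteq> S \<times> S \<and> irrefl I \<and> sym I"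

definition commutations :: "('a \<times> 'a) set \<Rightarrow> ('a letter list \<times> 'a letter list) set" where
  "commutations I = {([Inl a, Inl b], [Inl b, Inl a]) | a b. (a, b) \<in> I}"

definition involutions :: "'a set \<Rightarrow> ('a letter list \<times> 'a letter list) set" where
  "involutions S = {([Inl a, Inl a], []) | a. a \<in> S}"

definition graph_group :: "'a set \<Rightarrow> ('a \<times> 'a) set \<Rightarrow> 'a letter list set monoid" where
  "graph_group S I = presented_group S (commutations I)"

definition coxeter_group :: "'a set \<Rightarrow> ('a \<times> 'a) set \<Rightarrow> 'a letter list set monoid" where
  "coxeter_group S I = presented_group S (involutions S \<union> commutations I)"

definition graph_gen :: "'a set \<Rightarrow> ('a \<times> 'a) set \<Rightarrow> 'a letter \<Rightarrow> 'a letter list set" where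
  "graph_gen S I x = word_class S (commutations I) [x]"

definition coxeter_gen :: "'a set \<Rightarrow> ('a \<times> 'a) set \<Rightarrow> 'a \<Rightarrow> 'a letter list set" where
  "coxeter_gen S I a = word_class S (involutions S \<union> commutations I) [Inl a]"

section \<open>Geodesics and shortlex normal forms\<close>

text \<open>
  Here \<open>X\<close> is an alphabet and \<open>\<phi>\<close> sends each letter to the element of \<open>G\<close> it represents.
\<close>

definition word_value :: "('g, 'b) monoid_scheme \<Rightarrow> ('x \<Rightarrow> 'g) \<Rightarrow> 'x list \<Rightarrow> 'g" where
  "word_value G \<phi> w = foldr (\<lambda>x g. \<phi> x \<otimes>\<^bsub>G\<^esub> g) w \<one>\<^bsub>G\<^esub>"

definition geodesics :: "('g, 'b) monoid_scheme \<Rightarrow> 'x set \<Rightarrow> ('x \<Rightarrow> 'g) \<Rightarrow> 'g \<Rightarrow> 'x list set" where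
  "geodesics G X \<phi> g =
    {w \<in> lists X. word_value G \<phi> w = g \<and>
      (\<forall>v \<in> lists X. word_value G \<phi> v = g \<longrightarrow> length w \<le> length v)}"

text \<open>\<open>ord\<close> is a reflexive linear order; \<open>lexord\<close> expects its strict part.\<close>

definition is_shortlex_nf :: "('g, 'b) monoid_scheme \<Rightarrow> 'x set \<Rightarrow> ('x \<Rightarrow> 'g)
    \<Rightarrow> ('x \<times> 'x) set \<Rightarrow> 'g \<Rightarrow> 'x list \<Rightarrow> bool" where
  "is_shortlex_nf G X \<phi> ord g w \<longleftrightarrow>
    w \<in> geodesics G X \<phi> g \<and>
    (\<forall>v \<in> geodesics G X \<phi> g. v \<noteq> w \<longrightarrow> (w, v) \<in> lexord (ord - Id))"

definition shortlex_nf :: "('g, 'b) monoid_scheme \<Rightarrow> 'x set \<Rightarrow> ('x \<Rightarrow> 'g)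
    \<Rightarrow> ('x \<times> 'x) set \<Rightarrow> 'g \<Rightarrow> 'x list" where
  "shortlex_nf G X \<phi> ord g = (THE w. is_shortlex_nf G X \<phi> ord g w)"

lemma lexord_total_same_length:
  assumes "total_on X r" "length u = length v" "u \<in> lists X" "v \<in> lists X" "u \<noteq> v"
  shows "(u, v) \<in> lexord r \<or> (v, u) \<in> lexord r"
  using assms(2-5)
proof (induction u v rule: list_induct2)
  case (Cons x xs y ys)
  then show ?case using assms(1) by (auto simp: total_on_def)
qed simp

lemma ex1_shortlex_nf:
  assumes X: "finite X" and ord: "linear_order_on X ord"
    and w: "w \<in> lists X" "word_value G \<phi> w = g"
  shows "\<exists>!u. is_shortlex_nf G X \<phi> ord g u"
proof -
  let ?r = "ord - Id" and ?A = "geodesics G X \<phi> g"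
  have r: "trans ?r" "irrefl ?r" "total_on X ?r"
    using strict_linear_order_on_diff_Id[OF ord] by (auto simp: strict_linear_order_on_def)
  define n where "n = (LEAST n. \<exists>v \<in> lists X. word_value G \<phi> v = g \<and> length v = n)"
  have "\<exists>v \<in> lists X. word_value G \<phi> v = g \<and> length v = n"
    unfolding n_def by (rule LeastI_ex) (use w in blast)
  then obtain v where v: "v \<in> lists X" "word_value G \<phi> v = g" "length v = n"
    by blast
  have n_le: "n \<le> length u" if "u \<in> lists X" "word_value G \<phi> u = g" for u
    unfolding n_def by (rule Least_le) (use that in blast)
  have vA: "v \<in> ?A"
    using v n_le by (auto simp: geodesics_def)
  have len: "length u = n" if "u \<in> ?A" for u
    using that v n_le[of u] by (force simp: geodesics_def)
  have "?A \<subseteq> {u. set u \<subseteq> X \<and> length u = n}"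
    using len by (auto simp: geodesics_def)
  then have fin: "finite ?A"
    using finite_lists_length_eq[OF X] finite_subset by blast
  have irr: "(u, u) \<notin> lexord ?r" for u
    by (rule lexord_irreflexive) auto
  have tr: "trans (lexord ?r)"
    using r(1) by (rule lexord_transI)
  define q where "q = lexord ?r \<inter> ?A \<times> ?A"
  have "trans q" "irrefl q"
    using tr irr unfolding q_def by (auto simp: trans_def irrefl_def)
  moreover have "finite q"
    using fin unfolding q_def by blast
  ultimately have wf: "wf q"
    by (simp add: finite_acyclic_wf acyclic_irrefl)
  have "\<exists>u \<in> ?A. \<forall>y. (y, u) \<in> q \<longrightarrow> y \<notin> ?A"
    by (rule wfE_min[OF wf vA]) (intro bexI allI impI)
  then obtain u where u: "u \<in> ?A" "\<And>y. (y, u) \<in> q \<Longrightarrow> y \<notin> ?A"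
    by blast
  have "(u, y) \<in> lexord ?r" if "y \<in> ?A" "y \<noteq> u" for y
  proof -
    have l: "u \<in> lists X" "y \<in> lists X"
      using that(1) u(1) unfolding geodesics_def by blast+
    have "length u = length y"
      by (simp only: len[OF u(1)] len[OF that(1)])
    then have "(u, y) \<in> lexord ?r \<or> (y, u) \<in> lexord ?r"
      using l that(2)[symmetric] by (rule lexord_total_same_length[OF r(3)])
    moreover have "(y, u) \<notin> lexord ?r"
    proof
      assume "(y, u) \<in> lexord ?r"
      then have "(y, u) \<in> q" using u(1) that(1) by (simp add: q_def)
      then show False using u(2) that(1) by simp
    qed
    ultimately show ?thesis by simp
  qed
  then have nf: "is_shortlex_nf G X \<phi> ord g u"
    using u(1) by (simp add: is_shortlex_nf_def)
  have "u' = u" if nf': "is_shortlex_nf G X \<phi> ord g u'" for u'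
  proof (rule ccontr)
    assume "u' \<noteq> u"
    then have "(u, u') \<in> lexord ?r" "(u', u) \<in> lexord ?r"
      using nf nf' by (simp_all add: is_shortlex_nf_def)
    then have "(u, u) \<in> lexord ?r" by (rule transD[OF tr])
    then show False using irr by simp
  qed
  then show ?thesis using nf by (rule ex1I[rotated])
qed

section \<open>Deterministic logspace transducers\<close>

text \<open>
  The input is delimited by end markers. The work tape is infinite to the right and
  initially blank; at most one output letter is written per step. States and work
  symbols are natural numbers; a transition result \<open>None\<close> means halting.
\<close>

datatype 'i input_cell = LeftEnd | Input 'i | RightEnd

datatype direction = GoLeft | Stay | GoRight

record ('i, 'o) transducer =
  tr_states :: "nat set"
  tr_symbols :: "nat set"
  tr_start :: nat
  tr_blank :: nat
  tr_delta :: "nat \<Rightarrow> 'i input_cell \<Rightarrow> nat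
    \<Rightarrow> (nat \<times> nat \<times> direction \<times> direction \<times> 'o option) option"

definition wf_transducer :: "'i set \<Rightarrow> 'o set \<Rightarrow> ('i, 'o) transducer \<Rightarrow> bool" where
  "wf_transducer A B M \<longleftrightarrow>
    finite A \<and> finite B \<and> finite (tr_states M) \<and> finite (tr_symbols M) \<and>
    tr_start M \<in> tr_states M \<and> tr_blank M \<in> tr_symbols M \<and>
    (\<forall>q \<in> tr_states M. \<forall>x \<in> {LeftEnd, RightEnd} \<union> Input ` A. \<forall>s \<in> tr_symbols M.
      case tr_delta M q x s of
        None \<Rightarrow> True
      | Some (q', s', d, e, out) \<Rightarrow>
          q' \<in> tr_states M \<and> s' \<in> tr_symbols M \<and> set_option out \<subseteq> B)"

record 'o configuration =
  state :: nat
  input_head :: nat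
  work_tape :: "nat \<Rightarrow> nat"
  work_head :: nat
  output_tape :: "'o list"

definition input_at :: "'i list \<Rightarrow> nat \<Rightarrow> 'i input_cell" where
  "input_at w i = (if i = 0 then LeftEnd else if i \<le> length w then Input (w ! (i - 1)) else RightEnd)"

text \<open>Truncated subtraction: a move to the left from position \<open>0\<close> has no effect.\<close>

fun move_head :: "direction \<Rightarrow> nat \<Rightarrow> nat" where
  "move_head GoLeft i = i - 1"
| "move_head Stay i = i"
| "move_head GoRight i = i + 1"

definition initial :: "('i, 'o) transducer \<Rightarrow> 'o configuration" where
  "initial M = \<lparr>state = tr_start M, input_head = 0, work_tape = (\<lambda>_. tr_blank M),
    work_head = 0, output_tape = []\<rparr>"

definition step :: "('i, 'o) transducer \<Rightarrow> 'i list \<Rightarrow> 'o configuration \<Rightarrow> 'o configuration option" where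
  "step M w c =
    (case tr_delta M (state c) (input_at w (input_head c)) (work_tape c (work_head c)) of
      None \<Rightarrow> None
    | Some (q, s, d, e, out) \<Rightarrow> Some
        \<lparr>state = q,
         input_head = min (move_head d (input_head c)) (length w + 1),
         work_tape = (work_tape c)(work_head c := s),
         work_head = move_head e (work_head c),
         output_tape = output_tape c @ (case out of None \<Rightarrow> [] | Some y \<Rightarrow> [y])\<rparr>)"

definition reachable :: "('i, 'o) transducer \<Rightarrow> 'i list \<Rightarrow> 'o configuration \<Rightarrow> bool" where
  "reachable M w c \<longleftrightarrow> (\<lambda>c c'. step M w c = Some c')\<^sup>*\<^sup>* (initial M) c"

definition computes :: "('i, 'o) transducer \<Rightarrow> 'i set \<Rightarrow> ('i list \<Rightarrow> 'o list) \<Rightarrow> bool" where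
  "computes M A f \<longleftrightarrow>
    (\<forall>w \<in> lists A. \<exists>c. reachable M w c \<and> step M w c = None \<and> output_tape c = f w)"

definition runs_in_space :: "('i, 'o) transducer \<Rightarrow> 'i set \<Rightarrow> (nat \<Rightarrow> nat) \<Rightarrow> bool" where
  "runs_in_space M A s \<longleftrightarrow>
    (\<forall>w \<in> lists A. \<forall>c. reachable M w c \<longrightarrow> work_head c < s (length w))"

definition logspace_transducer :: "'i set \<Rightarrow> 'o set \<Rightarrow> ('i, 'o) transducer \<Rightarrow> bool" where
  "logspace_transducer A B M \<longleftrightarrow> wf_transducer A B M \<and>
    (\<exists>s. (\<lambda>n. real (s n)) \<in> O(\<lambda>n. ln (real n)) \<and> runs_in_space M A s)"

end

theory Submission
  imports Defs
begin

text \<open>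
  Both groups are treated uniformly: the alphabet \<open>X\<close> carries an involution \<open>iv\<close>
  (formal inversion for graph groups, the identity for Coxeter groups) and an independence relation
  \<open>J\<close>. The group acts on integer vectors through the geometric representation of a
  right-angled Coxeter group; a generator \<open>a\<close> of a graph group acts as the product of the two
  non-commuting reflections that belong to \<open>a\<close> and to its formal inverse. A word is a path
  that crosses a sequence of walls, each given by the image, up to sign, of a fixed vector under the
  preceding prefix. Keeping the first crossing of every wall that is crossed an odd number of
  times yields a geodesic subword. Whether two positions cross the same wall is an equality of integer
  vectors with entries of linear bit length; it is tested modulo all numbers up to a linear bound.
  The shortlex normal form is the lexicographically first linearization of the geodesic; as equal
  letters are output in their order of occurrence, the letters already output are
  described by one counter for each letter of the alphabet.
\<close>

section \<open>Words and reduction\<close>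

text \<open>The obstacle is memory: a reduced word is as long as the input, so whether a letter
  survives cancellation must be decided from the input alone. Walls allow this, since cancelling
  letters cross the same wall in opposite directions and deleting them leaves the walls of all other
  letters in place (\<open>kept_zip_walls\<close>). The vectors come from root systems. For the
  bilinear form with 1 on the diagonal, 0 on independent pairs and -1 on the other pairs of distinct
  letters, \<open>reflect b\<close> is the reflection s_b in the simple root e_b. A graph group
  letter x acts as s_x s_{iv x}, so its edge crosses two walls of the Coxeter group, with roots e_x
  and s_x(e_{iv x}) = e_{iv x} + 2 e_x; their sum 3 e_x + e_{iv x} is \<open>rho x\<close>. That a
  reduced path does not cross back is the positivity of roots, obtained here from an entrywise
  growth estimate. The moduli are all integers of a range and not only primes: the machine then
  needs no primality test, and an elementary argument bounds the least common multiple of 1, ..., 2k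
  below by 2^k.\<close>

locale inv_alphabet =
  fixes X :: "'x set" and iv :: "'x \<Rightarrow> 'x" and J :: "('x \<times> 'x) set"
  assumes finite_X: "finite X"
    and iv_X: "x \<in> X \<Longrightarrow> iv x \<in> X"
    and iv_iv [simp]: "iv (iv x) = x"
    and J_X: "J \<subseteq> X \<times> X"
    and J_sym: "(x, y) \<in> J \<Longrightarrow> (y, x) \<in> J"
    and J_irrefl [simp]: "(x, x) \<notin> J"
    and J_iv_self: "(x, iv x) \<notin> J"
    and J_iv: "(x, y) \<in> J \<Longrightarrow> (iv x, y) \<in> J"
begin

lemma iv_eq_iff [simp]: "iv x = iv y \<longleftrightarrow> x = y"
  by (metis iv_iv)

lemma iv_X_iff [simp]: "iv x \<in> X \<longleftrightarrow> x \<in> X"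
  by (metis iv_X iv_iv)

lemma J_iv_iff [simp]:
  "(iv x, y) \<in> J \<longleftrightarrow> (x, y) \<in> J"
  "(x, iv y) \<in> J \<longleftrightarrow> (x, y) \<in> J"
  by (metis J_iv J_sym iv_iv)+

lemma J_commute: "(x, y) \<in> J \<longleftrightarrow> (y, x) \<in> J"
  by (metis J_sym)

lemma J_neq: "(x, y) \<in> J \<Longrightarrow> x \<noteq> y \<and> iv x \<noteq> y \<and> x \<noteq> iv y"
  using J_iv_self by fastforce

fun front :: "'x \<Rightarrow> 'x list \<Rightarrow> bool" where
  "front x [] = False"
| "front x (y # u) = (x = y \<or> (x, y) \<in> J \<and> front x u)"

fun reduced :: "'x list \<Rightarrow> bool" where
  "reduced [] = True"
| "reduced (x # u) = (\<not> front (iv x) u \<and> reduced u)"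

text \<open>Left multiplication of a reduced word by a letter. Up to \<open>teq\<close> this is an
  action of the group on reduced words, which takes the place of a confluence argument.\<close>

definition ins :: "'x \<Rightarrow> 'x list \<Rightarrow> 'x list" where
  "ins x u = (if front (iv x) u then remove1 (iv x) u else x # u)"

definition red :: "'x list \<Rightarrow> 'x list" where
  "red w = foldr ins w []"

lemma red_simps [simp]: "red [] = []" "red (x # w) = ins x (red w)"
  by (simp_all add: red_def)

lemma red_append: "red (u @ v) = foldr ins u (red v)"
  by (simp add: red_def)

text \<open>
  Equality in the partially commutative monoid, in terms of the projections to pairs of
  dependent letters.
\<close>

definition teq :: "'x list \<Rightarrow> 'x list \<Rightarrow> bool" where
  "teq u v \<longleftrightarrow> (\<forall>a b. (a, b) \<notin> J \<longrightarrow>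
    filter (\<lambda>z. z = a \<or> z = b) u = filter (\<lambda>z. z = a \<or> z = b) v)"

lemma teq_refl [simp]: "teq u u"
  and teq_sym: "teq u v \<Longrightarrow> teq v u"
  and teq_trans [trans]: "teq u v \<Longrightarrow> teq v w \<Longrightarrow> teq u w"
  by (simp_all add: teq_def)

lemma teq_Cons: "teq u v \<Longrightarrow> teq (x # u) (x # v)"
  by (simp add: teq_def)

lemma teq_swap: "(x, y) \<in> J \<Longrightarrow> teq (x # y # u) (y # x # u)"
  using J_sym by (auto simp: teq_def)

lemma teq_remove1: "teq u v \<Longrightarrow> teq (remove1 x u) (remove1 x v)"
  by (simp add: teq_def filter_remove1)

text \<open>Letters independent of \<open>x\<close> are invisible in these projections, so only
  dependent letters before the first \<open>x\<close> matter; the choice \<open>y = x\<close> forces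
  \<open>x\<close> to occur. In this form \<open>front\<close> is evidently invariant under
  \<open>teq\<close>.\<close>

lemma front_iff_projections:
  "front x u \<longleftrightarrow> (\<forall>y. (x, y) \<notin> J \<longrightarrow> (\<exists>r. filter (\<lambda>z. z = x \<or> z = y) u = x # r))"
proof (induction u)
  case Nil
  then show ?case using J_irrefl[of x] by (auto simp del: J_irrefl)
next
  case (Cons z u)
  show ?case
  proof (cases "z = x")
    case False
    show ?thesis
    proof (cases "(x, z) \<in> J")
      case True
      then have "filter (\<lambda>a. a = x \<or> a = y) (z # u) = filter (\<lambda>a. a = x \<or> a = y) u"
        if "(x, y) \<notin> J" for y using that False by auto
      then show ?thesis using Cons True False by auto
    next
      case J: False
      then have "\<not> (\<exists>r. filter (\<lambda>a. a = x \<or> a = z) (z # u) = x # r)"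
        using False by simp
      then show ?thesis using J False by fastforce
    qed
  qed simp
qed

lemma teq_front: "teq u v \<Longrightarrow> front x u \<longleftrightarrow> front x v"
  by (simp add: front_iff_projections teq_def)

lemma front_in_set: "front x u \<Longrightarrow> x \<in> set u"
  by (induction u) auto

lemma teq_front_remove1: "front x u \<Longrightarrow> teq (x # remove1 x u) u"
proof (induction u)
  case (Cons z u)
  show ?case
  proof (cases "z = x")
    case False
    with Cons.prems have J: "(x, z) \<in> J" and f: "front x u" by auto
    have "teq (x # z # remove1 x u) (z # x # remove1 x u)"
      by (rule teq_swap[OF J])
    also have "teq \<dots> (z # u)"
      by (rule teq_Cons[OF Cons.IH[OF f]])
    finally show ?thesis using False by simp
  qed simp
qed simp

lemma front_split:
  "front x u \<longleftrightarrow> (\<exists>p q. u = p @ x # q \<and> (\<forall>y \<in> set p. (x, y) \<in> J))"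
proof
  show "\<exists>p q. u = p @ x # q \<and> (\<forall>y \<in> set p. (x, y) \<in> J)" if "front x u"
    using that
  proof (induction u)
    case (Cons z u)
    show ?case
    proof (cases "x = z")
      case False
      with Cons obtain p q where "u = p @ x # q" "\<forall>y \<in> set p. (x, y) \<in> J" by auto
      with Cons.prems False show ?thesis
        by (intro exI[of _ "z # p"] exI[of _ q]) auto
    qed (intro exI[of _ "[]"] exI[of _ u], simp)
  qed simp
  have "front x (p @ x # q)" if "\<forall>y \<in> set p. (x, y) \<in> J" for p q
    using that by (induction p) auto
  then show "front x u" if "\<exists>p q. u = p @ x # q \<and> (\<forall>y \<in> set p. (x, y) \<in> J)"
    using that by blast
qed

lemma teq_imp_length: "teq u v \<Longrightarrow> length u = length v"
proof (induction u arbitrary: v)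
  case Nil
  have "v = []"
  proof (cases v)
    case (Cons y v')
    have "filter (\<lambda>z. z = y \<or> z = y) [] = filter (\<lambda>z. z = y \<or> z = y) v"
      using Nil J_irrefl unfolding teq_def by blast
    then show ?thesis using Cons by simp
  qed simp
  then show ?case by simp
next
  case (Cons x u)
  have f: "front x v" using teq_front[OF Cons.prems, of x] by simp
  have "teq u (remove1 x v)" using teq_remove1[OF Cons.prems, of x] by simp
  then have "length u = length (remove1 x v)" by (rule Cons.IH)
  moreover have "length v > 0" using front_in_set[OF f] by (cases v) auto
  ultimately show ?case using front_in_set[OF f] by (simp add: length_remove1)
qed

lemma teq_imp_set: "teq u v \<Longrightarrow> set u = set v"
proof (rule Set.set_eqI)
  fix y assume "teq u v"
  then have "filter (\<lambda>z. z = y \<or> z = y) u = filter (\<lambda>z. z = y \<or> z = y) v"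
    using J_irrefl unfolding teq_def by blast
  then have "set (filter (\<lambda>z. z = y) u) = set (filter (\<lambda>z. z = y) v)" by simp
  then show "y \<in> set u \<longleftrightarrow> y \<in> set v" by auto
qed

lemma ins_cong: "teq u v \<Longrightarrow> teq (ins x u) (ins x v)"
  by (simp add: ins_def teq_front teq_remove1 teq_Cons)

lemma foldr_ins_cong: "teq u v \<Longrightarrow> teq (foldr ins p u) (foldr ins p v)"
  by (induction p) (auto intro: ins_cong)

lemma reduced_not_front_iv:
  "reduced u \<Longrightarrow> front x u \<Longrightarrow> \<not> front (iv x) (remove1 x u)"
proof (induction u)
  case (Cons z u)
  then show ?case using J_neq[of x z] J_iv_iff(1)[of x z] by auto
qed simp

text \<open>The delicate case is an accessible \<open>x\<close> in \<open>u\<close>: once it is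
  removed, \<open>iv x\<close> must not be accessible, or \<open>ins x\<close> would delete a second
  letter instead of putting \<open>x\<close> back. Reducedness excludes this.\<close>

lemma ins_iv: "reduced u \<Longrightarrow> teq (ins x (ins (iv x) u)) u"
  using reduced_not_front_iv[of u x] teq_front_remove1[of x u] by (auto simp: ins_def)

lemma front_Cons_indep: "(x, y) \<in> J \<Longrightarrow> front x (y # u) = front x u"
  using J_neq by auto

lemma front_remove1_indep:
  assumes "(x, y) \<in> J" "front y u"
  shows "front x (remove1 y u) = front x u"
  using teq_front[OF teq_front_remove1[OF assms(2)], of x] front_Cons_indep[OF assms(1)] by simp

text \<open>Inserting or deleting a letter does not change whether a letter independent of it is
  accessible, so both orders take the same branches.\<close>

lemma ins_commute:
  assumes J: "(x, y) \<in> J"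
  shows "teq (ins x (ins y u)) (ins y (ins x u))"
proof -
  have J': "(y, x) \<in> J" using J J_sym by simp
  have ne: "iv x \<noteq> y" "iv y \<noteq> x" using J_neq[OF J] by auto
  have f: "front (iv x) (ins y u) = front (iv x) u"
    using J by (cases "front (iv y) u") (auto simp: ins_def front_remove1_indep front_Cons_indep
      simp del: front.simps)
  have g: "front (iv y) (ins x u) = front (iv y) u"
    using J' by (cases "front (iv x) u") (auto simp: ins_def front_remove1_indep front_Cons_indep
      simp del: front.simps)
  show ?thesis
    unfolding ins_def[of x "ins y u"] ins_def[of y "ins x u"] f g
    using ne teq_swap[OF J, of u] by (auto simp: ins_def remove1_commute)
qed

lemma reduced_remove1: "reduced u \<Longrightarrow> front x u \<Longrightarrow> reduced (remove1 x u)"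
proof (induction u)
  case (Cons z u)
  show ?case
  proof (cases "z = x")
    case False
    with Cons.prems have J: "(x, z) \<in> J" and f: "front x u" by auto
    have "front (iv z) (remove1 x u) = front (iv z) u"
      using J f by (intro front_remove1_indep) (auto intro: J_sym)
    then show ?thesis using Cons f False by auto
  qed (use Cons in auto)
qed simp

lemma reduced_ins: "reduced u \<Longrightarrow> reduced (ins x u)"
  by (simp add: ins_def reduced_remove1)

lemma reduced_red: "reduced (red w)"
  by (induction w) (auto intro: reduced_ins)

lemma red_reduced: "reduced u \<Longrightarrow> red u = u"
  by (induction u) (auto simp: ins_def)

lemma length_ins_le: "length (ins x u) \<le> Suc (length u)"
  by (auto simp: ins_def length_remove1)

lemma length_red_le: "length (red w) \<le> length w"
  by (induction w) (auto intro: order_trans[OF length_ins_le])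

lemma length_red_less: "\<not> reduced w \<Longrightarrow> length (red w) < length w"
proof (induction w)
  case (Cons x w)
  show ?case
  proof (cases "reduced w")
    case True
    then have f: "front (iv x) w" using Cons.prems by simp
    then have "red (x # w) = remove1 (iv x) w"
      by (simp add: red_reduced[OF True] ins_def)
    then show ?thesis using length_remove1[of "iv x" w] by (simp split: if_splits)
  next
    case False
    then show ?thesis
      using Cons.IH length_ins_le[of x "red w"] by simp
  qed
qed simp

lemma set_ins: "set (ins x u) \<subseteq> insert x (set u)"
  using set_remove1_subset[of "iv x" u] by (auto simp: ins_def)

lemma set_red: "set (red w) \<subseteq> set w"
  by (induction w) (use set_ins in \<open>fastforce+\<close>)

text \<open>Together with \<open>red_swap\<close> this makes \<open>red\<close> respect the defining
  relations, so that words of equal value have equivalent reductions: the hard direction of the word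
  problem.\<close>

lemma red_cancel: "teq (red (p @ [x, iv x] @ q)) (red (p @ q))"
  using foldr_ins_cong[OF ins_iv[OF reduced_red]] by (simp add: red_append)

lemma red_swap: "(x, y) \<in> J \<Longrightarrow> teq (red (p @ [x, y] @ q)) (red (p @ [y, x] @ q))"
  using foldr_ins_cong[OF ins_commute] by (simp add: red_append)

section \<open>Lexicographically first words\<close>

text \<open>Greedy choice; \<open>xs\<close> is meant to list the alphabet in increasing order and
  \<open>n\<close> is fuel. Surplus fuel is harmless, as nothing is produced once no letter is
  accessible.\<close>

primrec lexnf :: "'x list \<Rightarrow> nat \<Rightarrow> 'x list \<Rightarrow> 'x list" where
  "lexnf xs 0 u = []"
| "lexnf xs (Suc n) u = (case find (\<lambda>x. front x u) xs of None \<Rightarrow> []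
    | Some x \<Rightarrow> x # lexnf xs n (remove1 x u))"

lemma lexnf_Nil [simp]: "lexnf xs n [] = []"
proof -
  have "find (\<lambda>x. False) xs = None" by (simp add: find_None_iff)
  then show ?thesis by (cases n) simp_all
qed

lemma find_front:
  assumes "set u \<subseteq> set xs" "u \<noteq> []"
  obtains x where "find (\<lambda>x. front x u) xs = Some x" "front x u"
proof -
  obtain y u' where u: "u = y # u'" using assms(2) by (cases u) auto
  then have "front y u" "y \<in> set xs" using assms by auto
  then have "find (\<lambda>x. front x u) xs \<noteq> None" unfolding find_None_iff by blast
  then obtain x where "find (\<lambda>x. front x u) xs = Some x" by blast
  moreover from this have "front x u" unfolding find_Some_iff by auto
  ultimately show thesis by (rule that)
qed

lemma teq_lexnf: "set u \<subseteq> set xs \<Longrightarrow> length u \<le> n \<Longrightarrow> teq (lexnf xs n u) u"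
proof (induction n arbitrary: u)
  case (Suc n)
  show ?case
  proof (cases "u = []")
    case False
    from find_front[OF Suc.prems(1) False] obtain x
      where x: "find (\<lambda>x. front x u) xs = Some x" "front x u" by blast
    have "teq (lexnf xs n (remove1 x u)) (remove1 x u)"
      using Suc.prems front_in_set[OF x(2)] set_remove1_subset[of x u]
      by (intro Suc.IH) (auto simp: length_remove1)
    then show ?thesis
      using x teq_trans[OF teq_Cons teq_front_remove1[OF x(2)]] by simp
  qed simp
qed simp

text \<open>If \<open>v\<close> starts with a letter other than the greedy choice, that letter is
  accessible too and hence comes later in \<open>xs\<close>. If the first letters agree, both are
  removed and the induction continues.\<close>

lemma lexnf_least:
  assumes ord: "sorted_wrt (\<lambda>a b. (a, b) \<in> r) xs"
  shows "set u \<subseteq> set xs \<Longrightarrow> length u \<le> n \<Longrightarrow> teq v u \<Longrightarrow> v \<noteq> lexnf xs n u \<Longrightarrow>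
    (lexnf xs n u, v) \<in> lexord r"
proof (induction n arbitrary: u v)
  case 0
  then show ?case using teq_imp_length by fastforce
next
  case (Suc n)
  show ?case
  proof (cases "u = []")
    case True
    then have "v = []" using Suc.prems(3) teq_imp_length by fastforce
    then show ?thesis using Suc.prems(4) True by simp
  next
    case False
    from find_front[OF Suc.prems(1) False] obtain x
      where x: "find (\<lambda>x. front x u) xs = Some x" "front x u" by blast
    have "v \<noteq> []" using Suc.prems(3) False teq_imp_length by fastforce
    then obtain y v' where v: "v = y # v'" by (cases v) auto
    have fy: "front y u" using teq_front[OF Suc.prems(3), of y] v by simp
    show ?thesis
    proof (cases "y = x")
      case True
      have "teq v' (remove1 x u)" using teq_remove1[OF Suc.prems(3), of x] v True by simp
      then have "v' \<noteq> lexnf xs n (remove1 x u) \<Longrightarrow> (lexnf xs n (remove1 x u), v') \<in> lexord r"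
        using Suc.prems front_in_set[OF x(2)] set_remove1_subset[of x u]
        by (intro Suc.IH) (auto simp: length_remove1)
      then show ?thesis using x v True Suc.prems(4) by auto
    next
      case False
      obtain i where i: "i < length xs" "x = xs ! i" "\<forall>j<i. \<not> front (xs ! j) u"
        using x(1) unfolding find_Some_iff by auto
      obtain j where j: "j < length xs" "xs ! j = y"
        using Suc.prems(1) front_in_set[OF fy] by (metis in_set_conv_nth subsetD)
      have "i < j" using i j fy False by (metis linorder_neqE_nat)
      then have "(x, y) \<in> r" using ord i j unfolding sorted_wrt_iff_nth_less by blast
      then show ?thesis using x v by simp
    qed
  qed
qed

end

section \<open>A linear representation\<close>

context inv_alphabet
begin

text \<open>As \<open>(b, iv b)\<close> is never in \<open>J\<close>, the letter \<open>iv b\<close>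
  counts as a neighbour of \<open>b\<close> whenever it differs from \<open>b\<close>; the two
  reflections behind a graph group generator therefore do not commute and their product has infinite
  order.\<close>

definition nbsum :: "'x \<Rightarrow> ('x \<Rightarrow> int) \<Rightarrow> int" where
  "nbsum b v = (\<Sum>c \<in> {c \<in> X. c \<noteq> b \<and> (b, c) \<notin> J}. v c)"

definition reflect :: "'x \<Rightarrow> ('x \<Rightarrow> int) \<Rightarrow> 'x \<Rightarrow> int" where
  "reflect b v = v(b := 2 * nbsum b v - v b)"

definition act :: "'x \<Rightarrow> ('x \<Rightarrow> int) \<Rightarrow> 'x \<Rightarrow> int" where
  "act x v = reflect x (if iv x = x then v else reflect (iv x) v)"

definition rho :: "'x \<Rightarrow> 'x \<Rightarrow> int" where
  "rho x = (\<lambda>y. if y = x then (if iv x = x then 1 else 3) else if y = iv x then 1 else 0)"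

definition scale :: "int \<Rightarrow> ('x \<Rightarrow> int) \<Rightarrow> 'x \<Rightarrow> int" where
  "scale k v = (\<lambda>y. k * v y)"

definition sim :: "('x \<Rightarrow> int) \<Rightarrow> ('x \<Rightarrow> int) \<Rightarrow> bool" where
  "sim u v \<longleftrightarrow> u = v \<or> u = scale (-1) v"

lemma nbsum_upd:
  "nbsum b (v(c := z)) =
    (if c \<in> X \<and> c \<noteq> b \<and> (b, c) \<notin> J then nbsum b v + z - v c else nbsum b v)"
proof (cases "c \<in> X \<and> c \<noteq> b \<and> (b, c) \<notin> J")
  case True
  let ?A = "{c \<in> X. c \<noteq> b \<and> (b, c) \<notin> J}"
  have A: "finite ?A" "c \<in> ?A" using finite_X True by auto
  show ?thesis
    using True sum.remove[OF A, of v] sum.remove[OF A, of "v(c := z)"]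
    by (simp add: nbsum_def)
next
  case False
  then have "nbsum b (v(c := z)) = nbsum b v"
    unfolding nbsum_def by (intro sum.cong) auto
  then show ?thesis using False by (simp only: if_False)
qed

lemma nbsum_scale: "nbsum b (scale k v) = k * nbsum b v"
  by (simp add: nbsum_def scale_def sum_distrib_left)

lemma nbsum_eq_0: "(\<And>c. c \<noteq> b \<Longrightarrow> (b, c) \<notin> J \<Longrightarrow> v c = 0) \<Longrightarrow> nbsum b v = 0"
  by (simp add: nbsum_def)

lemma nbsum_ge: "(\<And>c. v c \<ge> 0) \<Longrightarrow> c \<in> X \<Longrightarrow> c \<noteq> b \<Longrightarrow> (b, c) \<notin> J \<Longrightarrow> v c \<le> nbsum b v"
  unfolding nbsum_def by (rule member_le_sum) (use finite_X in auto)

lemma reflect_reflect [simp]: "reflect b (reflect b v) = v"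
  by (auto simp: reflect_def nbsum_upd)

lemma reflect_commute: "(b, c) \<in> J \<Longrightarrow> reflect b (reflect c v) = reflect c (reflect b v)"
  using J_neq[of b c] J_sym[of b c] by (auto simp: reflect_def nbsum_upd fun_upd_twist)

lemma reflect_scale: "reflect b (scale k v) = scale k (reflect b v)"
  by (rule ext) (simp add: reflect_def nbsum_scale, simp add: scale_def algebra_simps)

lemma act_scale: "act x (scale k v) = scale k (act x v)"
  by (simp add: act_def reflect_scale)

lemma act_act_iv [simp]: "act x (act (iv x) v) = v" "act (iv x) (act x v) = v"
  by (simp_all add: act_def)

lemma act_commute: "(x, y) \<in> J \<Longrightarrow> act x (act y v) = act y (act x v)"
  by (simp add: act_def reflect_commute[of x] reflect_commute[of "iv x"] J_commute)

lemma foldr_act_commute: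
  "\<forall>y \<in> set p. (x, y) \<in> J \<Longrightarrow> act x (foldr act p v) = foldr act p (act x v)"
  by (induction p) (simp_all add: act_commute)

lemma reflect_rho_indep: "(x, y) \<in> J \<Longrightarrow> reflect x (rho y) = rho y"
proof -
  assume J: "(x, y) \<in> J"
  have "nbsum x (rho y) = 0"
  proof (rule nbsum_eq_0)
    fix c assume "(x, c) \<notin> J"
    then have "c \<noteq> y" "c \<noteq> iv y" using J by auto
    then show "rho y c = 0" by (simp add: rho_def)
  qed
  then show ?thesis using J_neq[OF J] by (auto simp: reflect_def rho_def)
qed

lemma act_rho_indep: "(x, y) \<in> J \<Longrightarrow> act x (rho y) = rho y"
  by (simp add: act_def reflect_rho_indep)

lemma foldr_act_rho_indep: "\<forall>y \<in> set p. (x, y) \<in> J \<Longrightarrow> foldr act p (rho x) = rho x"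
  by (induction p) (simp_all add: act_rho_indep J_commute)

definition rest :: "'x \<Rightarrow> ('x \<Rightarrow> int) \<Rightarrow> int" where
  "rest x v = (\<Sum>c \<in> {c \<in> X. c \<noteq> x \<and> c \<noteq> iv x \<and> (x, c) \<notin> J}. v c)"

lemma nbsum_rest:
  assumes "x \<in> X" "iv x \<noteq> x"
  shows "nbsum x v = v (iv x) + rest x v" "nbsum (iv x) v = v x + rest x v"
proof -
  let ?A = "{c \<in> X. c \<noteq> x \<and> c \<noteq> iv x \<and> (x, c) \<notin> J}"
  have fin: "finite ?A" using finite_X by simp
  have "{c \<in> X. c \<noteq> x \<and> (x, c) \<notin> J} = insert (iv x) ?A"
    using assms by auto
  then show "nbsum x v = v (iv x) + rest x v"
    using fin by (simp add: nbsum_def rest_def)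
  have "{c \<in> X. c \<noteq> iv x \<and> (iv x, c) \<notin> J} = insert x ?A"
    using assms by auto
  then show "nbsum (iv x) v = v x + rest x v"
    using fin by (simp add: nbsum_def rest_def)
qed

lemma act_eq_involution: "iv x = x \<Longrightarrow> act x v = v(x := 2 * nbsum x v - v x)"
  by (simp add: act_def reflect_def)

lemma act_eq:
  assumes "x \<in> X" "iv x \<noteq> x"
  shows "act x v = v(x := 3 * v x - 2 * v (iv x) + 6 * rest x v,
    iv x := 2 * v x - v (iv x) + 2 * rest x v)"
proof -
  let ?t = "v(iv x := 2 * nbsum (iv x) v - v (iv x))"
  have "rest x ?t = rest x v"
    unfolding rest_def by (intro sum.cong) auto
  then have "nbsum x ?t = 2 * nbsum (iv x) v - v (iv x) + rest x v"
    using nbsum_rest[OF assms, of ?t] by simp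
  then show ?thesis
    using assms nbsum_rest(2)[OF assms, of v]
    by (auto simp: act_def reflect_def)
qed

lemma act_rho_iv:
  assumes "x \<in> X"
  shows "act x (rho (iv x)) = scale (-1) (rho x)"
proof (cases "iv x = x")
  case True
  have "nbsum x (rho x) = 0"
    by (rule nbsum_eq_0) (simp add: rho_def True)
  then show ?thesis
    by (auto simp: act_eq_involution True rho_def scale_def)
next
  case False
  have "rest x (rho (iv x)) = 0"
    unfolding rest_def by (rule sum.neutral) (auto simp: rho_def)
  then show ?thesis
    using False by (auto simp: act_eq[OF assms False] rho_def scale_def)
qed

lemma rho_nonneg: "0 \<le> rho x c"
  by (simp add: rho_def)

text \<open>The hypothesis says that the reflection applied first does not lower its coordinate
  \<open>iv x\<close>; then the second one cannot lower \<open>x\<close> either. The second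
  conclusion supplies the hypothesis for a dependent letter prepended next, the third one for
  another copy of \<open>x\<close>.\<close>

lemma act_increases:
  assumes x: "x \<in> X" and pos: "\<And>c. 0 \<le> v c" and le: "v (iv x) \<le> nbsum (iv x) v"
  shows "v c \<le> act x v c"
    and "c \<in> X \<Longrightarrow> c \<noteq> x \<Longrightarrow> c \<noteq> iv x \<Longrightarrow> (x, c) \<notin> J \<Longrightarrow> v c \<le> act x v x"
    and "iv x \<noteq> x \<Longrightarrow> act x v (iv x) \<le> nbsum (iv x) (act x v)"
proof -
  have r0: "0 \<le> rest x v" unfolding rest_def by (rule sum_nonneg) (simp add: pos)
  have rc: "v c \<le> rest x v" if "c \<in> X" "c \<noteq> x" "c \<noteq> iv x" "(x, c) \<notin> J" for c
    unfolding rest_def by (rule member_le_sum) (use that pos finite_X in auto)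
  have le': "v (iv x) \<le> v x + rest x v" if "iv x \<noteq> x"
    using le nbsum_rest(2)[OF x that, of v] by simp
  show "v c \<le> act x v c"
  proof (cases "iv x = x")
    case True
    then show ?thesis using le by (simp add: act_eq_involution)
  next
    case False
    then show ?thesis using le' r0 pos[of x] by (simp add: act_eq x)
  qed
  show "v c \<le> act x v x" if c: "c \<in> X" "c \<noteq> x" "c \<noteq> iv x" "(x, c) \<notin> J"
  proof (cases "iv x = x")
    case True
    then show ?thesis using le nbsum_ge[of v c x] c pos by (simp add: act_eq_involution)
  next
    case False
    then show ?thesis using le' r0 rc[OF c] pos[of x] by (simp add: act_eq x)
  qed
  show "act x v (iv x) \<le> nbsum (iv x) (act x v)" if ne: "iv x \<noteq> x"
  proof -
    have "rest x (act x v) = rest x v"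
      unfolding rest_def by (intro sum.cong) (auto simp: act_eq x ne)
    then show ?thesis
      using nbsum_rest(2)[OF x ne, of "act x v"] ne r0 le' pos[of x] by (simp add: act_eq x)
  qed
qed

lemma act_eq_outside: "x \<in> X \<Longrightarrow> c \<noteq> x \<Longrightarrow> c \<noteq> iv x \<Longrightarrow> act x v c = v c"
  by (cases "iv x = x") (simp_all add: act_eq_involution act_eq)

lemma front_append: "front x u \<Longrightarrow> front x (u @ v)"
  by (induction u) auto

lemma reduced_prefix: "reduced (u @ v) \<Longrightarrow> reduced u"
  by (induction u) (auto simp: front_append)

lemma nbsum_act_indep:
  assumes "x \<in> X" "(z, x) \<in> J"
  shows "nbsum z (act x v) = nbsum z v"
  unfolding nbsum_def
proof (rule sum.cong)
  fix c assume c: "c \<in> {c \<in> X. c \<noteq> z \<and> (z, c) \<notin> J}"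
  then have "c \<noteq> x" "c \<noteq> iv x" using assms by auto
  then show "act x v c = v c" using assms(1) by (simp add: act_eq_outside)
qed simp

text \<open>
  The positivity argument: along a reduced word every new letter \<open>x\<close> meets a vector on which
  it is increasing. The vector can stay equal to \<open>rho y\<close> only if all letters commute with \<open>y\<close>.
\<close>

lemma foldr_act_rho:
  assumes "reduced (u @ [y])" "set u \<subseteq> X" "y \<in> X"
  defines "v \<equiv> foldr act u (rho y)"
  shows "(\<forall>c. rho y c \<le> v c) \<and>
    (\<forall>x \<in> X. \<not> front (iv x) (u @ [y]) \<longrightarrow> v (iv x) \<le> nbsum (iv x) v) \<and>
    ((\<forall>x \<in> set u. (y, x) \<in> J) \<or> (\<exists>c. rho y c < v c))"
  unfolding v_def using assms(1,2)
proof (induction u)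
  case Nil
  have "rho y (iv x) \<le> nbsum (iv x) (rho y)" if x: "x \<in> X" and ne: "iv x \<noteq> y" for x
  proof (cases "x = y")
    case True
    then have "iv y \<noteq> y" using ne by auto
    moreover have "rho y y \<le> nbsum (iv y) (rho y)"
      using \<open>iv y \<noteq> y\<close> J_iv_self[of y] J_irrefl[of y] \<open>y \<in> X\<close>
      by (intro nbsum_ge) (auto simp: rho_nonneg)
    ultimately show ?thesis using True by (simp add: rho_def)
  next
    case False
    then have "rho y (iv x) = 0" using ne by (simp add: rho_def)
    moreover have "0 \<le> nbsum (iv x) (rho y)"
      unfolding nbsum_def by (rule sum_nonneg) (simp add: rho_nonneg)
    ultimately show ?thesis by simp
  qed
  then show ?case by auto
next
  case (Cons x u)
  let ?v = "foldr act u (rho y)" and ?w = "u @ [y]"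
  let ?v' = "act x ?v"
  have x: "x \<in> X" and u: "set u \<subseteq> X" and nf: "\<not> front (iv x) ?w" and r: "reduced ?w"
    using Cons.prems by auto
  have ge: "\<And>c. rho y c \<le> ?v c"
    and inv: "\<And>z. z \<in> X \<Longrightarrow> \<not> front (iv z) ?w \<Longrightarrow> ?v (iv z) \<le> nbsum (iv z) ?v"
    and alt: "(\<forall>z \<in> set u. (y, z) \<in> J) \<or> (\<exists>c. rho y c < ?v c)"
    using Cons.IH[OF r u] by auto
  have pos: "0 \<le> ?v c" for c using ge[of c] rho_nonneg[of y c] by simp
  note inc = act_increases[OF x pos inv[OF x nf]]
  have ge': "rho y c \<le> ?v' c" for c using ge[of c] inc(1)[of c] by simp
  have pos': "0 \<le> ?v' c" for c using ge'[of c] rho_nonneg[of y c] by simp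
  have "?v' (iv z) \<le> nbsum (iv z) ?v'" if z: "z \<in> X" and nfz: "\<not> front (iv z) (x # ?w)" for z
  proof -
    have zx: "iv z \<noteq> x" and nz: "(iv z, x) \<in> J \<Longrightarrow> \<not> front (iv z) ?w" using nfz by auto
    show ?thesis
    proof (cases "(iv z, x) \<in> J")
      case True
      then have "iv z \<noteq> iv x" using J_neq[OF True] by auto
      then have "?v' (iv z) = ?v (iv z)" using x zx by (simp add: act_eq_outside)
      then show ?thesis using inv[OF z nz[OF True]] nbsum_act_indep[OF x True] by simp
    next
      case False
      show ?thesis
      proof (cases "z = x")
        case True
        then show ?thesis using inc(3) zx by auto
      next
        case ne: False
        \<comment> \<open>A coordinate dependent on \<open>x\<close> is dominated through
          \<open>x\<close> alone: it is at most the new coordinate \<open>x\<close>, which is a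
          summand of its \<open>nbsum\<close>.\<close>
        have "?v' (iv z) = ?v (iv z)" using x zx ne by (simp add: act_eq_outside)
        also have "\<dots> \<le> ?v' x"
          using inc(2)[of "iv z"] z zx ne False by (auto simp: J_commute)
        also have "\<dots> \<le> nbsum (iv z) ?v'"
          using x zx False by (intro nbsum_ge pos') auto
        finally show ?thesis .
      qed
    qed
  qed
  moreover have "(\<forall>z \<in> set (x # u). (y, z) \<in> J) \<or> (\<exists>c. rho y c < ?v' c)"
  proof (cases "\<exists>c. rho y c < ?v c")
    case True
    then show ?thesis using inc(1) by (meson less_le_trans)
  next
    case False
    then have u: "\<forall>z \<in> set u. (y, z) \<in> J" using alt by blast
    show ?thesis
    proof (cases "(y, x) \<in> J")
      case True
      then show ?thesis using u by simp
    next
      case xy: False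
      have v: "?v = rho y" by (rule foldr_act_rho_indep[OF u])
      \<comment> \<open>All of \<open>u\<close> commutes with \<open>y\<close>, so \<open>y\<close>
        is still accessible and reducedness rules out \<open>iv x = y\<close>. Hence
        \<open>x\<close> is either \<open>y\<close> itself or a letter whose coordinate was 0 and
        now receives at least the coordinate \<open>y\<close>.\<close>
      have "front y ?w" using u unfolding front_split by blast
      then have ne: "iv x \<noteq> y" using nf by auto
      have "rho y x < ?v' x"
      proof (cases "x = y")
        case True
        have "0 \<le> rest y (rho y)"
          unfolding rest_def by (rule sum_nonneg) (simp add: rho_nonneg)
        then show ?thesis using True ne v assms(3) by (auto simp: act_eq rho_def)
      next
        case False
        then have "x \<noteq> iv y" using ne by auto
        then have "rho y x = 0" using False by (simp add: rho_def)
        moreover have "rho y y \<le> ?v' x"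
          using inc(2)[of y] xy ne False assms(3) v by (auto simp: J_commute)
        moreover have "0 < rho y y" by (simp add: rho_def)
        ultimately show ?thesis by simp
      qed
      then show ?thesis by blast
    qed
  qed
  ultimately show ?case using ge' by simp
qed

lemma sim_refl [simp]: "sim v v"
  by (simp add: sim_def)

lemma scale_scale: "scale k (scale l v) = scale (k * l) v"
  by (simp add: scale_def mult.assoc)

lemma scale_1 [simp]: "scale 1 v = v"
  by (simp add: scale_def)

lemma sim_sym: "sim u v \<longleftrightarrow> sim v u"
  by (auto simp: sim_def scale_scale)

lemma sim_trans: "sim u v \<Longrightarrow> sim v w \<Longrightarrow> sim u w"
  by (auto simp: sim_def scale_scale)

lemma sim_cong: "sim u v \<Longrightarrow> sim u w \<longleftrightarrow> sim v w"
  by (meson sim_sym sim_trans)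

lemma sim_act_imp: "sim u v \<Longrightarrow> sim (act x u) (act x v)"
  by (auto simp: sim_def act_scale)

lemma sim_act [simp]: "sim (act x u) (act x v) \<longleftrightarrow> sim u v"
  using sim_act_imp[of u v x] sim_act_imp[of "act x u" "act x v" "iv x"] by auto

lemma sim_foldr_act [simp]: "sim (foldr act p u) (foldr act p v) \<longleftrightarrow> sim u v"
  by (induction p) auto

text \<open>Positivity fixes the sign, comparison of \<open>rho y\<close> with \<open>rho z\<close>
  at \<open>y\<close> leaves only \<open>y = z\<close>, and the absence of strict growth forces all
  letters of \<open>u\<close> to commute with \<open>z\<close>. In terms of walls: a reduced path
  crosses the wall \<open>rho z\<close> only at an accessible \<open>z\<close>.\<close>

lemma sim_rho:
  assumes "reduced (u @ [y])" "set u \<subseteq> X" "y \<in> X" "z \<in> X"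
    and sim: "sim (rho z) (foldr act u (rho y))"
  shows "y = z \<and> (\<forall>x \<in> set u. (z, x) \<in> J)"
proof -
  let ?v = "foldr act u (rho y)"
  note F = foldr_act_rho[OF assms(1-3)]
  then have ge: "rho y c \<le> ?v c" for c by blast
  have "rho z = ?v"
  proof (rule ccontr)
    assume "rho z \<noteq> ?v"
    then have "rho z z = - ?v z" using sim by (simp add: sim_def scale_def)
    moreover have "0 \<le> ?v z" using ge[of z] rho_nonneg[of y z] by simp
    ultimately show False by (simp add: rho_def split: if_splits)
  qed
  then have v: "?v = rho z" by simp
  have "y = z" using ge[of y] unfolding v by (auto simp: rho_def split: if_splits)
  then show ?thesis using F unfolding v by blast
qed

section \<open>Walls\<close>

text \<open>
  Up to sign, \<open>walls w ! i\<close> describes the wall that the path \<open>w\<close> crosses in its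
  step \<open>i\<close>.
\<close>

primrec walls :: "'x list \<Rightarrow> ('x \<Rightarrow> int) list" where
  "walls [] = []"
| "walls (x # w) = rho x # map (act x) (walls w)"

lemma length_walls [simp]: "length (walls w) = length w"
  by (induction w) auto

lemma walls_append: "walls (u @ v) = walls u @ map (foldr act u) (walls v)"
  by (induction u) auto

lemma walls_nth: "i < length w \<Longrightarrow> walls w ! i = foldr act (take i w) (rho (w ! i))"
proof (induction w arbitrary: i)
  case (Cons x w)
  then show ?case by (cases i) auto
qed simp

lemma sim_rho_walls:
  assumes "reduced w" "set w \<subseteq> X" "z \<in> X" "i < length w" "sim (rho z) (walls w ! i)"
  shows "w ! i = z \<and> (\<forall>x \<in> set (take i w). (z, x) \<in> J)"
proof (rule sim_rho)
  have "take i w @ [w ! i] = take (Suc i) w" using assms(4) by (simp add: take_Suc_conv_app_nth)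
  then show "reduced (take i w @ [w ! i])"
    using assms(1) reduced_prefix[of "take (Suc i) w" "drop (Suc i) w"] by simp
  show "set (take i w) \<subseteq> X" using assms(2) set_take_subset[of i w] by blast
  show "w ! i \<in> X" using assms(2,4) by auto
  show "sim (rho z) (foldr act (take i w) (rho (w ! i)))"
    using assms(4,5) by (simp add: walls_nth)
qed (rule assms(3))

lemma act_walls_indep:
  "\<forall>y \<in> set p. (x, y) \<in> J \<Longrightarrow> v \<in> set (walls p) \<Longrightarrow> act x v = v"
proof (induction p arbitrary: v)
  case (Cons y p)
  then show ?case using act_commute[of x y] by (auto simp: act_rho_indep)
qed simp

lemma map_act_walls_indep: "\<forall>y \<in> set p. (x, y) \<in> J \<Longrightarrow> map (act x) (walls p) = walls p"
  by (simp add: act_walls_indep map_idI)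

definition wall_count :: "('x \<Rightarrow> int) \<Rightarrow> ('b \<times> ('x \<Rightarrow> int)) list \<Rightarrow> nat" where
  "wall_count b ps = length (filter (\<lambda>q. sim b (snd q)) ps)"

text \<open>The first crossing of each wall that is crossed an odd number of times.\<close>

fun kept :: "('b \<times> ('x \<Rightarrow> int)) list \<Rightarrow> ('b \<times> ('x \<Rightarrow> int)) list" where
  "kept [] = []"
| "kept (p # ps) = (if even (wall_count (snd p) ps) then [p] else []) @
    filter (\<lambda>q. \<not> sim (snd p) (snd q)) (kept ps)"

lemma odd_wall_count: "odd (wall_count b ps) \<longleftrightarrow> (\<exists>q \<in> set (kept ps). sim b (snd q))"
proof (induction ps)
  case (Cons p ps)
  show ?case
  proof (cases "sim b (snd p)")
    case True
    have "wall_count b ps = wall_count (snd p) ps"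
      unfolding wall_count_def using sim_cong[OF True] by simp
    then show ?thesis using True sim_cong[OF True] by (auto simp: wall_count_def)
  next
    case False
    have "\<not> sim (snd p) (snd q)" if "sim b (snd q)" for q :: "'b \<times> ('x \<Rightarrow> int)"
      using that False sim_sym sim_trans by blast
    then show ?thesis using False Cons by (auto simp: wall_count_def)
  qed
qed (simp add: wall_count_def)

lemma kept_map:
  assumes "\<And>u v. sim (f u) (f v) \<longleftrightarrow> sim u v"
  shows "kept (map (apsnd f) ps) = map (apsnd f) (kept ps)"
  by (induction ps) (simp_all add: wall_count_def filter_map o_def assms)

text \<open>Prepending \<open>x\<close> applies \<open>act x\<close> to all walls and adds
  \<open>rho x\<close>, which coincides with a shifted wall exactly when the old one was
  \<open>rho (iv x)\<close> up to sign. By \<open>sim_rho\<close> this happens only at an accessible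
  \<open>iv x\<close>. When the two cancel, the walls before \<open>iv x\<close> are fixed by
  \<open>act x\<close>, and those after it lose the factor \<open>act (iv x)\<close>; so the
  surviving letters have the same walls in the reduced word as in the original one.\<close>

lemma kept_zip_walls:
  assumes "set w \<subseteq> X"
  shows "map fst (kept (zip w (walls w))) = red w \<and>
    list_all2 sim (map snd (kept (zip w (walls w)))) (walls (red w))"
  using assms
proof (induction w)
  case (Cons x w)
  let ?z = "zip w (walls w)" and ?R = "red w"
  let ?K = "kept ?z"
  have x: "x \<in> X" and w: "set w \<subseteq> X" using Cons.prems by auto
  have RX: "set ?R \<subseteq> X" using set_red w by blast
  have K1: "map fst ?K = ?R" and K2: "list_all2 sim (map snd ?K) (walls ?R)"
    using Cons.IH[OF w] by auto
  have len: "length ?K = length ?R" using arg_cong[OF K1, of length] by simp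
  have simx: "sim (rho x) (act x b) \<longleftrightarrow> sim (rho (iv x)) b" for b
  proof -
    have "sim (rho x) (act x (rho (iv x)))"
      unfolding act_rho_iv[OF x] by (simp add: sim_def scale_scale)
    from sim_cong[OF this, of "act x b"] show ?thesis by simp
  qed
  have wall: "sim (rho (iv x)) (snd (?K ! i)) \<longleftrightarrow> sim (rho (iv x)) (walls ?R ! i)"
    if "i < length ?R" for i
  proof -
    have "sim (snd (?K ! i)) (walls ?R ! i)"
      using list_all2_nthD[OF K2, of i] that len by simp
    then show ?thesis using sim_trans sim_sym by blast
  qed
  have crossed: "i < length ?R \<Longrightarrow> sim (rho (iv x)) (snd (?K ! i)) \<Longrightarrow>
      ?R ! i = iv x \<and> (\<forall>y \<in> set (take i ?R). (iv x, y) \<in> J)" for i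
    using wall sim_rho_walls[OF reduced_red RX, of "iv x"] x by auto
  have zip: "zip (x # w) (walls (x # w)) = (x, rho x) # map (apsnd (act x)) ?z"
    by (simp add: zip_map2 apsnd_def map_prod_def)
  have cnt: "wall_count (rho x) (map (apsnd (act x)) ?z) = wall_count (rho (iv x)) ?z"
    by (simp add: wall_count_def filter_map o_def simx)
  have K': "kept (zip (x # w) (walls (x # w))) =
      (if even (wall_count (rho (iv x)) ?z) then [(x, rho x)] else []) @
      map (apsnd (act x)) (filter (\<lambda>q. \<not> sim (rho (iv x)) (snd q)) ?K)"
    unfolding zip by (simp add: cnt kept_map filter_map o_def simx)
  show ?case
  proof (cases "front (iv x) ?R")
    case False
    have no: "\<not> sim (rho (iv x)) (snd q)" if q: "q \<in> set ?K" for q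
    proof
      assume s: "sim (rho (iv x)) (snd q)"
      obtain i where i: "i < length ?R" "q = ?K ! i" using q len by (metis in_set_conv_nth)
      then have "?R ! i = iv x" "\<forall>y \<in> set (take i ?R). (iv x, y) \<in> J" using crossed s by auto
      then have "front (iv x) ?R"
        using i id_take_nth_drop[of i ?R] unfolding front_split by metis
      then show False using False by simp
    qed
    then have "even (wall_count (rho (iv x)) ?z)" using odd_wall_count by blast
    moreover have "filter (\<lambda>q. \<not> sim (rho (iv x)) (snd q)) ?K = ?K" using no by simp
    ultimately have "kept (zip (x # w) (walls (x # w))) = (x, rho x) # map (apsnd (act x)) ?K"
      unfolding K' by simp
    moreover have "red (x # w) = x # ?R" using False by (simp add: ins_def)
    moreover have "list_all2 sim (map (act x) (map snd ?K)) (map (act x) (walls ?R))"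
      using K2 by (simp add: list_all2_map1 list_all2_map2)
    ultimately show ?thesis using K1 by (simp add: o_def)
  next
    case True
    then obtain p q where R: "?R = p @ iv x # q" and p: "\<forall>y \<in> set p. (iv x, y) \<in> J"
      unfolding front_split by blast
    from K1[unfolded R] obtain P k L where K: "?K = P @ k # L"
      and PL: "map fst P = p" "map fst L = q"
      by (auto simp: map_eq_append_conv map_eq_Cons_conv)
    have lp: "length P = length p" using PL by auto
    have notin: "iv x \<notin> set p" using p by auto
    have p': "\<forall>y \<in> set p. (x, y) \<in> J" using p by simp
    have W: "walls ?R = walls p @ rho (iv x) # map (foldr act p) (map (act (iv x)) (walls q))"
      unfolding R walls_append using foldr_act_rho_indep[OF p] by simp
    have l2: "list_all2 sim (map snd P) (walls p)" "sim (snd k) (rho (iv x))"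
      "list_all2 sim (map snd L) (map (foldr act p) (map (act (iv x)) (walls q)))"
      using K2 lp unfolding W K by (simp_all add: list_all2_append)
    have nP: "\<not> sim (rho (iv x)) (snd r)" if r: "r \<in> set P" for r
    proof
      assume s: "sim (rho (iv x)) (snd r)"
      obtain i where i: "i < length P" "r = P ! i" using r by (metis in_set_conv_nth)
      then have "?R ! i = iv x" using crossed[of i] s lp R K by (simp add: nth_append)
      then have "p ! i = iv x" using i lp R by (simp add: nth_append)
      then show False using notin i lp nth_mem[of i p] by simp
    qed
    have nL: "\<not> sim (rho (iv x)) (snd r)" if r: "r \<in> set L" for r
    proof
      assume s: "sim (rho (iv x)) (snd r)"
      obtain i where i: "i < length L" "r = L ! i" using r by (metis in_set_conv_nth)
      let ?i = "length P + Suc i"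
      have "?i < length ?R" "?K ! ?i = r"
        using i lp PL unfolding K R by (auto simp: nth_append)
      then have "\<forall>y \<in> set (take ?i ?R). (iv x, y) \<in> J" using crossed[of ?i] s by auto
      moreover have "iv x \<in> set (take ?i ?R)" using lp unfolding R by simp
      ultimately show False by auto
    qed
    have kk: "sim (rho (iv x)) (snd k)" using l2(2) sim_sym by blast
    have "\<exists>r \<in> set ?K. sim (rho (iv x)) (snd r)" using kk unfolding K by auto
    then have "odd (wall_count (rho (iv x)) ?z)" using odd_wall_count by blast
    moreover have "filter (\<lambda>q. \<not> sim (rho (iv x)) (snd q)) ?K = P @ L"
      using nP nL kk unfolding K by simp
    ultimately have K'': "kept (zip (x # w) (walls (x # w))) = map (apsnd (act x)) (P @ L)"
      unfolding K' by simp
    have red: "red (x # w) = p @ q"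
      using True notin unfolding red_simps ins_def R by (simp add: remove1_append)
    have "list_all2 sim (map (act x) (map snd P)) (map (act x) (walls p))"
      using l2(1) by (simp add: list_all2_map1 list_all2_map2)
    then have A: "list_all2 sim (map (act x) (map snd P)) (walls p)"
      unfolding map_act_walls_indep[OF p'] .
    have "list_all2 sim (map (act x) (map snd L))
        (map (act x) (map (foldr act p) (map (act (iv x)) (walls q))))"
      using l2(3) by (simp add: list_all2_map1 list_all2_map2)
    moreover have "map (act x) (map (foldr act p) (map (act (iv x)) (walls q))) =
        map (foldr act p) (walls q)"
      by (simp add: foldr_act_commute[OF p'])
    ultimately have B: "list_all2 sim (map (act x) (map snd L)) (map (foldr act p) (walls q))"
      by (simp only:)
    show ?thesis
      unfolding K'' red walls_append using PL list_all2_appendI[OF A B] by (simp add: o_def)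
  qed
qed simp

definition kept_pos :: "'x list \<Rightarrow> nat \<Rightarrow> bool" where
  "kept_pos w i \<longleftrightarrow> (\<forall>j<i. \<not> sim (walls w ! j) (walls w ! i)) \<and>
    even (length (filter (\<lambda>j. sim (walls w ! i) (walls w ! j)) [Suc i..<length w]))"

lemma length_filter_conv_upt:
  "length (filter P xs) = length (filter (\<lambda>j. P (xs ! j)) [0..<length xs])"
proof -
  have "filter P xs = filter P (map ((!) xs) [0..<length xs])" by (simp add: map_nth)
  then show ?thesis by (simp add: filter_map o_def)
qed

text \<open>Trades the recursion for a condition on a single position that refers to the original
  word only; this is what the machine can check by scanning.\<close>

lemma kept_eq_filter_upt:
  "kept ps = map ((!) ps) (filter (\<lambda>i. (\<forall>j<i. \<not> sim (snd (ps ! j)) (snd (ps ! i))) \<and>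
    even (length (filter (\<lambda>j. sim (snd (ps ! i)) (snd (ps ! j))) [Suc i..<length ps])))
    [0..<length ps])"
proof (induction ps)
  case (Cons p ps)
  let ?n = "length ps"
  let ?E = "\<lambda>ps i. even (length (filter (\<lambda>j. sim (snd (ps ! i)) (snd (ps ! j))) [Suc i..<length ps]))"
  let ?Q = "\<lambda>ps i. (\<forall>j<i. \<not> sim (snd (ps ! j)) (snd (ps ! i))) \<and> ?E ps i"
  have up: "[0..<length (p # ps)] = 0 # map Suc [0..<?n]"
    by (simp add: map_Suc_upt upt_conv_Cons del: upt_Suc)
  have up': "[Suc i..<length (p # ps)] = map Suc [i..<?n]" for i
    by (simp add: map_Suc_upt del: upt_Suc)
  have E: "?E (p # ps) (Suc i) = ?E ps i" for i
    unfolding up' by (simp add: filter_map o_def)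
  have Q: "?Q (p # ps) (Suc i) \<longleftrightarrow> \<not> sim (snd p) (snd (ps ! i)) \<and> ?Q ps i" for i
    unfolding E by (auto simp: All_less_Suc2)
  have Q0: "?Q (p # ps) 0 \<longleftrightarrow> even (wall_count (snd p) ps)"
    unfolding up' wall_count_def
    by (simp add: filter_map o_def length_filter_conv_upt[of _ ps])
  have "map ((!) (p # ps)) (filter (?Q (p # ps)) [0..<length (p # ps)]) =
      (if even (wall_count (snd p) ps) then [p] else []) @
      map ((!) ps) (filter (\<lambda>i. \<not> sim (snd p) (snd (ps ! i)) \<and> ?Q ps i) [0..<?n])"
    unfolding up using Q0 Q by (simp add: filter_map o_def)
  also have "\<dots> = kept (p # ps)"
    using Cons by (simp add: filter_map o_def conj_commute)
  finally show ?case by simp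
qed simp

theorem red_eq_kept: "set w \<subseteq> X \<Longrightarrow> red w = map ((!) w) (filter (kept_pos w) [0..<length w])"
proof -
  assume w: "set w \<subseteq> X"
  let ?ps = "zip w (walls w)"
  have "filter (\<lambda>j. sim (snd (?ps ! i)) (snd (?ps ! j))) [Suc i..<length ?ps] =
      filter (\<lambda>j. sim (walls w ! i) (walls w ! j)) [Suc i..<length w]" if "i < length w" for i
    by (rule filter_cong) (use that in auto)
  then have "filter (\<lambda>i. (\<forall>j<i. \<not> sim (snd (?ps ! j)) (snd (?ps ! i))) \<and>
      even (length (filter (\<lambda>j. sim (snd (?ps ! i)) (snd (?ps ! j))) [Suc i..<length ?ps])))
      [0..<length ?ps] = filter (kept_pos w) [0..<length w]"
    unfolding kept_pos_def by (intro filter_cong) auto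
  then have "map fst (kept ?ps) = map (fst \<circ> (!) ?ps) (filter (kept_pos w) [0..<length w])"
    by (subst kept_eq_filter_upt) simp
  also have "\<dots> = map ((!) w) (filter (kept_pos w) [0..<length w])"
    by (rule map_cong) auto
  finally show ?thesis using kept_zip_walls[OF w] by simp
qed

end

section \<open>Testing equality modulo small numbers\<close>

text \<open>
  In Leibniz' harmonic triangle each entry \<open>1 / (m * (n choose m))\<close> with \<open>m > 1\<close> is a
  difference of two others, so that these denominators divide every common multiple
  of \<open>1, \<dots>, n\<close>.
\<close>

lemma harmonic_triangle_dvd:
  fixes z :: int
  assumes "\<And>k. 1 \<le> k \<Longrightarrow> k \<le> n \<Longrightarrow> int k dvd z" "1 \<le> m" "m \<le> n"
  shows "int (m * (n choose m)) dvd z"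
  using assms(2,1,3)
proof (induction m arbitrary: n rule: nat_induct_at_least)
  case base
  then show ?case by simp
next
  case (Suc m)
  obtain n' where n: "n = Suc n'" using Suc.prems(2) by (cases n) auto
  obtain m' where m: "m = Suc m'" using Suc.hyps by (cases m) auto
  have "0 < m" "m \<le> n'" "m \<le> n" using m n Suc.prems(2) by auto
  let ?A = "int (m * (n' choose m))" and ?B = "int (m * (n choose m))"
    and ?D = "int (Suc m * (n choose Suc m))"
  have "?A dvd z" using Suc.prems n by (intro Suc.IH) auto
  then obtain a where a: "z = ?A * a" by (rule dvdE)
  have "?B dvd z" using Suc.prems n by (intro Suc.IH) auto
  then obtain b where b: "z = ?B * b" by (rule dvdE)
  have pos: "?A > 0" "?B > 0"
    using \<open>0 < m\<close> \<open>m \<le> n'\<close> \<open>m \<le> n\<close>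
    by (simp_all only: of_nat_0_less_iff nat_0_less_mult_iff zero_less_binomial_iff)
  have D: "?D = int (n * (n' choose m))"
    unfolding n using Suc_times_binomial_eq[of n' m] by (simp add: mult.commute)
  have BA: "?B - ?A = int (m * (n' choose m'))"
    unfolding n m by (simp add: algebra_simps)
  have B: "?B = int (n * (n' choose m'))"
    unfolding n m using Suc_times_binomial_eq[of n' m'] by (simp add: mult.commute)
  \<comment> \<open>This is \<open>1 / ?D = 1 / ?A - 1 / ?B\<close> without denominators, so
    \<open>z / ?D\<close> is the integer \<open>a - b\<close>.\<close>
  have rel: "?D * (?B - ?A) = ?A * ?B"
    unfolding BA D unfolding B by (simp add: mult.commute mult.left_commute)
  have "(a - b) * ?D * (?A * ?B) = z * (?A * ?B)"
  proof -
    have "(a - b) * ?D * (?A * ?B) = (?A * a) * ?B * ?D - (?B * b) * ?A * ?D"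
      by (simp add: algebra_simps)
    also have "\<dots> = z * (?D * (?B - ?A))"
      unfolding a[symmetric] b[symmetric] by (simp add: algebra_simps)
    finally show ?thesis unfolding rel .
  qed
  moreover have "?A * ?B \<noteq> 0" using mult_pos_pos[OF pos] by (metis less_irrefl)
  ultimately have "(a - b) * ?D = z" using mult_right_cancel by blast
  then have "z = ?D * (a - b)" by (simp only: mult.commute)
  then show ?case by (rule dvdI)
qed

text \<open>All of \<open>1, ..., 2 * k\<close> divide \<open>z\<close>, hence so does
  \<open>k * (2 * k choose k)\<close>, which is at least \<open>2 ^ k\<close>. The moduli start at 4
  so that the entries of \<open>rho\<close>, which are at most 3, are their own residues; the
  divisors 2 and 3 are recovered from 4 and 6.\<close>

lemma eq_0_if_dvd_small:
  fixes z :: int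
  assumes dvd: "\<And>m. 4 \<le> m \<Longrightarrow> m < N \<Longrightarrow> int m dvd z"
    and k: "4 \<le> k" "2 * k < N" and small: "\<bar>z\<bar> < 2 ^ k"
  shows "z = 0"
proof (rule ccontr)
  assume z: "z \<noteq> 0"
  have all: "int m dvd z" if "1 \<le> m" "m \<le> 2 * k" for m
  proof (cases "4 \<le> m")
    case True
    then show ?thesis using that k dvd by simp
  next
    case False
    then have "m = 1 \<or> m = 2 \<or> m = 3" using that by auto
    moreover have "int 4 dvd z" "int 6 dvd z" using k by (intro dvd; simp)+
    then have "2 dvd z" "3 dvd z" by (auto elim: dvd_trans[rotated])
    ultimately show ?thesis by auto
  qed
  have "int (k * (2 * k choose k)) dvd z"
    by (rule harmonic_triangle_dvd) (use all k in auto)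
  then have "int (k * (2 * k choose k)) \<le> \<bar>z\<bar>"
    using z by (simp add: zdvd_imp_le)
  moreover have "(2::real) ^ k \<le> real (2 * k choose k)"
    using binomial_ge_n_over_k_pow_k[of k "2 * k", where 'a = real] k by simp
  then have "2 ^ k \<le> (2 * k choose k)"
    by (metis of_nat_le_iff of_nat_numeral of_nat_power)
  then have "int (2 ^ k) \<le> int (k * (2 * k choose k))"
    using k by (intro iffD2[OF of_nat_le_iff]) (simp add: order_trans)
  ultimately show False using small by simp
qed

context inv_alphabet
begin

text \<open>A letter enlarges the entries by a factor of at most
  \<open>2 ^ (4 * card X + 2)\<close>, which keeps the integers to be tested below
  \<open>2 ^ k\<close> for \<open>k = (4 * card X + 7) * Suc n\<close>. The bound exceeds
  \<open>2 * k\<close>, as \<open>eq_0_if_dvd_small\<close> requires.\<close>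

definition modulus_bound :: "nat \<Rightarrow> nat" where
  "modulus_bound n = (8 * card X + 16) * Suc n"

lemma reflect_bound:
  assumes "\<And>c. \<bar>v c\<bar> \<le> L"
  shows "\<bar>reflect b v c\<bar> \<le> 2 ^ (2 * card X + 1) * L"
proof -
  have L: "0 \<le> L" using assms[of b] by linarith
  have "\<bar>nbsum b v\<bar> \<le> (\<Sum>c \<in> {c \<in> X. c \<noteq> b \<and> (b, c) \<notin> J}. L)"
    unfolding nbsum_def by (rule order_trans[OF sum_abs]) (rule sum_mono, rule assms)
  also have "\<dots> \<le> int (card X) * L"
    using card_mono[OF finite_X, of "{c \<in> X. c \<noteq> b \<and> (b, c) \<notin> J}"] L
    by (auto intro: mult_right_mono)
  finally have "\<bar>reflect b v c\<bar> \<le> (2 * int (card X) + 1) * L"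
    using assms[of b] assms[of c] L mult_nonneg_nonneg[of "int (card X)" L]
    by (auto simp: reflect_def algebra_simps)
  also have "\<dots> \<le> 2 ^ (2 * card X + 1) * L"
  proof (rule mult_right_mono[OF _ L])
    have "int (2 * card X + 1) \<le> int (2 ^ (2 * card X + 1))"
      by (simp only: of_nat_le_iff less_exp less_imp_le)
    then show "2 * int (card X) + 1 \<le> 2 ^ (2 * card X + 1)"
      by (simp only: of_nat_add of_nat_mult of_nat_numeral of_nat_power of_nat_1)
  qed
  finally show ?thesis .
qed

lemma act_bound:
  assumes "\<And>c. \<bar>v c\<bar> \<le> L"
  shows "\<bar>act x v c\<bar> \<le> 2 ^ (2 * (2 * card X + 1)) * L"
proof -
  define e :: int where "e = 2 ^ (2 * card X + 1)"
  have e: "1 \<le> e" unfolding e_def by (rule one_le_power) simp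
  have L: "0 \<le> L" using assms[of x] by linarith
  have b: "\<bar>reflect a u c\<bar> \<le> e * K" if "\<And>c. \<bar>u c\<bar> \<le> K" for a c u K
    unfolding e_def by (rule reflect_bound[OF that])
  have "\<bar>act x v c\<bar> \<le> e * (e * L)"
  proof (cases "iv x = x")
    case True
    have "\<bar>act x v c\<bar> \<le> e * L"
      using b[OF assms] True by (simp add: act_def)
    also have "L \<le> e * L" using mult_right_mono[OF e L] by simp
    then have "e * L \<le> e * (e * L)" using e by (intro mult_left_mono) auto
    finally show ?thesis .
  next
    case False
    have "\<bar>reflect (iv x) v c\<bar> \<le> e * L" for c by (rule b[OF assms])
    from b[OF this] False show ?thesis by (simp add: act_def)
  qed
  also have "e * (e * L) = 2 ^ (2 * (2 * card X + 1)) * L"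
    unfolding e_def mult_2[of "2 * card X + 1"] power_add[of _ "2 * card X + 1"] by (simp only: mult.assoc)
  finally show ?thesis .
qed

abbreviation defect :: "('x \<Rightarrow> int) \<Rightarrow> 'x \<Rightarrow> 'x \<Rightarrow> int" where
  "defect v y b \<equiv> v b - rho y b * v (iv y)"

text \<open>To compare the walls at \<open>i\<close> and \<open>j\<close>, all letters are moved to
  one side: \<open>rho (w ! i)\<close> is pulled back along the letters from \<open>i\<close> up to
  \<open>j - 1\<close> and compared with the small vector \<open>rho (w ! j)\<close>. Only one
  vector has to be stored, and it is updated letter by letter while the input head moves
  right.\<close>

definition test_vec :: "'x list \<Rightarrow> nat \<Rightarrow> nat \<Rightarrow> 'x \<Rightarrow> int" where
  "test_vec w i k = fold (\<lambda>x. act (iv x)) (drop i (take k w)) (rho (w ! i))"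

lemma test_vec_start: "test_vec w i i = rho (w ! i)"
  by (simp add: test_vec_def)

lemma test_vec_Suc:
  "i \<le> k \<Longrightarrow> k < length w \<Longrightarrow> test_vec w i (Suc k) = act (iv (w ! k)) (test_vec w i k)"
  by (simp add: test_vec_def take_Suc_conv_app_nth)

lemma fold_act_bound:
  "(\<And>c. \<bar>v c\<bar> \<le> L) \<Longrightarrow>
    \<bar>fold (\<lambda>x. act (iv x)) u v c\<bar> \<le> (2 ^ (2 * (2 * card X + 1))) ^ length u * L"
proof (induction u arbitrary: v L)
  case (Cons x u)
  have "\<bar>fold (\<lambda>x. act (iv x)) u (act (iv x) v) c\<bar> \<le>
      (2 ^ (2 * (2 * card X + 1))) ^ length u * (2 ^ (2 * (2 * card X + 1)) * L)"
    by (intro Cons.IH act_bound Cons.prems)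
  then show ?case
    by (simp only: fold_simps length_Cons power_Suc mult.assoc mult.commute mult.left_commute)
qed simp

lemma foldr_fold_act: "foldr act u (fold (\<lambda>x. act (iv x)) u v) = v"
  by (induction u arbitrary: v) auto

lemma foldr_act_scale: "foldr act u (scale k v) = scale k (foldr act u v)"
  by (induction u) (auto simp: act_scale)

lemma sim_walls_test_vec:
  assumes "i < j" "j < length w"
  shows "sim (walls w ! i) (walls w ! j) \<longleftrightarrow> sim (test_vec w i j) (rho (w ! j))"
proof -
  let ?u = "drop i (take j w)"
  have "take j w = take i w @ ?u"
    using assms(1) append_take_drop_id[of i "take j w"] by (simp add: min_def)
  then have "foldr act (take j w) (rho (w ! j)) = foldr act (take i w) (foldr act ?u (rho (w ! j)))"
    by (metis foldr_append o_apply)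
  then have "sim (walls w ! i) (walls w ! j) \<longleftrightarrow> sim (rho (w ! i)) (foldr act ?u (rho (w ! j)))"
    using assms by (simp add: walls_nth)
  also have "\<dots> \<longleftrightarrow> sim (foldr act ?u (test_vec w i j)) (foldr act ?u (rho (w ! j)))"
    by (simp only: test_vec_def foldr_fold_act)
  finally show ?thesis by simp
qed

lemma fold_act_outside:
  "set u \<subseteq> X \<Longrightarrow> b \<notin> X \<Longrightarrow> fold (\<lambda>x. act (iv x)) u v b = v b"
proof (induction u arbitrary: v)
  case (Cons x u)
  then have "b \<noteq> x" "b \<noteq> iv x" by auto
  then show ?case using Cons by (simp add: act_eq_outside)
qed simp

text \<open>
  Testing up to sign amounts to testing proportionality, as vectors in the orbit of \<open>rho x\<close>
  are primitive; \<open>rho y (iv y) = 1\<close> makes the proportionality factor readable.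
\<close>

lemma sim_rho_iff_proportional:
  assumes w: "set w \<subseteq> X" "i < length w" "y \<in> X"
  shows "sim (test_vec w i j) (rho y) \<longleftrightarrow>
    (\<forall>b \<in> X. test_vec w i j b = rho y b * test_vec w i j (iv y))"
proof
  have rho1: "rho y (iv y) = 1" by (simp add: rho_def)
  show "\<forall>b \<in> X. test_vec w i j b = rho y b * test_vec w i j (iv y)" if "sim (test_vec w i j) (rho y)"
    using that rho1 by (auto simp: sim_def scale_def)
  let ?u = "drop i (take j w)" and ?v = "test_vec w i j"
  assume *: "\<forall>b \<in> X. ?v b = rho y b * ?v (iv y)"
  have wi: "w ! i \<in> X" using w by auto
  have uX: "set ?u \<subseteq> X" using w(1) set_drop_subset set_take_subset by fastforce
  have "?v b = ?v (iv y) * rho y b" for b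
  proof (cases "b \<in> X")
    case False
    then have "b \<noteq> y" "b \<noteq> iv y" "b \<noteq> w ! i" "b \<noteq> iv (w ! i)" using w wi by auto
    then show ?thesis
      using fold_act_outside[OF uX False] by (simp add: test_vec_def rho_def)
  qed (use * in auto)
  then have v: "?v = scale (?v (iv y)) (rho y)" unfolding scale_def by (rule ext)
  \<comment> \<open>Undoing the pull-back and reading the coordinate \<open>iv (w ! i)\<close>,
    where \<open>rho (w ! i)\<close> is 1, shows that the factor divides 1.\<close>
  have "rho (w ! i) = foldr act ?u ?v" by (simp add: test_vec_def foldr_fold_act)
  also have "\<dots> = scale (?v (iv y)) (foldr act ?u (rho y))"
    by (subst v) (rule foldr_act_scale)
  finally have "rho (w ! i) (iv (w ! i)) = ?v (iv y) * foldr act ?u (rho y) (iv (w ! i))"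
    by (simp add: scale_def)
  moreover have "rho (w ! i) (iv (w ! i)) = 1" by (simp add: rho_def)
  ultimately have "?v (iv y) dvd 1" by (simp only: dvdI)
  then have "?v (iv y) = 1 \<or> ?v (iv y) = -1" by (auto simp: zdvd1_eq)
  then show "sim ?v (rho y)" using v by (metis scale_1 sim_def)
qed

lemma sim_walls_iff_dvd:
  assumes w: "set w \<subseteq> X" and ij: "i < j" "j < length w"
  shows "sim (walls w ! i) (walls w ! j) \<longleftrightarrow>
    (\<forall>m. 4 \<le> m \<longrightarrow> m < modulus_bound (length w) \<longrightarrow> (\<forall>b \<in> X.
      int m dvd defect (test_vec w i j) (w ! j) b))"
    (is "_ \<longleftrightarrow> ?R")
proof -
  let ?v = "test_vec w i j" and ?y = "w ! j" and ?n = "length w"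
  let ?e = "2 * (2 * card X + 1)"
  have y: "?y \<in> X" and i: "i < length w" using w ij by auto
  have vb: "\<bar>?v c\<bar> \<le> 2 ^ (?e * ?n) * 3" for c
  proof -
    have "\<bar>?v c\<bar> \<le> (2 ^ ?e) ^ length (drop i (take j w)) * 3"
      unfolding test_vec_def by (rule fold_act_bound) (simp add: rho_def)
    also have "\<dots> \<le> 2 ^ (?e * ?n) * 3"
      unfolding power_mult[symmetric] using ij
      by (intro mult_right_mono power_increasing mult_left_mono) auto
    finally show ?thesis .
  qed
  have "?v b = rho ?y b * ?v (iv ?y)"
    if R: "?R" and b: "b \<in> X" for b
  proof -
    let ?z = "?v b - rho ?y b * ?v (iv ?y)"
    \<comment> \<open>Entries of \<open>?v\<close> contribute a factor 3 from the initial
      \<open>rho\<close>, and \<open>rho ?y b\<close> another one, whence the constant 12 = 3 + 9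
      below.\<close>
    have "\<bar>rho ?y b * ?v (iv ?y)\<bar> \<le> 3 * (2 ^ (?e * ?n) * 3)"
      unfolding abs_mult by (rule mult_mono) (use vb in \<open>auto simp: rho_def\<close>)
    then have "\<bar>?z\<bar> \<le> 12 * 2 ^ (?e * ?n)"
      using vb[of b] by linarith
    also have "\<dots> < 2 ^ (4 + ?e * ?n)" unfolding power_add by simp
    also have "\<dots> \<le> 2 ^ ((4 * card X + 7) * Suc ?n)"
      by (rule power_increasing) (auto simp: algebra_simps)
    finally have "\<bar>?z\<bar> < 2 ^ ((4 * card X + 7) * Suc ?n)" .
    then have "?z = 0"
      by (rule eq_0_if_dvd_small[rotated 3, where N = "modulus_bound ?n"])
        (use R b in \<open>auto simp: modulus_bound_def algebra_simps\<close>)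
    then show ?thesis by simp
  qed
  then have "?R \<Longrightarrow> \<forall>b \<in> X. ?v b = rho ?y b * ?v (iv ?y)" by blast
  moreover have "?R" if "\<forall>b \<in> X. ?v b = rho ?y b * ?v (iv ?y)"
  proof (intro allI impI ballI)
    fix m b assume "b \<in> X"
    then have "?v b - rho ?y b * ?v (iv ?y) = 0" using that by simp
    then show "int m dvd ?v b - rho ?y b * ?v (iv ?y)" by (simp only: dvd_0_right)
  qed
  ultimately have "?R \<longleftrightarrow> (\<forall>b \<in> X. ?v b = rho ?y b * ?v (iv ?y))" by (rule iffI)
  then show ?thesis
    using sim_walls_test_vec[OF ij] sim_rho_iff_proportional[OF w i y] by (simp only:)
qed

end

section \<open>A programming language for logspace transducers\<close>

datatype ('i, 'r) guard = Less 'r 'r | Cell "'i input_cell \<Rightarrow> bool"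

text \<open>The flag of \<open>Add\<close> is the carry into the lowest bit, so that an increment
  needs no constant beyond a register holding 0. \<open>Branch\<close> makes the continuation depend
  on the cell read, so that letters never have to be stored.\<close>

datatype ('i, 'o, 'r) com =
    Add 'r 'r 'r bool
  | Sub 'r 'r 'r
  | Act direction "'o option"
  | Seq "('i, 'o, 'r) com" "('i, 'o, 'r) com"
  | Cond "('i, 'r) guard" "('i, 'o, 'r) com" "('i, 'o, 'r) com"
  | Loop "('i, 'r) guard" "('i, 'o, 'r) com"
  | Branch "'i input_cell \<Rightarrow> ('i, 'o, 'r) com"

primrec holds :: "'i input_cell \<Rightarrow> ('r \<Rightarrow> nat) \<Rightarrow> ('i, 'r) guard \<Rightarrow> bool" where
  "holds x s (Less a b) = (s a < s b)"
| "holds x s (Cell P) = P x"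

abbreviation emit :: "'o list \<Rightarrow> 'o option \<Rightarrow> 'o list" where
  "emit out y \<equiv> out @ (case y of None \<Rightarrow> [] | Some y \<Rightarrow> [y])"

text \<open>
  Execution on input \<open>w\<close> where no register ever exceeds the bound \<open>B\<close>.
\<close>

inductive exec :: "'i list \<Rightarrow> nat \<Rightarrow> ('i, 'o, 'r) com \<Rightarrow> ('r \<Rightarrow> nat) \<Rightarrow> nat \<Rightarrow> 'o list \<Rightarrow>
    ('r \<Rightarrow> nat) \<Rightarrow> nat \<Rightarrow> 'o list \<Rightarrow> bool" for w B where
  Add: "s a + s b + of_bool c \<le> B \<Longrightarrow>
    exec w B (Add r a b c) s p out (s(r := s a + s b + of_bool c)) p out"
| Sub: "s b \<le> s a \<Longrightarrow> exec w B (Sub r a b) s p out (s(r := s a - s b)) p out"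
| Act: "exec w B (Act d y) s p out s (min (move_head d p) (length w + 1)) (emit out y)"
| Seq: "exec w B c s p out s' p' out' \<Longrightarrow> exec w B c' s' p' out' s'' p'' out'' \<Longrightarrow>
    exec w B (Seq c c') s p out s'' p'' out''"
| Cond: "exec w B (if holds (input_at w p) s t then c else c') s p out s' p' out' \<Longrightarrow>
    exec w B (Cond t c c') s p out s' p' out'"
| LoopT: "holds (input_at w p) s t \<Longrightarrow> exec w B c s p out s' p' out' \<Longrightarrow>
    exec w B (Loop t c) s' p' out' s'' p'' out'' \<Longrightarrow>
    exec w B (Loop t c) s p out s'' p'' out''"
| LoopF: "\<not> holds (input_at w p) s t \<Longrightarrow> exec w B (Loop t c) s p out s p out"
| Branch: "exec w B (f (input_at w p)) s p out s' p' out' \<Longrightarrow>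
    exec w B (Branch f) s p out s' p' out'"

definition cells :: "'i set \<Rightarrow> 'i input_cell set" where
  "cells A = {LeftEnd, RightEnd} \<union> Input ` A"

lemma input_at_cells: "w \<in> lists A \<Longrightarrow> input_at w p \<in> cells A"
  by (auto simp: input_at_def cells_def)

primrec guard_ok :: "'r set \<Rightarrow> ('i, 'r) guard \<Rightarrow> bool" where
  "guard_ok Rs (Less a b) = (a \<in> Rs \<and> b \<in> Rs)"
| "guard_ok Rs (Cell P) = True"

primrec com_ok :: "'i set \<Rightarrow> 'o set \<Rightarrow> 'r set \<Rightarrow> ('i, 'o, 'r) com \<Rightarrow> bool" where
  "com_ok A Y Rs (Add r a b c) = (r \<in> Rs \<and> a \<in> Rs \<and> b \<in> Rs)"
| "com_ok A Y Rs (Sub r a b) = (r \<in> Rs \<and> a \<in> Rs \<and> b \<in> Rs)"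
| "com_ok A Y Rs (Act d y) = (set_option y \<subseteq> Y)"
| "com_ok A Y Rs (Seq c c') = (com_ok A Y Rs c \<and> com_ok A Y Rs c')"
| "com_ok A Y Rs (Cond t c c') = (guard_ok Rs t \<and> com_ok A Y Rs c \<and> com_ok A Y Rs c')"
| "com_ok A Y Rs (Loop t c) = (guard_ok Rs t \<and> com_ok A Y Rs c)"
| "com_ok A Y Rs (Branch f) = (\<forall>x \<in> cells A. com_ok A Y Rs (f x))"

section \<open>Compilation to transducers\<close>

text \<open>
  The control state holds a stack of programs to be run. A cell of the work tape holds the set of
  registers whose binary representation has a one there, together with a mark on the leftmost
  cell; blank cells are \<open>None\<close>. Arithmetic is done in one sweep to the right with a carry
  bit, which is followed by a walk back to the mark.
\<close>

datatype ('i, 'o, 'r) control =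
    Init
  | Home "('i, 'o, 'r) com list"
  | Sweep bool "'r option" 'r 'r bool "('i, 'o, 'r) com list" "('i, 'o, 'r) com list"
  | Back "('i, 'o, 'r) com list"

text \<open>The majority of three bits; for subtraction the bit of the minuend is negated, which
  gives the borrow.\<close>

definition carry :: "bool \<Rightarrow> bool \<Rightarrow> bool \<Rightarrow> bool \<Rightarrow> bool" where
  "carry add a b c = (let a = (a = add) in a \<and> b \<or> a \<and> c \<or> b \<and> c)"

definition sumbit :: "bool \<Rightarrow> bool \<Rightarrow> bool \<Rightarrow> bool" where
  "sumbit a b c = (a \<noteq> (b \<noteq> c))"

fun put :: "'r option \<Rightarrow> bool \<Rightarrow> 'r set \<Rightarrow> 'r set" where
  "put None v R = R"
| "put (Some r) v R = (if v then insert r R else R - {r})"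

text \<open>A comparison is a subtraction without a target register: it changes no bit, and its
  final borrow selects \<open>k1\<close> or \<open>k0\<close>. An addition that ends with a carry
  appends a cell in which only the target register has a one.\<close>

fun delta :: "('i, 'o, 'r) com \<Rightarrow> ('i, 'o, 'r) control \<Rightarrow> 'i input_cell \<Rightarrow> (bool \<times> 'r set) option \<Rightarrow>
    (('i, 'o, 'r) control \<times> (bool \<times> 'r set) option \<times> direction \<times> direction \<times> 'o option) option"
where
  "delta prog Init x s = Some (Home [prog], Some (True, {}), Stay, Stay, None)"
| "delta prog (Home []) x s = None"
| "delta prog (Home (Add r a b c # k)) x s =
    Some (Sweep True (Some r) a b c k k, s, Stay, Stay, None)"
| "delta prog (Home (Sub r a b # k)) x s =
    Some (Sweep False (Some r) a b False k k, s, Stay, Stay, None)"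
| "delta prog (Home (Act d y # k)) x s = Some (Home k, s, d, Stay, y)"
| "delta prog (Home (Seq c c' # k)) x s = Some (Home (c # c' # k), s, Stay, Stay, None)"
| "delta prog (Home (Cond (Less a b) c c' # k)) x s =
    Some (Sweep False None a b False (c # k) (c' # k), s, Stay, Stay, None)"
| "delta prog (Home (Cond (Cell P) c c' # k)) x s =
    Some (Home ((if P x then c else c') # k), s, Stay, Stay, None)"
| "delta prog (Home (Loop (Less a b) c # k)) x s =
    Some (Sweep False None a b False (c # Loop (Less a b) c # k) k, s, Stay, Stay, None)"
| "delta prog (Home (Loop (Cell P) c # k)) x s =
    Some (Home (if P x then c # Loop (Cell P) c # k else k), s, Stay, Stay, None)"
| "delta prog (Home (Branch f # k)) x s = Some (Home (f x # k), s, Stay, Stay, None)"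
| "delta prog (Sweep add t a b c k1 k0) x (Some (m, R)) =
    Some (Sweep add t a b (carry add (a \<in> R) (b \<in> R) c) k1 k0,
      Some (m, put t (sumbit (a \<in> R) (b \<in> R) c) R), Stay, GoRight, None)"
| "delta prog (Sweep add t a b c k1 k0) x None =
    Some (Back (if c then k1 else k0), if add \<and> c then Some (False, set_option t) else None,
      Stay, GoLeft, None)"
| "delta prog (Back k) x None = None"
| "delta prog (Back k) x (Some (m, R)) =
    (if m then Some (Home k, Some (m, R), Stay, Stay, None)
     else Some (Back k, Some (m, R), Stay, GoLeft, None))"

type_synonym ('i, 'o, 'r) conf =
  "('i, 'o, 'r) control \<times> nat \<times> (nat \<Rightarrow> (bool \<times> 'r set) option) \<times> nat \<times> 'o list"

definition conf_step :: "('i, 'o, 'r) com \<Rightarrow> 'i list \<Rightarrow> ('i, 'o, 'r) conf \<Rightarrow>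
    ('i, 'o, 'r) conf option" where
  "conf_step prog w = (\<lambda>(q, p, T, h, out). case delta prog q (input_at w p) (T h) of
      None \<Rightarrow> None
    | Some (q', s, d, e, y) \<Rightarrow>
        Some (q', min (move_head d p) (length w + 1), T(h := s), move_head e h, emit out y))"

text \<open>The head bound is part of the step relation, so that a run certifies it for every
  configuration except the last; a complete computation ends with its head at 0.\<close>

definition good :: "('i, 'o, 'r) com \<Rightarrow> 'i list \<Rightarrow> nat \<Rightarrow> ('i, 'o, 'r) conf \<Rightarrow>
    ('i, 'o, 'r) conf \<Rightarrow> bool" where
  "good prog w B = (\<lambda>(q, p, T, h, out) C'.
    conf_step prog w (q, p, T, h, out) = Some C' \<and> 2 ^ h \<le> 2 * B)"

abbreviation runs :: "('i, 'o, 'r) com \<Rightarrow> 'i list \<Rightarrow> nat \<Rightarrow> ('i, 'o, 'r) conf \<Rightarrow>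
    ('i, 'o, 'r) conf \<Rightarrow> bool" where
  "runs prog w B \<equiv> (good prog w B)\<^sup>*\<^sup>*"

definition tape :: "'r set \<Rightarrow> nat \<Rightarrow> ('r \<Rightarrow> nat) \<Rightarrow> nat \<Rightarrow> (bool \<times> 'r set) option" where
  "tape Rs e s = (\<lambda>i. if i < e then Some (i = 0, {r \<in> Rs. bit (s r) i}) else None)"

text \<open>All registers share the width \<open>e\<close>. A cell is appended only when a sum
  reaches \<open>2 ^ e\<close>; as sums are at most \<open>B\<close>, the new width still satisfies
  the bound \<open>2 * B\<close>.\<close>

definition fits :: "'r set \<Rightarrow> nat \<Rightarrow> nat \<Rightarrow> ('r \<Rightarrow> nat) \<Rightarrow> bool" where
  "fits Rs B e s \<longleftrightarrow> 1 \<le> e \<and> 2 ^ e \<le> 2 * B \<and> (\<forall>r \<in> Rs. s r < 2 ^ e)"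

section \<open>Carries and borrows of binary arithmetic\<close>

definition add_carry :: "nat \<Rightarrow> nat \<Rightarrow> bool \<Rightarrow> nat \<Rightarrow> bool" where
  "add_carry a b c i \<longleftrightarrow> 2 ^ i \<le> take_bit i a + take_bit i b + of_bool c"

definition borrow :: "nat \<Rightarrow> nat \<Rightarrow> nat \<Rightarrow> bool" where
  "borrow a b i \<longleftrightarrow> take_bit i a < take_bit i b"

lemma add_carry_0: "add_carry a b c 0 = c"
  by (simp add: add_carry_def)

lemma add_carry_Suc:
  "add_carry a b c (Suc i) = carry True (bit a i) (bit b i) (add_carry a b c i)"
proof -
  have arith: "2 * z \<le> (z * of_bool p + x) + (z * of_bool q + y) + of_bool c \<longleftrightarrow>
      carry True p q (z \<le> x + y + of_bool c)" if "x < z" "y < z" for x y z :: nat and p q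
    using that by (cases c; cases p; cases q) (auto simp: carry_def)
  show ?thesis
    unfolding add_carry_def take_bit_Suc_from_most power_Suc by (rule arith) simp_all
qed

lemma bit_add_carry: "bit (a + b + of_bool c) i = sumbit (bit a i) (bit b i) (add_carry a b c i)"
proof -
  let ?k = "take_bit i a + take_bit i b + of_bool c"
  have lt: "take_bit i a < 2 ^ i" "take_bit i b < 2 ^ i" by simp_all
  have "a + b + of_bool c = ?k + (a div 2 ^ i + b div 2 ^ i) * 2 ^ i"
    using div_mult_mod_eq[of a "2 ^ i"] div_mult_mod_eq[of b "2 ^ i"]
    by (simp add: take_bit_eq_mod algebra_simps)
  then have "(a + b + of_bool c) div 2 ^ i = ?k div 2 ^ i + (a div 2 ^ i + b div 2 ^ i)"
    by (simp only: div_mult_self1[OF power_not_zero[OF numeral_neq_zero]] add.commute)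
  moreover have "of_bool c \<le> (1::nat)" by simp
  then have "?k < 2 * 2 ^ i" using lt by linarith
  then have "?k div 2 ^ i = of_bool (add_carry a b c i)"
    by (cases "add_carry a b c i") (auto simp: add_carry_def intro!: div_nat_eqI)
  ultimately show ?thesis
    by (auto simp: bit_iff_odd sumbit_def)
qed

lemma borrow_0: "borrow a b 0 = False"
  by (simp add: borrow_def)

lemma borrow_Suc: "borrow a b (Suc i) = carry False (bit a i) (bit b i) (borrow a b i)"
proof -
  have arith: "z * of_bool p + x < z * of_bool q + y \<longleftrightarrow> carry False p q (x < y)"
    if "x < z" "y < z" for x y z :: nat and p q
    using that by (cases p; cases q) (auto simp: carry_def)
  show ?thesis
    unfolding borrow_def take_bit_Suc_from_most by (rule arith) simp_all
qed

text \<open>Read off from the addition \<open>(a - b) + b = a\<close>, whose carries are the borrows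
  of the subtraction.\<close>

lemma bit_diff_borrow:
  assumes "b \<le> a"
  shows "bit (a - b) i = sumbit (bit a i) (bit b i) (borrow a b i)"
proof -
  have c: "add_carry (a - b) b False i = borrow a b i" for i
  proof (induction i)
    case (Suc i)
    have "bit a i = sumbit (bit (a - b) i) (bit b i) (borrow a b i)"
      using bit_add_carry[of "a - b" b False i] assms Suc by simp
    then show ?case
      unfolding add_carry_Suc borrow_Suc Suc by (auto simp: carry_def sumbit_def)
  qed (simp add: add_carry_0 borrow_0)
  show ?thesis
    using bit_add_carry[of "a - b" b False i] assms c[of i] by (auto simp: sumbit_def)
qed

lemma borrow_iff_less: "a < 2 ^ e \<Longrightarrow> b < 2 ^ e \<Longrightarrow> borrow a b e \<longleftrightarrow> a < b"
  by (simp add: borrow_def take_bit_nat_eq_self)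

lemma power_le_double: "2 ^ e \<le> 2 * B \<Longrightarrow> i \<le> e \<Longrightarrow> 2 ^ i \<le> (2::nat) * B"
  using power_increasing[of i e "2::nat"] by linarith

section \<open>Simulation of program runs on the work tape\<close>

lemma sweep_run:
  assumes ab: "a \<in> Rs" "b \<in> Rs" and e: "2 ^ e \<le> 2 * B"
    and carry: "\<And>i. i < e \<Longrightarrow> carry add (bit (s a) i) (bit (s b) i) (cr i) = cr (Suc i)"
    and put: "\<And>i. i < e \<Longrightarrow> put t (sumbit (bit (s a) i) (bit (s b) i) (cr i))
      {r \<in> Rs. bit (s r) i} = {r \<in> Rs. bit (s' r) i}"
    and p: "p \<le> length w + 1"
  shows "runs prog w B (Sweep add t a b (cr 0) k1 k0, p, tape Rs e s, 0, out)
    (Sweep add t a b (cr e) k1 k0, p, tape Rs e s', e, out)"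
proof -
  \<comment> \<open>With the head on cell \<open>i\<close>, the cells to its left already show the
    new register contents and the others still the old ones.\<close>
  let ?T = "\<lambda>i j. if j < i then tape Rs e s' j else tape Rs e s j"
  have run: "runs prog w B (Sweep add t a b (cr 0) k1 k0, p, tape Rs e s, 0, out)
    (Sweep add t a b (cr i) k1 k0, p, ?T i, i, out)" if "i \<le> e" for i
    using that
  proof (induction i)
    case (Suc i)
    have i: "i < e" using Suc.prems by simp
    have B: "2 ^ i \<le> 2 * B" using power_le_double[OF e] i by simp
    have T: "tape Rs e s i = Some (i = 0, {r \<in> Rs. bit (s r) i})" using i by (simp add: tape_def)
    have T': "(?T i)(i := Some (i = 0, {r \<in> Rs. bit (s' r) i})) = ?T (Suc i)"
      using i by (auto simp: tape_def)
    have "good prog w B (Sweep add t a b (cr i) k1 k0, p, ?T i, i, out)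
      (Sweep add t a b (cr (Suc i)) k1 k0, p, ?T (Suc i), Suc i, out)"
      unfolding good_def conf_step_def T'[symmetric] using ab B p
      by (simp add: T carry[OF i] put[OF i] del: fun_upd_apply)
    then show ?case using Suc by (meson Suc_leD rtranclp.rtrancl_into_rtrancl)
  qed simp
  have T: "?T e = tape Rs e s'" by (auto simp: tape_def)
  from run[OF order_refl] show ?thesis unfolding T .
qed

abbreviation home :: "'r set \<Rightarrow> ('i, 'o, 'r) com list \<Rightarrow> nat \<Rightarrow> nat \<Rightarrow> ('r \<Rightarrow> nat) \<Rightarrow>
    'o list \<Rightarrow> ('i, 'o, 'r) conf" where
  "home Rs k p e s out \<equiv> (Home k, p, tape Rs e s, 0, out)"

lemma back_run:
  assumes e: "2 ^ e \<le> 2 * B" and p: "p \<le> length w + 1"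
  shows "h < e \<Longrightarrow> runs prog w B (Back k, p, tape Rs e s, h, out) (home Rs k p e s out)"
proof (induction h)
  case 0
  then have "good prog w B (Back k, p, tape Rs e s, 0, out) (home Rs k p e s out)"
    using power_le_double[OF e, of 0] p by (auto simp: good_def conf_step_def tape_def)
  then show ?case by blast
next
  case (Suc h)
  have "2 ^ Suc h \<le> 2 * B" using power_le_double[OF e] Suc.prems by (simp del: power_Suc)
  then have "good prog w B (Back k, p, tape Rs e s, Suc h, out) (Back k, p, tape Rs e s, h, out)"
    using Suc.prems p by (auto simp: good_def conf_step_def tape_def)
  then show ?case using Suc by (meson Suc_lessD converse_rtranclp_into_rtranclp)
qed

lemma sub_run:
  assumes ab: "a \<in> Rs" "b \<in> Rs" and fits: "fits Rs B e s" and p: "p \<le> length w + 1"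
    and t: "t = None \<and> s' = s \<or> (\<exists>r \<in> Rs. t = Some r \<and> s b \<le> s a \<and> s' = s(r := s a - s b))"
  shows "runs prog w B (Sweep False t a b False k1 k0, p, tape Rs e s, 0, out)
    (home Rs (if s a < s b then k1 else k0) p e s' out)"
proof -
  let ?cr = "borrow (s a) (s b)" and ?k = "if s a < s b then k1 else k0"
  have e: "1 \<le> e" "2 ^ e \<le> 2 * B" using fits by (auto simp: fits_def)
  have "runs prog w B (Sweep False t a b (?cr 0) k1 k0, p, tape Rs e s, 0, out)
    (Sweep False t a b (?cr e) k1 k0, p, tape Rs e s', e, out)"
  proof (rule sweep_run[OF ab e(2) _ _ p])
    fix i
    show "put t (sumbit (bit (s a) i) (bit (s b) i) (?cr i)) {r \<in> Rs. bit (s r) i} =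
      {r \<in> Rs. bit (s' r) i}"
      using t by (auto simp: bit_diff_borrow[symmetric] split: if_splits)
  qed (simp add: borrow_Suc)
  also have "good prog w B (Sweep False t a b (?cr e) k1 k0, p, tape Rs e s', e, out)
    (Back ?k, p, tape Rs e s', e - 1, out)"
    using fits ab p by (auto simp: good_def conf_step_def tape_def fits_def borrow_iff_less)
  also have "runs prog w B (Back ?k, p, tape Rs e s', e - 1, out)
    (Home ?k, p, tape Rs e s', 0, out)"
    by (rule back_run[OF e(2) p]) (use e in auto)
  finally show ?thesis by (simp add: borrow_0)
qed

lemma add_run:
  assumes ab: "a \<in> Rs" "b \<in> Rs" "r \<in> Rs" and fits: "fits Rs B e s" and p: "p \<le> length w + 1"
    and B: "s a + s b + of_bool c \<le> B"
  defines "s' \<equiv> s(r := s a + s b + of_bool c)"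
  shows "\<exists>e'. fits Rs B e' s' \<and>
    runs prog w B (Sweep True (Some r) a b c k k, p, tape Rs e s, 0, out)
      (home Rs k p e' s' out)"
proof -
  let ?cr = "add_carry (s a) (s b) c" and ?s = "s a + s b + of_bool c"
  have e: "1 \<le> e" "2 ^ e \<le> 2 * B" and lt: "\<And>x. x \<in> Rs \<Longrightarrow> s x < 2 ^ e"
    using fits by (auto simp: fits_def)
  have cr: "?cr e \<longleftrightarrow> 2 ^ e \<le> ?s"
    using lt ab by (simp add: add_carry_def take_bit_nat_eq_self)
  have lt': "s x < 2 * 2 ^ e" if "x \<in> Rs" for x using lt[OF that] by simp
  have s: "?s < 2 ^ Suc e" using lt[OF ab(1)] lt[OF ab(2)] by (cases c) auto
  have run: "runs prog w B (Sweep True (Some r) a b (?cr 0) k k, p, tape Rs e s, 0, out)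
    (Sweep True (Some r) a b (?cr e) k k, p, tape Rs e s', e, out)"
  proof (rule sweep_run[OF ab(1,2) e(2) _ _ p])
    fix i
    show "put (Some r) (sumbit (bit (s a) i) (bit (s b) i) (?cr i)) {r \<in> Rs. bit (s r) i} =
      {r \<in> Rs. bit (s' r) i}"
      using ab unfolding s'_def bit_add_carry[symmetric] by (auto split: if_splits)
  qed (simp add: add_carry_Suc)
  show ?thesis
  proof (cases "?cr e")
    case True
    let ?e = "Suc e"
    have fits': "fits Rs B ?e s'"
      using e(1) True cr s B lt' by (auto simp: fits_def s'_def)
    \<comment> \<open>Contents of the appended cell: the sum lies in
      \<open>2 ^ e, ..., 2 ^ Suc e - 1\<close>, while every other register is below
      \<open>2 ^ e\<close>.\<close>
    have bit_e: "bit (s' x) e \<longleftrightarrow> x = r" if "x \<in> Rs" for x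
    proof (cases "x = r")
      case True
      have "?s div 2 ^ e = 1" using \<open>?cr e\<close> cr s by (intro div_nat_eqI) auto
      then show ?thesis using True by (simp add: s'_def bit_iff_odd)
    next
      case False
      then show ?thesis using lt[OF that] by (simp add: s'_def bit_iff_odd)
    qed
    have T: "(tape Rs e s')(e := Some (False, {r})) = tape Rs ?e s'"
      using e(1) ab(3) bit_e by (auto simp: tape_def fun_eq_iff less_Suc_eq)
    have "good prog w B (Sweep True (Some r) a b (?cr e) k k, p, tape Rs e s', e, out)
      (Back k, p, tape Rs ?e s', e - 1, out)"
      unfolding T[symmetric] using True e(2) p by (simp add: good_def conf_step_def tape_def)
    moreover have "runs prog w B (Back k, p, tape Rs ?e s', e - 1, out)
      (home Rs k p ?e s' out)"
      by (rule back_run) (use fits' p in \<open>auto simp: fits_def\<close>)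
    ultimately show ?thesis
      using run fits' unfolding add_carry_0
      by (meson rtranclp.rtrancl_into_rtrancl rtranclp_trans)
  next
    case False
    have fits': "fits Rs B e s'"
      using e False cr lt by (auto simp: fits_def s'_def)
    have "good prog w B (Sweep True (Some r) a b (?cr e) k k, p, tape Rs e s', e, out)
      (Back k, p, tape Rs e s', e - 1, out)"
      using False e(2) p by (auto simp: good_def conf_step_def tape_def)
    moreover have "runs prog w B (Back k, p, tape Rs e s', e - 1, out)
      (home Rs k p e s' out)"
      by (rule back_run) (use e p in auto)
    ultimately show ?thesis
      using run fits' unfolding add_carry_0
      by (meson rtranclp.rtrancl_into_rtrancl rtranclp_trans)
  qed
qed

lemma home_move:
  assumes "delta prog (Home (c # k)) (input_at w p) (tape Rs e s 0) =
      Some (q, tape Rs e s 0, d, Stay, y)"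
    and "fits Rs B e s"
  shows "good prog w B (home Rs (c # k) p e s out)
    (q, min (move_head d p) (length w + 1), tape Rs e s, 0, emit out y)"
  using assms power_le_double[of e B 0] by (auto simp: good_def conf_step_def fits_def)

lemma home_stay:
  assumes "delta prog (Home (c # k)) (input_at w p) (tape Rs e s 0) =
      Some (q, tape Rs e s 0, Stay, Stay, None)"
    and "fits Rs B e s" "p \<le> length w + 1"
  shows "good prog w B (home Rs (c # k) p e s out) (q, p, tape Rs e s, 0, out)"
  using home_move[OF assms(1,2), of out] assms(3) by simp

lemma less_run:
  assumes "a \<in> Rs" "b \<in> Rs" "fits Rs B e s" "p \<le> length w + 1"
    and "\<And>x y. delta prog (Home (c # k)) x y = Some (Sweep False None a b False k1 k0, y, Stay, Stay, None)"
  shows "runs prog w B (home Rs (c # k) p e s out)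
    (home Rs (if s a < s b then k1 else k0) p e s out)"
proof -
  have "good prog w B (home Rs (c # k) p e s out)
      (Sweep False None a b False k1 k0, p, tape Rs e s, 0, out)"
    by (rule home_stay[OF assms(5,3,4)])
  also have "runs prog w B (Sweep False None a b False k1 k0, p, tape Rs e s, 0, out)
    (home Rs (if s a < s b then k1 else k0) p e s out)"
    by (rule sub_run) (use assms(1-4) in auto)
  finally show ?thesis .
qed

lemma guard_run:
  assumes t: "guard_ok Rs t" and fits: "fits Rs B e s" and p: "p \<le> length w + 1"
    and less: "\<And>a b x y. t = Less a b \<Longrightarrow> delta prog (Home (c # k)) x y =
      Some (Sweep False None a b False k1 k0, y, Stay, Stay, None)"
    and cell: "\<And>P x y. t = Cell P \<Longrightarrow> delta prog (Home (c # k)) x y =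
      Some (Home (if P x then k1 else k0), y, Stay, Stay, None)"
  shows "runs prog w B (home Rs (c # k) p e s out)
    (home Rs (if holds (input_at w p) s t then k1 else k0) p e s out)"
proof (cases t)
  case (Less a b)
  then show ?thesis using less_run[OF _ _ fits p less[OF Less]] t by simp
next
  case (Cell P)
  show ?thesis
    using home_stay[OF cell[OF Cell] fits p, where out = out] Cell by (simp add: r_into_rtranclp)
qed

lemma exec_pos_le: "exec w B c s p out s' p' out' \<Longrightarrow> p \<le> length w + 1 \<Longrightarrow> p' \<le> length w + 1"
  by (induction rule: exec.induct) auto

text \<open>The final width is existential because additions may have lengthened the tape;
  \<open>k\<close> is arbitrary because the stack below the current command stays untouched until
  that command is finished.\<close>

lemma exec_run:
  assumes w: "w \<in> lists A"
  shows "exec w B c s p out s' p' out' \<Longrightarrow> com_ok A Y Rs c \<Longrightarrow> p \<le> length w + 1 \<Longrightarrow>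
    fits Rs B e s \<Longrightarrow> \<exists>e'. fits Rs B e' s' \<and>
      runs prog w B (home Rs (c # k) p e s out) (home Rs k p' e' s' out')"
proof (induction arbitrary: e k rule: exec.induct)
  case (Add s a b c r p out)
  have "good prog w B (home Rs (Add r a b c # k) p e s out)
      (Sweep True (Some r) a b c k k, p, tape Rs e s, 0, out)"
    by (rule home_stay) (use Add in auto)
  moreover obtain e' where "fits Rs B e' (s(r := s a + s b + of_bool c))"
    "runs prog w B (Sweep True (Some r) a b c k k, p, tape Rs e s, 0, out)
      (Home k, p, tape Rs e' (s(r := s a + s b + of_bool c)), 0, out)"
    using add_run[of a Rs b r B e s p w c prog k out] Add by auto
  ultimately show ?case
    by (blast intro: converse_rtranclp_into_rtranclp)
next
  case (Sub s b a r p out)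
  have "good prog w B (home Rs (Sub r a b # k) p e s out)
      (Sweep False (Some r) a b False k k, p, tape Rs e s, 0, out)"
    by (rule home_stay) (use Sub in auto)
  moreover have "runs prog w B (Sweep False (Some r) a b False k k, p, tape Rs e s, 0, out)
      (Home k, p, tape Rs e (s(r := s a - s b)), 0, out)"
    using sub_run[of a Rs b B e s p w "Some r" "s(r := s a - s b)" prog k k out] Sub by auto
  moreover have "fits Rs B e (s(r := s a - s b))"
    using Sub by (auto simp: fits_def intro: le_less_trans)
  ultimately show ?case
    by (blast intro: converse_rtranclp_into_rtranclp)
next
  case (Act d y s p out)
  have "good prog w B (home Rs (Act d y # k) p e s out)
      (Home k, min (move_head d p) (length w + 1), tape Rs e s, 0, emit out y)"
    by (rule home_move) (use Act in auto)
  then show ?case using Act.prems by blast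
next
  case (Seq c s p out s' p' out' c' s'' p'' out'')
  have 1: "good prog w B (home Rs (Seq c c' # k) p e s out)
      (home Rs (c # c' # k) p e s out)"
    by (rule home_stay) (use Seq in auto)
  obtain e1 where e1: "fits Rs B e1 s'" "runs prog w B (home Rs (c # c' # k) p e s out)
      (home Rs (c' # k) p' e1 s' out')"
    using Seq.IH(1)[of e "c' # k"] Seq.prems by auto
  obtain e2 where "fits Rs B e2 s''" "runs prog w B (home Rs (c' # k) p' e1 s' out')
      (home Rs k p'' e2 s'' out'')"
    using Seq.IH(2)[of e1 k] Seq.prems e1(1) exec_pos_le[OF Seq.hyps(1)] by auto
  then show ?case using 1 e1(2) by (meson converse_rtranclp_into_rtranclp rtranclp_trans)
next
  case (Cond p s t c c' out s' p' out')
  have "runs prog w B (home Rs (Cond t c c' # k) p e s out)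
    (home Rs (if holds (input_at w p) s t then c # k else c' # k) p e s out)"
    by (rule guard_run) (use Cond in auto)
  moreover have "(if holds (input_at w p) s t then c # k else c' # k) =
      (if holds (input_at w p) s t then c else c') # k" by simp
  ultimately have 1: "runs prog w B (home Rs (Cond t c c' # k) p e s out)
    (home Rs ((if holds (input_at w p) s t then c else c') # k) p e s out)" by (simp only:)
  have "com_ok A Y Rs (if holds (input_at w p) s t then c else c')" using Cond.prems by simp
  from Cond.IH[OF this Cond.prems(2,3), of k] show ?case
    using 1 by (blast intro: rtranclp_trans)
next
  case (LoopT p s t c out s' p' out' s'' p'' out'')
  let ?L = "Loop t c"
  have "runs prog w B (home Rs (?L # k) p e s out)
    (home Rs (if holds (input_at w p) s t then c # ?L # k else k) p e s out)"
    by (rule guard_run) (use LoopT in auto)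
  then have 1: "runs prog w B (home Rs (?L # k) p e s out)
    (home Rs (c # ?L # k) p e s out)"
    using LoopT.hyps(1) by simp
  obtain e1 where e1: "fits Rs B e1 s'" "runs prog w B (home Rs (c # ?L # k) p e s out)
      (home Rs (?L # k) p' e1 s' out')"
    using LoopT.IH(1)[of e "?L # k"] LoopT.prems by auto
  obtain e2 where "fits Rs B e2 s''" "runs prog w B (home Rs (?L # k) p' e1 s' out')
      (home Rs k p'' e2 s'' out'')"
    using LoopT.IH(2)[of e1 k] LoopT.prems e1(1) exec_pos_le[OF LoopT.hyps(2)] by auto
  then show ?case using 1 e1(2) by (meson rtranclp_trans)
next
  case (LoopF p s t c out)
  have "runs prog w B (home Rs (Loop t c # k) p e s out)
    (home Rs (if holds (input_at w p) s t then c # Loop t c # k else k) p e s out)"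
    by (rule guard_run) (use LoopF in auto)
  then show ?case using LoopF by auto
next
  case (Branch f p s out s' p' out')
  have "good prog w B (home Rs (Branch f # k) p e s out)
      (home Rs (f (input_at w p) # k) p e s out)"
    by (rule home_stay) (use Branch in auto)
  moreover obtain e' where "fits Rs B e' s'"
    "runs prog w B (home Rs (f (input_at w p) # k) p e s out)
      (home Rs k p' e' s' out')"
    using Branch.IH[of e k] Branch.prems input_at_cells[OF w] by auto
  ultimately show ?case
    by (blast intro: converse_rtranclp_into_rtranclp)
qed

section \<open>Finiteness of the control\<close>

primrec conts :: "'i set \<Rightarrow> ('i, 'o, 'r) com \<Rightarrow> ('i, 'o, 'r) com list \<Rightarrow> ('i, 'o, 'r) com list set" where
  "conts A (Add r a b c) k = {Add r a b c # k}"
| "conts A (Sub r a b) k = {Sub r a b # k}"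
| "conts A (Act d y) k = {Act d y # k}"
| "conts A (Seq c c') k = insert (Seq c c' # k) (conts A c (c' # k) \<union> conts A c' k)"
| "conts A (Cond t c c') k = insert (Cond t c c' # k) (conts A c k \<union> conts A c' k)"
| "conts A (Loop t c) k = insert (Loop t c # k) (conts A c (Loop t c # k))"
| "conts A (Branch f) k = insert (Branch f # k) (\<Union>x \<in> cells A. conts A (f x) k)"

primrec succs :: "'i set \<Rightarrow> ('i, 'o, 'r) com list \<Rightarrow> ('i, 'o, 'r) com \<Rightarrow> ('i, 'o, 'r) com list set" where
  "succs A k (Add r a b c) = {k}"
| "succs A k (Sub r a b) = {k}"
| "succs A k (Act d y) = {k}"
| "succs A k (Seq c c') = {c # c' # k}"
| "succs A k (Cond t c c') = {c # k, c' # k}"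
| "succs A k (Loop t c) = {k, c # Loop t c # k}"
| "succs A k (Branch f) = (\<lambda>x. f x # k) ` cells A"

lemma finite_conts: "finite A \<Longrightarrow> finite (conts A c k)"
  by (induction c arbitrary: k) (auto simp: cells_def)

lemma self_conts: "c # k \<in> conts A c k"
  by (cases c) auto

text \<open>Unfolding a loop puts the same loop back below its body, so the stacks never outgrow the
  nesting of the program and a finite set of them is closed under execution.\<close>

lemma succs_conts: "c' # k' \<in> conts A c k \<Longrightarrow> succs A k' c' \<subseteq> insert k (conts A c k)"
proof (induction c arbitrary: k)
  case (Seq c1 c2)
  then show ?case using self_conts[of c1 "c2 # k" A] self_conts[of c2 k A] by fastforce
next
  case (Cond t c1 c2)
  then show ?case using self_conts[of c1 k A] self_conts[of c2 k A] by fastforce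
next
  case (Loop t c)
  then show ?case using self_conts[of c "Loop t c # k" A] by fastforce
next
  case (Branch f)
  then show ?case using self_conts[of "f _" k A] by fastforce
qed auto

lemma conts_ok: "c' # k' \<in> conts A c k \<Longrightarrow> com_ok A Y Rs c \<Longrightarrow> com_ok A Y Rs c'"
  by (induction c arbitrary: k) auto

definition controls :: "'i set \<Rightarrow> 'r set \<Rightarrow> ('i, 'o, 'r) com \<Rightarrow> ('i, 'o, 'r) control set" where
  "controls A Rs prog = {q. case q of
      Init \<Rightarrow> True
    | Home k \<Rightarrow> k \<in> insert [] (conts A prog [])
    | Back k \<Rightarrow> k \<in> insert [] (conts A prog [])
    | Sweep add t a b c k1 k0 \<Rightarrow> set_option t \<subseteq> Rs \<and> a \<in> Rs \<and> b \<in> Rs \<and>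
        k1 \<in> insert [] (conts A prog []) \<and> k0 \<in> insert [] (conts A prog [])}"

definition tape_symbols :: "'r set \<Rightarrow> (bool \<times> 'r set) option set" where
  "tape_symbols Rs = insert None (Some ` (UNIV \<times> Pow Rs))"

lemma finite_controls:
  assumes "finite A" "finite Rs"
  shows "finite (controls A Rs prog)"
proof (rule finite_subset)
  let ?K = "insert [] (conts A prog [])"
  let ?S = "(\<lambda>(add, t, a, b, c, k1, k0). Sweep add t a b c k1 k0) `
    (UNIV \<times> insert None (Some ` Rs) \<times> Rs \<times> Rs \<times> UNIV \<times> ?K \<times> ?K)"
  show "controls A Rs prog \<subseteq> insert Init (Home ` ?K \<union> Back ` ?K \<union> ?S)"
  proof
    fix q assume q: "q \<in> controls A Rs prog"
    show "q \<in> insert Init (Home ` ?K \<union> Back ` ?K \<union> ?S)"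
    proof (cases q)
      case (Sweep add t a b c k1 k0)
      then have "(add, t, a, b, c, k1, k0) \<in>
          UNIV \<times> insert None (Some ` Rs) \<times> Rs \<times> Rs \<times> UNIV \<times> ?K \<times> ?K"
        using q by (cases t) (auto simp: controls_def)
      from imageI[OF this, of "\<lambda>(add, t, a, b, c, k1, k0). Sweep add t a b c k1 k0"]
      show ?thesis using Sweep by simp
    qed (use q in \<open>auto simp: controls_def\<close>)
  qed
  show "finite (insert Init (Home ` ?K \<union> Back ` ?K \<union> ?S))"
    using assms by (simp add: finite_conts)
qed

lemma finite_tape_symbols: "finite Rs \<Longrightarrow> finite (tape_symbols Rs)"
  by (auto simp: tape_symbols_def)

lemma controls_iff [simp]:
  "Init \<in> controls A Rs prog"
  "Home k \<in> controls A Rs prog \<longleftrightarrow> k \<in> insert [] (conts A prog [])"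
  "Back k \<in> controls A Rs prog \<longleftrightarrow> k \<in> insert [] (conts A prog [])"
  "Sweep add t a b c k1 k0 \<in> controls A Rs prog \<longleftrightarrow> set_option t \<subseteq> Rs \<and> a \<in> Rs \<and> b \<in> Rs \<and>
    k1 \<in> insert [] (conts A prog []) \<and> k0 \<in> insert [] (conts A prog [])"
  by (simp_all add: controls_def)

lemma tape_symbols_iff [simp]:
  "None \<in> tape_symbols Rs" "Some (m, R) \<in> tape_symbols Rs \<longleftrightarrow> R \<subseteq> Rs"
  by (auto simp: tape_symbols_def)

lemma put_subset: "R \<subseteq> Rs \<Longrightarrow> set_option t \<subseteq> Rs \<Longrightarrow> put t v R \<subseteq> Rs"
  by (cases t) auto

lemma delta_closed:
  assumes "com_ok A Y Rs prog" "q \<in> controls A Rs prog" "x \<in> cells A" "s \<in> tape_symbols Rs"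
    and d: "delta prog q x s = Some (q', s', d, e, y)"
  shows "q' \<in> controls A Rs prog \<and> s' \<in> tape_symbols Rs \<and> set_option y \<subseteq> Y"
proof (cases q)
  case Init
  then show ?thesis using d self_conts[of prog "[]" A] by auto
next
  case (Home ks)
  then obtain c k where ks: "ks = c # k" using d by (cases ks) auto
  have ck: "c # k \<in> conts A prog []" using assms(2) Home ks by simp
  have ok: "com_ok A Y Rs c" by (rule conts_ok[OF ck assms(1)])
  have sub: "succs A k c \<subseteq> insert [] (conts A prog [])" by (rule succs_conts[OF ck])
  show ?thesis
  proof (cases c)
    case (Cond t c1 c2)
    then show ?thesis using d Home ks ok sub assms(4) by (cases t) auto
  next
    case (Loop t c1)
    then show ?thesis using d Home ks ok sub assms(4) by (cases t) (auto split: if_splits)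
  qed (use d Home ks ok sub assms(3,4) in auto)
next
  case (Sweep add t a b c k1 k0)
  then show ?thesis using d assms(2,4)
    by (cases s) (auto simp: put_subset split: if_splits dest: put_subset[THEN subsetD, rotated 2])
next
  case (Back k)
  then show ?thesis using d assms(2,4) by (cases s) (auto split: if_splits)
qed

section \<open>Logarithmic space and the encoded machine\<close>

definition space_bound :: "nat \<Rightarrow> nat \<Rightarrow> nat" where
  "space_bound k n = nat \<lfloor>log 2 (real (2 * (k * Suc n)))\<rfloor> + 1"

lemma space_bound_bigo: "1 \<le> k \<Longrightarrow> (\<lambda>n. real (space_bound k n)) \<in> O(\<lambda>n. ln (real n))"
proof (rule bigoI)
  assume k: "1 \<le> k"
  let ?C = "1 / ln 2 * (ln (real (4 * k)) + 1) + 1"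
  show "\<forall>\<^sub>F n in at_top. norm (real (space_bound k n)) \<le> ?C * norm (ln (real n))"
    using eventually_ge_at_top[of 3]
  proof eventually_elim
    case (elim n)
    \<comment> \<open>From \<open>n \<ge> 3\<close> on, \<open>ln n\<close> is at least 1, so
      additive constants can be absorbed into a multiple of it.\<close>
    have "exp 1 \<le> real n" using elim exp_le by linarith
    then have ln1: "1 \<le> ln (real n)" using elim by (simp add: ln_ge_iff)
    have "1 \<le> 2 * (k * Suc n)" using k by simp
    then have "real 1 \<le> real (2 * (k * Suc n))" by (rule of_nat_mono)
    then have "1 \<le> real (2 * (k * Suc n))" by (simp only: of_nat_1)
    note pos = this
    then have "0 \<le> log 2 (real (2 * (k * Suc n)))" by (intro iffD2[OF zero_le_log_cancel_iff]) linarith+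
    then have "real (space_bound k n) \<le> log 2 (real (2 * (k * Suc n))) + 1"
      unfolding space_bound_def by linarith
    also have "log 2 (real (2 * (k * Suc n))) \<le> log 2 (real (4 * k) * real n)"
    proof (rule log_mono)
      have "k * (2 * Suc n) \<le> k * (4 * n)" using elim by (intro mult_le_mono2) simp
      then have "2 * (k * Suc n) \<le> 4 * k * n" by (simp only: mult.left_commute mult.assoc)
      then have "real (2 * (k * Suc n)) \<le> real (4 * k * n)" by (rule of_nat_mono)
      then show "real (2 * (k * Suc n)) \<le> real (4 * k) * real n" by (simp only: of_nat_mult)
    qed (use pos in linarith)+
    also have "\<dots> = 1 / ln 2 * (ln (real (4 * k)) + ln (real n))"
      using k elim by (simp add: log_def ln_mult)
    also have "\<dots> \<le> 1 / ln 2 * (ln (real (4 * k)) * ln (real n) + ln (real n))"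
    proof -
      have "0 \<le> ln (real (4 * k))" using k by simp
      then have "ln (real (4 * k)) * 1 \<le> ln (real (4 * k)) * ln (real n)"
        using ln1 by (intro mult_left_mono)
      then show ?thesis by (intro mult_left_mono) auto
    qed
    also have "\<dots> + 1 \<le> ?C * ln (real n)"
      using ln1 by (simp add: algebra_simps)
    finally show ?case using ln1 by simp
  qed
qed

lemma space_bound_less: "1 \<le> k \<Longrightarrow> 2 ^ h \<le> 2 * (k * Suc n) \<Longrightarrow> h < space_bound k n"
proof -
  assume k: "1 \<le> k" and h: "2 ^ h \<le> 2 * (k * Suc n)"
  have "real (2 ^ h) \<le> real (2 * (k * Suc n))" using h by (simp only: of_nat_le_iff)
  then have "log 2 (2 ^ h) \<le> log 2 (real (2 * (k * Suc n)))"
    by (intro log_mono) auto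
  then have "real h \<le> log 2 (real (2 * (k * Suc n)))" by simp
  then have "int h \<le> \<lfloor>log 2 (real (2 * (k * Suc n)))\<rfloor>" by (simp add: le_floor_iff)
  then show ?thesis unfolding space_bound_def by linarith
qed

text \<open>The space condition speaks of all reachable configurations, whereas the simulation
  yields a single halting run. By determinism every reachable configuration lies on that run, all of
  whose configurations obey the bound.\<close>

theorem logspace_program:
  fixes prog :: "('i, 'o, 'r) com"
  assumes fin: "finite A" "finite Y" "finite Rs" and ok: "com_ok A Y Rs prog" and k: "1 \<le> k"
    and run: "\<And>w. w \<in> lists A \<Longrightarrow> \<exists>s p. exec w (k * Suc (length w)) prog (\<lambda>_. 0) 0 [] s p (f w)"
  shows "\<exists>M. logspace_transducer A Y M \<and> computes M A f"
proof -
  let ?Q = "controls A Rs prog" and ?S = "tape_symbols Rs"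
  \<comment> \<open>A \<open>transducer\<close> has numbers as states and symbols, so the finite
    control and the finite tape alphabet are injected into \<open>nat\<close>.\<close>
  obtain eq :: "('i, 'o, 'r) control \<Rightarrow> nat" where eq: "inj_on eq ?Q"
    using finite_imp_inj_to_nat_seg[OF finite_controls[OF fin(1,3)]] by blast
  obtain es :: "(bool \<times> 'r set) option \<Rightarrow> nat" where es: "inj_on es ?S"
    using finite_imp_inj_to_nat_seg[OF finite_tape_symbols[OF fin(3)]] by blast
  define M :: "('i, 'o) transducer" where "M = \<lparr>tr_states = eq ` ?Q, tr_symbols = es ` ?S,
    tr_start = eq Init, tr_blank = es None,
    tr_delta = \<lambda>q x s. map_option (\<lambda>(q', s', d, e, y). (eq q', es s', d, e, y))
      (delta prog (inv_into ?Q eq q) x (inv_into ?S es s))\<rparr>"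
  have dec: "tr_delta M (eq q) x (es s) = map_option (\<lambda>(q', s', d, e, y). (eq q', es s', d, e, y))
      (delta prog q x s)" if "q \<in> ?Q" "s \<in> ?S" for q x s
    using that eq es by (simp add: M_def)
  have cells: "{LeftEnd, RightEnd} \<union> Input ` A = cells A" by (simp add: cells_def)
  have wf: "wf_transducer A Y M"
    unfolding wf_transducer_def cells
  proof (intro conjI ballI)
    fix q x s assume q: "q \<in> tr_states M" and x: "x \<in> cells A" and s: "s \<in> tr_symbols M"
    from q s obtain q1 s1 where qs: "q = eq q1" "q1 \<in> ?Q" "s = es s1" "s1 \<in> ?S"
      by (auto simp: M_def)
    show "case tr_delta M q x s of None \<Rightarrow> True
      | Some (q', s', d, e, out) \<Rightarrow> q' \<in> tr_states M \<and> s' \<in> tr_symbols M \<and> set_option out \<subseteq> Y"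
    proof (cases "delta prog q1 x s1")
      case None
      then show ?thesis using qs by (simp add: dec)
    next
      case (Some r)
      obtain q' s' d e y where r: "r = (q', s', d, e, y)" by (cases r)
      then have "q' \<in> ?Q \<and> s' \<in> ?S \<and> set_option y \<subseteq> Y"
        using delta_closed[OF ok qs(2) x qs(4)] Some by simp
      then show ?thesis using qs r Some by (simp add: dec) (simp add: M_def)
    qed
  qed (use fin in \<open>auto simp: M_def finite_controls finite_tape_symbols\<close>)
  define conc :: "('i, 'o, 'r) conf \<Rightarrow> 'o configuration" where
    "conc = (\<lambda>(q, p, T, h, out). \<lparr>state = eq q, input_head = p, work_tape = es \<circ> T,
      work_head = h, output_tape = out\<rparr>)"
  define legal :: "('i, 'o, 'r) conf \<Rightarrow> bool" where
    "legal = (\<lambda>(q, p, T, h, out). q \<in> ?Q \<and> range T \<subseteq> ?S)"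
  have sim_step: "step M w (conc C) = map_option conc (conf_step prog w C)" if "legal C" for w C
  proof -
    obtain q p T h out where C: "C = (q, p, T, h, out)" by (cases C)
    then have "q \<in> ?Q" "T h \<in> ?S" using that by (auto simp: legal_def)
    from dec[OF this] show ?thesis
      unfolding C by (auto simp: step_def conc_def conf_step_def fun_upd_comp fun_eq_iff
          split: option.splits)
  qed
  have legal_step: "legal C'" if C: "legal C" and s: "conf_step prog w C = Some C'" and w: "w \<in> lists A"
    for w C C'
  proof -
    obtain q p T h out where C1: "C = (q, p, T, h, out)" by (cases C)
    then have q: "q \<in> ?Q" and T: "T h \<in> ?S" "range T \<subseteq> ?S" using C by (auto simp: legal_def)
    obtain q' s' d e y where d: "delta prog q (input_at w p) (T h) = Some (q', s', d, e, y)"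
      using s unfolding C1 by (auto simp: conf_step_def split: option.splits)
    have "q' \<in> ?Q \<and> s' \<in> ?S"
      using delta_closed[OF ok q input_at_cells[OF w] T(1) d] by blast
    then show ?thesis using s T(2) unfolding C1 by (auto simp: conf_step_def d legal_def)
  qed
  have init: "initial M = conc (Init, 0, (\<lambda>_. None), 0, [])"
    by (simp add: initial_def conc_def M_def fun_eq_iff)
  let ?b = "\<lambda>w :: 'i list. k * Suc (length w)"
  let ?init = "(Init, 0, (\<lambda>_. None), 0, []) :: ('i, 'o, 'r) conf"
  have path: "\<exists>Cf. legal Cf \<and> conf_step prog w Cf = None \<and> (case Cf of (q, p, T, h, out) \<Rightarrow>
        h = 0 \<and> out = f w) \<and>
      runs prog w (?b w) ?init Cf"
    if w: "w \<in> lists A" for w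
  proof -
    let ?B = "?b w" and ?z = "\<lambda>_::'r. 0::nat"
    from run[OF w] obtain s p where ex: "exec w ?B prog ?z 0 [] s p (f w)" by blast
    have fits: "fits Rs ?B 1 ?z" using k by (auto simp: fits_def)
    obtain e where e: "runs prog w ?B (Home [prog], 0, tape Rs 1 ?z, 0, [])
        (Home [], p, tape Rs e s, 0, f w)"
      using exec_run[OF w ex ok _ fits, of prog "[]"] by auto
    have "(\<lambda>_. None)(0 := Some (True, {})) = tape Rs 1 ?z"
      by (auto simp: tape_def)
    then have "good prog w ?B ?init (Home [prog], 0, tape Rs 1 ?z, 0, [])"
      using k by (simp add: good_def conf_step_def)
    then have "runs prog w ?B ?init (Home [], p, tape Rs e s, 0, f w)"
      using e by (rule converse_rtranclp_into_rtranclp)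
    moreover have "legal (Home [], p, tape Rs e s, 0, f w)"
      by (auto simp: legal_def tape_def)
    moreover have "conf_step prog w (Home [], p, tape Rs e s, 0, f w) = None"
      by (simp add: conf_step_def)
    ultimately show ?thesis by (intro exI) auto
  qed
  have on_path: "\<exists>C. c = conc C \<and> legal C \<and> runs prog w (?b w) C Cf"
    if w: "w \<in> lists A" and r: "reachable M w c"
      and Cf: "conf_step prog w Cf = None"
        "runs prog w (?b w) ?init Cf" for w c Cf
    using r unfolding reachable_def
  proof (induction rule: rtranclp_induct)
    case base
    have "legal (Init, 0, \<lambda>_. None, 0, [])" by (auto simp: legal_def)
    then show ?case using init Cf(2) by blast
  next
    case (step c c')
    then obtain C where C: "c = conc C" "legal C" "runs prog w (?b w) C Cf" by blast
    obtain C' where C': "conf_step prog w C = Some C'" "c' = conc C'"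
      using step.hyps(2) C(1) sim_step[OF C(2)] by auto
    from C(3) have "runs prog w (?b w) C' Cf"
    proof (cases rule: converse_rtranclpE)
      case base
      then show ?thesis using Cf(1) C'(1) by simp
    next
      case (step C1)
      then have "C1 = C'" using C'(1) by (auto simp: good_def)
      then show ?thesis using step by simp
    qed
    then show ?case using C' legal_step[OF C(2) C'(1) w] by blast
  qed
  have "runs_in_space M A (space_bound k)"
    unfolding runs_in_space_def
  proof (intro ballI allI impI)
    fix w c assume w: "w \<in> lists A" and r: "reachable M w c"
    obtain Cf where Cf: "conf_step prog w Cf = None" "case Cf of (q, p, T, h, out) \<Rightarrow> h = 0 \<and> out = f w"
      "runs prog w (?b w) ?init Cf"
      using path[OF w] by blast
    obtain C where C: "c = conc C" "runs prog w (?b w) C Cf"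
      using on_path[OF w r Cf(1,3)] by blast
    from C(2) show "work_head c < space_bound k (length w)"
    proof (cases rule: converse_rtranclpE)
      case base
      then have "work_head c = 0" using Cf(2) C(1) by (auto simp: conc_def)
      then show ?thesis by (simp add: space_bound_def)
    next
      case (step C1)
      then have "2 ^ work_head c \<le> 2 * (k * Suc (length w))"
        using C(1) by (auto simp: good_def conc_def)
      then show ?thesis by (rule space_bound_less[OF k])
    qed
  qed
  then have "logspace_transducer A Y M"
    unfolding logspace_transducer_def using wf space_bound_bigo[OF k] by blast
  moreover have "computes M A f"
    unfolding computes_def
  proof
    fix w assume w: "w \<in> lists A"
    obtain Cf where Cf: "legal Cf" "conf_step prog w Cf = None"
      "case Cf of (q, p, T, h, out) \<Rightarrow> h = 0 \<and> out = f w"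
      "runs prog w (?b w) ?init Cf"
      using path[OF w] by blast
    have "legal C \<and> reachable M w (conc C)"
      if "runs prog w (?b w) ?init C" for C
      using that
    proof (induction rule: rtranclp_induct)
      case base
      then show ?case by (auto simp: legal_def reachable_def init)
    next
      case (step C C')
      then have s: "conf_step prog w C = Some C'" by (auto simp: good_def)
      then have "legal C'" using legal_step step.IH w by blast
      moreover have "Defs.step M w (conc C) = Some (conc C')"
        using sim_step step.IH s by simp
      ultimately show ?case using step.IH unfolding reachable_def
        by (auto intro: rtranclp.rtrancl_into_rtrancl)
    qed
    then have "reachable M w (conc Cf)" using Cf(4) by blast
    moreover have "Defs.step M w (conc Cf) = None" using sim_step[OF Cf(1)] Cf(2) by simp
    moreover have "output_tape (conc Cf) = f w" using Cf(3) by (auto simp: conc_def)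
    ultimately show "\<exists>c. reachable M w c \<and> Defs.step M w c = None \<and> output_tape c = f w" by blast
  qed
  ultimately show ?thesis by blast
qed

section \<open>Weakest preconditions\<close>

text \<open>Total correctness: a terminating run within the register bound \<open>B\<close> is
  asserted, so termination and space are proved together with the result.\<close>

definition wp :: "'i list \<Rightarrow> nat \<Rightarrow> ('i, 'o, 'r) com \<Rightarrow> (('r \<Rightarrow> nat) \<Rightarrow> nat \<Rightarrow> 'o list \<Rightarrow> bool) \<Rightarrow>
    ('r \<Rightarrow> nat) \<Rightarrow> nat \<Rightarrow> 'o list \<Rightarrow> bool" where
  "wp w B c Q s p out \<longleftrightarrow> (\<exists>s' p' out'. exec w B c s p out s' p' out' \<and> Q s' p' out')"

inductive_cases exec_AddE: "exec w B (Add r a b c) s p out s' p' out'"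
inductive_cases exec_SubE: "exec w B (Sub r a b) s p out s' p' out'"
inductive_cases exec_ActE: "exec w B (Act d y) s p out s' p' out'"
inductive_cases exec_SeqE: "exec w B (Seq c c') s p out s' p' out'"
inductive_cases exec_CondE: "exec w B (Cond t c c') s p out s' p' out'"
inductive_cases exec_LoopE: "exec w B (Loop t c) s p out s' p' out'"
inductive_cases exec_BranchE: "exec w B (Branch f) s p out s' p' out'"

lemma wp_Add [simp]: "wp w B (Add r a b c) Q s p out \<longleftrightarrow>
    s a + s b + of_bool c \<le> B \<and> Q (s(r := s a + s b + of_bool c)) p out"
  unfolding wp_def by (blast elim: exec_AddE intro: exec.Add)

lemma wp_Sub [simp]: "wp w B (Sub r a b) Q s p out \<longleftrightarrow> s b \<le> s a \<and> Q (s(r := s a - s b)) p out"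
  unfolding wp_def by (blast elim: exec_SubE intro: exec.Sub)

lemma wp_Act [simp]: "wp w B (Act d y) Q s p out \<longleftrightarrow>
    Q s (min (move_head d p) (length w + 1)) (emit out y)"
  unfolding wp_def using exec.Act[of w B d y s p out] by (fastforce elim: exec_ActE)

lemma wp_Seq [simp]: "wp w B (Seq c c') Q = wp w B c (wp w B c' Q)"
  unfolding wp_def by (intro ext) (blast elim: exec_SeqE intro: exec.Seq)

lemma wp_Cond [simp]: "wp w B (Cond t c c') Q s p out \<longleftrightarrow>
    (if holds (input_at w p) s t then wp w B c Q s p out else wp w B c' Q s p out)"
proof -
  have "wp w B (Cond t c c') Q s p out \<longleftrightarrow>
      wp w B (if holds (input_at w p) s t then c else c') Q s p out"
    unfolding wp_def by (blast elim: exec_CondE intro: exec.Cond)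
  then show ?thesis by simp
qed

lemma wp_Branch [simp]: "wp w B (Branch f) Q s p out \<longleftrightarrow> wp w B (f (input_at w p)) Q s p out"
  unfolding wp_def by (blast elim: exec_BranchE intro: exec.Branch)

lemma wp_Loop: "wp w B (Loop t c) Q s p out \<longleftrightarrow>
    (if holds (input_at w p) s t then wp w B c (wp w B (Loop t c) Q) s p out else Q s p out)"
proof
  assume "wp w B (Loop t c) Q s p out"
  then obtain s' p' out' where "exec w B (Loop t c) s p out s' p' out'" "Q s' p' out'"
    by (auto simp: wp_def)
  then show "if holds (input_at w p) s t then wp w B c (wp w B (Loop t c) Q) s p out else Q s p out"
  proof -
    assume ex: "exec w B (Loop t c) s p out s' p' out'" and Q: "Q s' p' out'"
    from ex have "holds (input_at w p) s t \<and> (\<exists>s1 p1 out1. exec w B c s p out s1 p1 out1 \<and>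
        exec w B (Loop t c) s1 p1 out1 s' p' out') \<or>
      \<not> holds (input_at w p) s t \<and> s' = s \<and> p' = p \<and> out' = out"
      by (rule exec_LoopE) auto
    then consider s1 p1 out1 where "holds (input_at w p) s t" "exec w B c s p out s1 p1 out1"
        "exec w B (Loop t c) s1 p1 out1 s' p' out'"
      | "\<not> holds (input_at w p) s t" "s' = s" "p' = p" "out' = out"
      by blast
    then show ?thesis
    proof cases
      case 1
      have "wp w B (Loop t c) Q s1 p1 out1"
        unfolding wp_def by (intro exI conjI) (rule 1(3), rule Q)
      then have "wp w B c (wp w B (Loop t c) Q) s p out"
        unfolding wp_def[of w B c] by (intro exI conjI) (rule 1(2))
      then show ?thesis using 1(1) by simp
    next
      case 2
      then show ?thesis using Q by simp
    qed
  qed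
next
  assume "if holds (input_at w p) s t then wp w B c (wp w B (Loop t c) Q) s p out else Q s p out"
  then show "wp w B (Loop t c) Q s p out"
  proof (cases "holds (input_at w p) s t")
    case True
    with \<open>if _ then _ else _\<close> show ?thesis unfolding wp_def by (auto intro: exec.LoopT)
  next
    case False
    with \<open>if _ then _ else _\<close> show ?thesis unfolding wp_def by (auto intro: exec.LoopF)
  qed
qed

lemma wp_mono: "wp w B c Q s p out \<Longrightarrow> (\<And>s p out. Q s p out \<Longrightarrow> Q' s p out) \<Longrightarrow> wp w B c Q' s p out"
  unfolding wp_def by blast

lemma wp_upto:
  assumes "Inv s p out"
    and step: "\<And>s p out. Inv s p out \<Longrightarrow> s a < s b \<Longrightarrow>
      wp w B c (\<lambda>s' p' out'. Inv s' p' out' \<and> s' a = Suc (s a) \<and> s' b = s b) s p out"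
    and fin: "\<And>s p out. Inv s p out \<Longrightarrow> \<not> s a < s b \<Longrightarrow> Q s p out"
  shows "wp w B (Loop (Less a b) c) Q s p out"
  using assms(1)
proof (induction "s b - s a" arbitrary: s p out)
  case 0
  then show ?case by (subst wp_Loop) (simp add: fin)
next
  case (Suc k)
  then have lt: "s a < s b" by simp
  have "wp w B c (wp w B (Loop (Less a b) c) Q) s p out"
    by (rule wp_mono[OF step[OF Suc.prems lt]]) (use Suc.hyps in auto)
  then show ?case using lt by (subst wp_Loop) simp
qed

definition skip :: "('i, 'o, 'r) com" where
  "skip = Loop (Cell (\<lambda>_. False)) (Act Stay None)"

definition seqs :: "('i, 'o, 'r) com list \<Rightarrow> ('i, 'o, 'r) com" where
  "seqs cs = foldr Seq cs skip"

lemma wp_skip [simp]: "wp w B skip Q = Q"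
  unfolding skip_def by (intro ext) (simp add: wp_Loop[of _ _ "Cell _"])

lemma wp_seqs [simp]:
  "wp w B (seqs []) Q = Q"
  "wp w B (seqs (c # cs)) Q = wp w B c (wp w B (seqs cs) Q)"
  by (simp_all add: seqs_def)

lemma wp_seqs_append [simp]: "wp w B (seqs (cs @ ds)) Q = wp w B (seqs cs) (wp w B (seqs ds) Q)"
  by (induction cs) simp_all

lemma com_ok_skip [simp]: "com_ok A Y Rs skip"
  by (simp add: skip_def)

lemma com_ok_seqs [simp]: "com_ok A Y Rs (seqs cs) \<longleftrightarrow> (\<forall>c \<in> set cs. com_ok A Y Rs c)"
  by (induction cs) (simp_all add: seqs_def)

section \<open>The normal form program\<close>

text \<open>Roles: \<open>rT\<close> accumulator; \<open>rV\<close> test vector modulo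
  \<open>rM\<close>; \<open>rK\<close> position inside a test; \<open>rG\<close> counter of
  \<open>goto\<close>; \<open>rE\<close> outcome of a wall test; \<open>rJ\<close> the position
  compared with \<open>rI\<close>; \<open>rP\<close> parity of later crossings; \<open>rQ\<close>
  whether position \<open>rI\<close> is kept; \<open>rS\<close> occurrences seen, capped at
  \<open>rC\<close>; \<open>rF\<close> whether a pending letter dependent on the candidate was seen;
  \<open>rD\<close> whether the candidate is accessible; \<open>rC\<close> letters emitted;
  \<open>rR\<close> rounds; \<open>rZ\<close> constant 0; \<open>rN\<close> input length plus one;
  \<open>rB\<close> bound on the moduli.\<close>

datatype 'x reg = rT | rV 'x | rM | rK | rG | rE | rJ | rP | rQ | rI | rS 'x | rF | rD | rC 'x | rR
  | rZ | rN | rB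

type_synonym 'x prog = "('x, 'x, 'x reg) com"

text \<open>A program fragment of some level may change the registers of lower levels only.\<close>

fun level :: "'x reg \<Rightarrow> nat" where
  "level rT = 0" | "level (rV x) = 0"
| "level rM = 1" | "level rK = 1" | "level rG = 1" | "level rE = 1"
| "level rJ = 2" | "level rP = 2" | "level rQ = 2"
| "level rI = 3" | "level (rS x) = 3" | "level rF = 3" | "level rD = 3"
| "level (rC x) = 4" | "level rR = 5" | "level rZ = 5" | "level rN = 5" | "level rB = 5"

definition agree :: "nat \<Rightarrow> ('x reg \<Rightarrow> nat) \<Rightarrow> ('x reg \<Rightarrow> nat) \<Rightarrow> bool" where
  "agree k s s' \<longleftrightarrow> (\<forall>r. k \<le> level r \<longrightarrow> s' r = s r)"

lemma agreeD: "agree k s s' \<Longrightarrow> k \<le> level r \<Longrightarrow> s' r = s r"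
  by (simp add: agree_def)

lemma agree_refl [simp]: "agree k s s"
  by (simp add: agree_def)

lemma agree_trans: "agree k s s' \<Longrightarrow> agree l s' s'' \<Longrightarrow> k \<le> m \<Longrightarrow> l \<le> m \<Longrightarrow> agree m s s''"
  by (simp add: agree_def)

lemma agree_upd [simp]: "level r < k \<Longrightarrow> agree k s (s'(r := v)) \<longleftrightarrow> agree k s s'"
  unfolding agree_def by (rule iff_allI) auto

abbreviation "inc r \<equiv> Add r r rZ True"
abbreviation "clr r \<equiv> Sub r r r"
abbreviation "set1 r \<equiv> Add r rZ rZ True"
abbreviation "copy r a \<equiv> Add r a rZ False"

text \<open>No register records the head position, so the head first returns to the left end marker
  and then counts its way to the target.\<close>

definition goto :: "'x reg \<Rightarrow> ('i, 'o, 'x reg) com" where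
  "goto r = seqs [Loop (Cell (\<lambda>x. x \<noteq> LeftEnd)) (Act GoLeft None), clr rG,
    Loop (Less rG r) (seqs [Act GoRight None, inc rG])]"

definition on_letter :: "('i \<Rightarrow> ('i, 'o, 'r) com) \<Rightarrow> ('i, 'o, 'r) com" where
  "on_letter f = Branch (\<lambda>x. case x of Input a \<Rightarrow> f a | _ \<Rightarrow> skip)"

definition modadd :: "'x reg \<Rightarrow> ('i, 'o, 'x reg) com" where
  "modadd a = seqs [Add rT rT a False, Cond (Less rT rM) skip (Sub rT rT rM)]"

lemma wp_rewind:
  "Q s 0 out \<Longrightarrow> p \<le> length w + 1 \<Longrightarrow> wp w B (Loop (Cell (\<lambda>x. x \<noteq> LeftEnd)) (Act GoLeft None)) Q s p out"
proof (induction p)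
  case 0
  then show ?case by (simp add: wp_Loop[of _ _ "Cell _"] input_at_def)
next
  case (Suc p)
  then show ?case by (subst wp_Loop) (simp add: input_at_def)
qed

lemma wp_goto:
  assumes "s rZ = 0" "s r \<le> length w + 1" "length w + 1 \<le> B" "r \<noteq> rG" "p \<le> length w + 1"
    and Q: "Q (s(rG := s r)) (s r) out"
  shows "wp w B (goto r) Q s p out"
proof -
  have "wp w B (Loop (Less rG r) (seqs [Act GoRight None, inc rG])) Q (s(rG := 0)) 0 out"
  proof (rule wp_upto[where Inv = "\<lambda>s' p' out'. out' = out \<and> p' = s' rG \<and> s' rG \<le> s r \<and>
      (\<forall>x. x \<noteq> rG \<longrightarrow> s' x = s x)"], goal_cases)
    case (2 s' p' out')
    then have "s' rZ = 0" "s' r = s r" using assms(1,4) by auto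
    then show ?case using 2 assms by simp
  next
    case (3 s' p' out')
    then have "s' r = s r" using assms(4) by auto
    then have "s' = s(rG := s r)" "p' = s r" "out' = out" using 3 by (auto simp: fun_eq_iff)
    then show ?case using Q by simp
  qed simp
  then show ?thesis
    unfolding goto_def by (simp only: wp_seqs) (rule wp_rewind, use assms in simp_all)
qed

lemma wp_on_letter:
  "1 \<le> p \<Longrightarrow> p \<le> length w \<Longrightarrow> wp w B (on_letter f) Q s p out = wp w B (f (w ! (p - 1))) Q s p out"
  by (simp add: on_letter_def input_at_def)

lemma wp_modadd:
  assumes "s rT < s rM" "s a < s rM" "2 * s rM \<le> B" "a \<noteq> rT"
    and "Q (s(rT := (s rT + s a) mod s rM)) p out"
  shows "wp w B (modadd a) Q s p out"
  using assms by (cases "s rT + s a < s rM") (auto simp: modadd_def le_mod_geq)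

lemma wp_modadds:
  assumes "s rT < s rM" "\<forall>a \<in> set as. s a < s rM \<and> a \<noteq> rT" "2 * s rM \<le> B"
    and "Q (s(rT := (s rT + (\<Sum>a\<leftarrow>as. s a)) mod s rM)) p out"
  shows "wp w B (seqs (map modadd as)) Q s p out"
  using assms
proof (induction as arbitrary: s)
  case (Cons a as)
  let ?s = "s(rT := (s rT + s a) mod s rM)"
  have upd: "map ?s as = map s as" using Cons.prems(2) by auto
  have eq: "?s(rT := (?s rT + (\<Sum>a\<leftarrow>as. s a)) mod ?s rM) =
      s(rT := (s rT + (\<Sum>a\<leftarrow>a # as. s a)) mod s rM)"
    by (simp add: mod_add_left_eq add.assoc)
  have "wp w B (seqs (map modadd as)) Q ?s p out"
  proof (rule Cons.IH)
    show "Q (?s(rT := (?s rT + (\<Sum>a\<leftarrow>as. ?s a)) mod ?s rM)) p out"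
      using Cons.prems(4) unfolding upd eq .
  qed (use Cons.prems in auto)
  then show ?case
    using Cons.prems by (simp only: list.map wp_seqs) (rule wp_modadd, auto)
qed simp

text \<open>Adding \<open>m\<close> first keeps the difference of two residues in the natural
  numbers; it stays below \<open>2 * m\<close>, so one conditional subtraction reduces it.\<close>

lemma nat_mod_diff:
  fixes a b :: int and m :: nat
  assumes "0 < m"
  defines "t \<equiv> nat (a mod int m) + m - nat (b mod int m)"
  shows "(if t < m then t else t - m) = nat ((a - b) mod int m)"
proof -
  let ?a = "a mod int m" and ?b = "b mod int m"
  have r: "0 \<le> ?a" "?a < int m" "0 \<le> ?b" "?b < int m" using assms(1) by simp_all
  have t: "int t = ?a + int m - ?b" unfolding t_def using r by (simp add: of_nat_diff)
  have eq: "(a - b) mod int m = (?a - ?b) mod int m" by (simp add: mod_diff_eq)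
  show ?thesis
  proof (cases "t < m")
    case True
    then have "(?a - ?b) mod int m = ?a - ?b + int m"
      using t r by (intro int_mod_pos_eq[of _ _ "-1"]) auto
    then show ?thesis using True t eq by simp
  next
    case False
    then have "0 \<le> ?a - ?b" "?a - ?b < int m" using t r by linarith+
    then have "(?a - ?b) mod int m = ?a - ?b" by (rule mod_pos_pos_trivial)
    then show ?thesis using False t eq by simp
  qed
qed

locale nf_program = inv_alphabet X iv J for X :: "'x set" and iv J +
  fixes xs :: "'x list"
  assumes set_xs: "set xs = X" and distinct_xs: "distinct xs"
begin

text \<open>Each neighbour is listed twice, which turns \<open>2 * nbsum b v\<close> into modular
  additions only.\<close>

definition reflect_prog :: "'x \<Rightarrow> 'x prog" where
  "reflect_prog b = seqs ([clr rT] @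
    map modadd (concat (map (\<lambda>c. [rV c, rV c]) (filter (\<lambda>c. c \<noteq> b \<and> (b, c) \<notin> J) xs))) @
    [Add rT rT rM False, Sub rT rT (rV b), Cond (Less rT rM) skip (Sub rT rT rM), copy (rV b) rT])"

definition act_prog :: "'x \<Rightarrow> 'x prog" where
  "act_prog x = Seq (if iv x = x then skip else reflect_prog (iv x)) (reflect_prog x)"

definition init_prog :: "'x \<Rightarrow> 'x prog" where
  "init_prog x = seqs (map (\<lambda>b. seqs (clr (rV b) # replicate (nat (rho x b)) (inc (rV b)))) xs)"

text \<open>Multiplication by an entry of \<open>rho\<close>, at most 3, is repeated addition.
  \<open>rE\<close> is only ever cleared here, so a failure for one modulus persists through all
  later ones.\<close>

definition cmp_prog :: "'x \<Rightarrow> 'x prog" where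
  "cmp_prog y = seqs (map (\<lambda>b. seqs ([clr rT] @ map modadd (replicate (nat (rho y b)) (rV (iv y))) @
    [Cond (Less rT (rV b)) (clr rE) skip, Cond (Less (rV b) rT) (clr rE) skip])) xs)"

text \<open>Positions count from 1, as cell 0 carries the left end marker: the register value
  \<open>r\<close> stands for \<open>w ! (r - 1)\<close>. The loop stops with the head on
  \<open>hi\<close>, whose letter is not applied but compared with.\<close>

definition test_body :: "'x reg \<Rightarrow> 'x reg \<Rightarrow> 'x prog" where
  "test_body lo hi = seqs [goto lo, on_letter init_prog, copy rK lo,
     Loop (Less rK hi) (seqs [on_letter (\<lambda>x. act_prog (iv x)), Act GoRight None, inc rK]),
     on_letter cmp_prog, inc rM]"

definition test_prog :: "'x reg \<Rightarrow> 'x reg \<Rightarrow> 'x prog" where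
  "test_prog lo hi = seqs [set1 rE, set1 rM, inc rM, inc rM, inc rM, Loop (Less rM rB) (test_body lo hi)]"

text \<open>The increment between the loops skips the position \<open>rI\<close> itself.
  \<open>test_prog\<close> always receives the smaller position first.\<close>

definition kept_prog :: "'x prog" where
  "kept_prog = seqs [set1 rQ, clr rP, set1 rJ,
    Loop (Less rJ rI) (seqs [test_prog rJ rI, Cond (Less rZ rE) (clr rQ) skip, inc rJ]),
    inc rJ,
    Loop (Less rJ rN) (seqs [test_prog rI rJ,
      Cond (Less rZ rE) (Cond (Less rZ rP) (clr rP) (set1 rP)) skip, inc rJ]),
    Cond (Less rZ rP) (clr rQ) skip]"

text \<open>The first \<open>rC y\<close> occurrences of \<open>y\<close> are already emitted and
  are skipped. The candidate \<open>x\<close> is accessible if a pending \<open>x\<close> is met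
  before any pending letter dependent on it; as \<open>x\<close> depends on itself, it sets
  \<open>rF\<close> too, and later letters cannot change the verdict.\<close>

definition visit_prog :: "'x \<Rightarrow> 'x \<Rightarrow> 'x prog" where
  "visit_prog x y = Cond (Less (rS y) (rC y)) (inc (rS y))
    (if (x, y) \<in> J then skip
     else Cond (Less rZ rF) skip (Seq (set1 rF) (if x = y then set1 rD else skip)))"

definition scan_prog :: "'x \<Rightarrow> 'x prog" where
  "scan_prog x = seqs ([clr rF, clr rD] @ map (\<lambda>y. clr (rS y)) xs @ [set1 rI,
    Loop (Less rI rN) (seqs [kept_prog,
      Cond (Less rZ rQ) (Seq (goto rI) (on_letter (visit_prog x))) skip, inc rI])])"

definition emit_prog :: "'x list \<Rightarrow> 'x prog" where
  "emit_prog ys = foldr (\<lambda>x c. Seq (scan_prog x)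
    (Cond (Less rZ rD) (Seq (Act Stay (Some x)) (inc (rC x))) c)) ys skip"

text \<open>Reaching the right end marker takes one move more than the input has letters, so
  \<open>rN\<close> is the length plus one. It is the exclusive bound for positions and also the
  number of rounds; rounds after the last pending letter emit nothing.\<close>

definition nf_prog :: "'x prog" where
  "nf_prog = seqs ([Loop (Cell (\<lambda>x. x \<noteq> RightEnd)) (seqs [Act GoRight None, inc rN])] @
    replicate (8 * card X + 16) (Add rB rB rN False) @
    [Loop (Less rR rN) (seqs [emit_prog xs, inc rR])])"

definition registers :: "'x reg set" where
  "registers = {rT, rM, rK, rG, rE, rJ, rP, rQ, rI, rF, rD, rR, rZ, rN, rB} \<union>
    rV ` X \<union> rS ` X \<union> rC ` X"

lemma finite_registers: "finite registers"
  by (simp add: registers_def finite_X)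

end

section \<open>Correctness of the normal form program\<close>

locale nf_run = nf_program X iv J xs for X :: "'x set" and iv J xs +
  fixes w :: "'x list" and B :: nat
  assumes w: "set w \<subseteq> X" and B: "2 * modulus_bound (length w) + 4 \<le> B"
begin

abbreviation "n \<equiv> length w"
abbreviation "bd \<equiv> modulus_bound (length w)"

lemma bd_ge: "Suc n \<le> bd" "16 \<le> bd"
  using mult_le_mono1[of 1 "8 * card X + 16" "Suc n"] by (simp_all add: modulus_bound_def)

lemma B_ge: "2 * bd \<le> B" "n + 1 \<le> B" "n + 2 \<le> B" "4 \<le> B" "bd + 4 \<le> B"
  using B bd_ge by simp_all

definition base :: "('x reg \<Rightarrow> nat) \<Rightarrow> bool" where
  "base s \<longleftrightarrow> s rZ = 0 \<and> s rN = Suc n \<and> s rB = bd"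

lemma base_agree: "agree k s s' \<Longrightarrow> k \<le> 5 \<Longrightarrow> base s \<Longrightarrow> base s'"
  by (simp add: base_def agree_def)

definition vrep :: "nat \<Rightarrow> ('x \<Rightarrow> int) \<Rightarrow> ('x reg \<Rightarrow> nat) \<Rightarrow> bool" where
  "vrep m v s \<longleftrightarrow> s rM = m \<and> (\<forall>c \<in> X. s (rV c) = nat (v c mod int m))"

lemma wp_reflect_prog:
  assumes v: "vrep m v s" and m: "4 \<le> m" "m \<le> bd" and z: "s rZ = 0" and b: "b \<in> X"
    and Q: "\<And>s'. agree 1 s s' \<Longrightarrow> vrep m (reflect b v) s' \<Longrightarrow> Q s' p out"
  shows "wp w B (reflect_prog b) Q s p out"
proof -
  let ?l = "filter (\<lambda>c. c \<noteq> b \<and> (b, c) \<notin> J) xs"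
  define as :: "'x reg list" where "as = concat (map (\<lambda>c. [rV c, rV c]) ?l)"
  let ?t = "nat ((2 * nbsum b v) mod int m)"
  let ?c = "seqs [Add rT rT rM False, Sub rT rT (rV b), Cond (Less rT rM) skip (Sub rT rT rM),
    copy (rV b) rT]"
  have M: "s rM = m" and V: "\<And>c. c \<in> X \<Longrightarrow> s (rV c) = nat (v c mod int m)"
    using v by (auto simp: vrep_def)
  have lt: "nat (k mod int m) < m" for k using m by (simp add: nat_less_iff)
  have "(\<Sum>a\<leftarrow>concat (map (\<lambda>c. [rV c, rV c]) l). s a) = (\<Sum>c\<leftarrow>l. 2 * s (rV c))" for l
    by (induction l) auto
  then have "(\<Sum>a\<leftarrow>as. s a) = (\<Sum>c \<in> set ?l. 2 * s (rV c))"
    unfolding as_def using sum_list_distinct_conv_sum_set[of ?l "\<lambda>c. 2 * s (rV c)"] distinct_xs by simp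
  also have "set ?l = {c \<in> X. c \<noteq> b \<and> (b, c) \<notin> J}" using set_xs by auto
  finally have sum: "int (\<Sum>a\<leftarrow>as. s a) =
      (\<Sum>c \<in> {c \<in> X. c \<noteq> b \<and> (b, c) \<notin> J}. 2 * (v c mod int m))"
    using V m by (simp add: of_nat_sum)
  have "int ((\<Sum>a\<leftarrow>as. s a) mod m) = (2 * nbsum b v) mod int m"
    unfolding of_nat_mod sum nbsum_def sum_distrib_left
    by (subst (1 2) mod_sum_eq[symmetric]) (simp add: mod_mult_right_eq)
  then have t: "(\<Sum>a\<leftarrow>as. s a) mod m = ?t" by linarith
  have red: "(if ?t + m - s (rV b) < m then ?t + m - s (rV b) else ?t + m - s (rV b) - m) =
      nat (reflect b v b mod int m)" (is "?r = _")
    using nat_mod_diff[of m "2 * nbsum b v" "v b"] m by (simp only: V[OF b] reflect_def fun_upd_same)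
  have Q': "Q (s(rT := ?r, rV b := ?r)) p out"
  proof (rule Q)
    show "agree 1 s (s(rT := ?r, rV b := ?r))" by (simp add: agree_def)
    show "vrep m (reflect b v) (s(rT := ?r, rV b := ?r))"
      unfolding red using M V by (auto simp: vrep_def reflect_def)
  qed
  have 1: "wp w B ?c Q (s(rT := ?t)) p out"
  proof (cases "?t + m - s (rV b) < m")
    case True
    then have "?r = ?t + m - s (rV b)" by simp
    then show ?thesis
      using Q' True M z lt[of "2 * nbsum b v"] lt[of "v b"] V[OF b] m B_ge(1) by simp
  next
    case False
    then have "?r = ?t + m - s (rV b) - m" by simp
    then show ?thesis
      using Q' False M z lt[of "2 * nbsum b v"] lt[of "v b"] V[OF b] m B_ge(1) by simp
  qed
  have "wp w B (seqs (map modadd as)) (wp w B ?c Q) (s(rT := 0)) p out"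
  proof (rule wp_modadds)
    let ?s0 = "s(rT := 0)"
    have upd: "map ?s0 as = map s as" by (auto simp: as_def)
    have eq: "?s0(rT := (?s0 rT + (\<Sum>a\<leftarrow>as. ?s0 a)) mod ?s0 rM) = s(rT := ?t)"
      unfolding upd using t M by simp
    show "wp w B ?c Q (?s0(rT := (?s0 rT + (\<Sum>a\<leftarrow>as. ?s0 a)) mod ?s0 rM)) p out"
      unfolding eq by (rule 1)
  qed (use M V lt m B_ge(1) set_xs in \<open>auto simp: as_def\<close>)
  then show ?thesis by (simp add: reflect_prog_def as_def)
qed

lemma wp_act_prog:
  assumes v: "vrep m v s" and m: "4 \<le> m" "m \<le> bd" and z: "s rZ = 0" and x: "x \<in> X"
    and Q: "\<And>s'. agree 1 s s' \<Longrightarrow> vrep m (act x v) s' \<Longrightarrow> Q s' p out"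
  shows "wp w B (act_prog x) Q s p out"
proof (cases "iv x = x")
  case True
  then show ?thesis
    unfolding act_prog_def using Q by (simp add: act_def) (rule wp_reflect_prog[OF v m z x], simp)
next
  case False
  have "wp w B (reflect_prog (iv x)) (wp w B (reflect_prog x) Q) s p out"
  proof (rule wp_reflect_prog[OF v m z])
    fix s1 assume 1: "agree 1 s s1" "vrep m (reflect (iv x) v) s1"
    show "wp w B (reflect_prog x) Q s1 p out"
    proof (rule wp_reflect_prog[OF 1(2) m])
      show "s1 rZ = 0" using z agreeD[OF 1(1), of rZ] by simp
    next
      fix s2 assume 2: "agree 1 s1 s2" "vrep m (reflect x (reflect (iv x) v)) s2"
      show "Q s2 p out"
        using Q[OF agree_trans[OF 1(1) 2(1)]] 2(2) False by (simp add: act_def)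
    qed (rule x)
  qed (use x in simp)
  then show ?thesis using False by (simp add: act_prog_def)
qed

lemma wp_incs:
  assumes "s rZ = 0" "r \<noteq> rZ" "s r + k \<le> B" "Q (s(r := s r + k)) p out"
  shows "wp w B (seqs (replicate k (inc r))) Q s p out"
  using assms by (induction k arbitrary: s) simp_all

lemma wp_init_prog:
  assumes z: "s rZ = 0" and m: "4 \<le> s rM"
    and Q: "\<And>s'. agree 1 s s' \<Longrightarrow> vrep (s rM) (rho x) s' \<Longrightarrow> Q s' p out"
  shows "wp w B (init_prog x) Q s p out"
proof -
  let ?f = "\<lambda>b. nat (rho x b)"
  let ?s = "\<lambda>r. case r of rV b \<Rightarrow> if b \<in> set xs then ?f b else s r | _ \<Rightarrow> s r"
  have "wp w B (seqs (map (\<lambda>b. seqs (clr (rV b) # replicate (?f b) (inc (rV b)))) ys)) Q s p out"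
    if "s rZ = 0" "Q (\<lambda>r. case r of rV b \<Rightarrow> if b \<in> set ys then ?f b else s r | _ \<Rightarrow> s r) p out"
    for ys s
    using that
  proof (induction ys arbitrary: s)
    case Nil
    have "(\<lambda>r. case r of rV b \<Rightarrow> if b \<in> set [] then ?f b else s r | _ \<Rightarrow> s r) = s"
      by (auto simp: fun_eq_iff split: reg.splits)
    then show ?case using Nil by simp
  next
    case (Cons b ys)
    have eq: "(\<lambda>r. case r of rV c \<Rightarrow> if c \<in> set ys then ?f c else (s(rV b := ?f b)) r
        | _ \<Rightarrow> (s(rV b := ?f b)) r) =
      (\<lambda>r. case r of rV c \<Rightarrow> if c \<in> set (b # ys) then ?f c else s r | _ \<Rightarrow> s r)"
      by (auto simp: fun_eq_iff split: reg.splits)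
    let ?R = "wp w B (seqs (map (\<lambda>b. seqs (clr (rV b) # replicate (?f b) (inc (rV b)))) ys)) Q"
    have R: "?R (s(rV b := ?f b)) p out"
      by (rule Cons.IH) (simp add: Cons.prems(1), use Cons.prems(2) in \<open>simp only: eq\<close>)
    have "?f b \<le> 3" by (simp add: rho_def)
    then have "wp w B (seqs (replicate (?f b) (inc (rV b)))) ?R (s(rV b := 0)) p out"
      using R Cons.prems(1) B_ge(4) by (intro wp_incs) auto
    then show ?case by simp
  qed
  then show ?thesis
    unfolding init_prog_def
  proof this
    show "Q ?s p out"
    proof (rule Q)
      show "agree 1 s ?s"
        by (auto simp: agree_def split: reg.splits)
      \<comment> \<open>Entries of \<open>rho\<close> are at most 3 and the modulus is at least 4,
        so the loaded values already are residues.\<close>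
      show "vrep (s rM) (rho x) ?s"
        using m set_xs by (auto simp: vrep_def rho_def)
    qed
  qed (rule z)
qed

lemma wp_cmp_prog:
  assumes v: "vrep m v s" and m: "4 \<le> m" "m \<le> bd" and y: "y \<in> X"
    and Q: "\<And>s'. agree 1 (s(rE := e)) s' \<Longrightarrow> Q s' p out"
    and e: "e = (if \<forall>b \<in> X. int m dvd defect v y b then s rE else 0)"
  shows "wp w B (cmp_prog y) Q s p out"
proof -
  let ?P = "\<lambda>b. int m dvd defect v y b"
  let ?c = "\<lambda>b. seqs ([clr rT] @ map modadd (replicate (nat (rho y b)) (rV (iv y))) @
    [Cond (Less rT (rV b)) (clr rE) skip, Cond (Less (rV b) rT) (clr rE) skip])"
  have "wp w B (seqs (map ?c ys)) Q s1 p out"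
    if "vrep m v s1" "set ys \<subseteq> X"
      "\<And>s'. (\<forall>r. r \<noteq> rT \<longrightarrow> r \<noteq> rE \<longrightarrow> s' r = s1 r) \<Longrightarrow>
        s' rE = (if \<forall>b \<in> set ys. ?P b then s1 rE else 0) \<Longrightarrow> Q s' p out"
    for ys s1
    using that
  proof (induction ys arbitrary: s1)
    case Nil
    then show ?case by simp
  next
    case (Cons b ys)
    have M: "s1 rM = m" and V: "\<And>c. c \<in> X \<Longrightarrow> s1 (rV c) = nat (v c mod int m)"
      using Cons.prems(1) by (auto simp: vrep_def)
    have b: "b \<in> X" using Cons.prems(2) by simp
    have lt: "nat (k mod int m) < m" for k using m by (simp add: nat_less_iff)
    let ?t = "(nat (rho y b) * s1 (rV (iv y))) mod m"
    have "int ?t = (rho y b * v (iv y)) mod int m"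
      using m V[of "iv y"] y rho_nonneg[of y b] by (simp add: of_nat_mod mod_mult_right_eq)
    moreover have "int (s1 (rV b)) = v b mod int m" using V[OF b] m by simp
    ultimately have P: "?P b \<longleftrightarrow> ?t = s1 (rV b)"
      by (metis mod_eq_dvd_iff of_nat_eq_iff)
    let ?R = "wp w B (seqs (map ?c ys)) Q"
    let ?d = "seqs [Cond (Less rT (rV b)) (clr rE) skip, Cond (Less (rV b) rT) (clr rE) skip]"
    have R: "?R s2 p out" if s2: "s2 = s1(rT := ?t, rE := if ?P b then s1 rE else 0)" for s2
    proof (rule Cons.IH)
      show "vrep m v s2" using Cons.prems(1) s2 by (simp add: vrep_def)
      show "set ys \<subseteq> X" using Cons.prems(2) by simp
      show "Q s' p out" if "\<forall>r. r \<noteq> rT \<longrightarrow> r \<noteq> rE \<longrightarrow> s' r = s2 r"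
        "s' rE = (if \<forall>b \<in> set ys. ?P b then s2 rE else 0)" for s'
        by (rule Cons.prems(3)) (use that s2 in auto)
    qed
    have upd: "s1(rT := ?t) = s1(rT := ?t, rE := s1 rE)" by auto
    have 1: "wp w B ?d
        ?R (s1(rT := ?t)) p out"
    proof (cases "?P b")
      case True
      then have "?R (s1(rT := ?t)) p out" by (intro R) (auto simp: fun_eq_iff)
      then show ?thesis using True P by simp
    next
      case False
      then have "?R (s1(rT := ?t, rE := 0)) p out" by (intro R) (auto simp: fun_eq_iff)
      moreover have "?t < s1 (rV b) \<or> s1 (rV b) < ?t" using False P by linarith
      ultimately show ?thesis by auto
    qed
    have "wp w B (seqs (map modadd (replicate (nat (rho y b)) (rV (iv y)))))
        (wp w B ?d ?R)
        (s1(rT := 0)) p out"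
    proof (rule wp_modadds)
      show "wp w B ?d ?R
        (s1(rT := 0, rT := ((s1(rT := 0)) rT +
          (\<Sum>a\<leftarrow>replicate (nat (rho y b)) (rV (iv y)). (s1(rT := 0)) a)) mod (s1(rT := 0)) rM)) p out"
        using 1 M by (simp add: sum_list_replicate)
    qed (use M V y lt m B_ge(1) in auto)
    then show ?case by simp
  qed
  then show ?thesis
    unfolding cmp_prog_def
  proof this
    show "Q s' p out" if "\<forall>r. r \<noteq> rT \<longrightarrow> r \<noteq> rE \<longrightarrow> s' r = s r"
      "s' rE = (if \<forall>b \<in> set xs. ?P b then s rE else 0)" for s'
    proof (rule Q)
      have "s' r = (s(rE := e)) r" if "1 \<le> level r" for r
      proof (cases "r = rE")
        case True
        then show ?thesis using \<open>s' rE = _\<close> e set_xs by simp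
      next
        case False
        moreover have "r \<noteq> rT" using that by auto
        ultimately show ?thesis using \<open>\<forall>r. r \<noteq> rT \<longrightarrow> _ r\<close> by simp
      qed
      then show "agree 1 (s(rE := e)) s'" by (simp add: agree_def)
    qed
  qed (use v set_xs in auto)
qed

fun drop_cnt :: "('x \<Rightarrow> nat) \<Rightarrow> 'x list \<Rightarrow> 'x list" where
  "drop_cnt C [] = []"
| "drop_cnt C (y # u) = (if 0 < C y then drop_cnt (C(y := C y - 1)) u else y # drop_cnt C u)"

lemma drop_cnt_snoc:
  "drop_cnt C (u @ [y]) = drop_cnt C u @ (if count_list u y < C y then [] else [y])"
  by (induction u arbitrary: C) auto

lemma drop_cnt_0 [simp]: "drop_cnt (\<lambda>_. 0) u = u"
  by (induction u) auto

text \<open>Counting one more emitted \<open>x\<close> has the effect of the \<open>remove1\<close>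
  in \<open>lexnf\<close>, which links the counters with the greedy recursion.\<close>

lemma drop_cnt_Suc:
  "x \<in> set (drop_cnt C u) \<Longrightarrow> drop_cnt (C(x := Suc (C x))) u = remove1 x (drop_cnt C u)"
proof (induction u arbitrary: C)
  case (Cons y u)
  show ?case
  proof (cases "0 < C y")
    case True
    let ?C = "C(y := C y - 1)"
    have "x \<in> set (drop_cnt ?C u)" using Cons.prems True by simp
    then have IH: "drop_cnt (?C(x := Suc (?C x))) u = remove1 x (drop_cnt ?C u)" by (rule Cons.IH)
    have upd: "?C(x := Suc (?C x)) = (C(x := Suc (C x)))(y := (C(x := Suc (C x))) y - 1)"
      and pos: "0 < (C(x := Suc (C x))) y"
      using True by auto
    show ?thesis
      using IH unfolding upd by (simp only: drop_cnt.simps if_P[OF pos] if_P[OF True])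
  next
    case False
    show ?thesis
    proof (cases "x = y")
      case True
      then have "C(y := 0) = C" using False by auto
      then show ?thesis using False True by (simp add: fun_upd_same del: fun_upd_apply)
    next
      case neq: False
      then show ?thesis using False Cons by simp
    qed
  qed
qed simp

lemma front_snoc: "front x (u @ [y]) \<longleftrightarrow> front x u \<or> (\<forall>z \<in> set u. (x, z) \<in> J) \<and> x = y"
  by (induction u) auto

lemma nth_X: "k < n \<Longrightarrow> w ! k \<in> X"
  using w by auto

lemma wp_test_body:
  assumes base: "base s" and lev: "2 \<le> level lo" "2 \<le> level hi"
    and lohi: "1 \<le> s lo" "s lo < s hi" "s hi \<le> n"
    and m: "4 \<le> s rM" "s rM < bd" and p: "p \<le> n + 1"
    and Q: "\<And>s' p'. agree 2 s s' \<Longrightarrow> p' \<le> n + 1 \<Longrightarrow> s' rM = Suc (s rM) \<Longrightarrow>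
      s' rE = (if \<forall>b \<in> X. int (s rM) dvd defect (test_vec w (s lo - 1) (s hi - 1)) (w ! (s hi - 1)) b
        then s rE else 0) \<Longrightarrow> Q s' p' out"
  shows "wp w B (test_body lo hi) Q s p out"
proof -
  let ?i = "s lo - 1" and ?j = "s hi - 1" and ?m = "s rM"
  have ne: "lo \<noteq> rG" "lo \<noteq> rK" "hi \<noteq> rK" using lev by auto
  let ?K = "wp w B (on_letter cmp_prog) (wp w B (inc rM) Q)"
  let ?L = "Loop (Less rK hi) (seqs [on_letter (\<lambda>x. act_prog (iv x)), Act GoRight None, inc rK])"
  have z: "s' rZ = 0" if "agree 2 s s'" for s'
    using agreeD[OF that, of rZ] base by (simp add: base_def)
  \<comment> \<open>The letters from index \<open>?i\<close> up to, but excluding,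
    \<open>rK - 1\<close> have been applied; the head stands on the next one.\<close>
  let ?Inv = "\<lambda>s' p' out'. agree 2 s s' \<and> out' = out \<and> s' rE = s rE \<and> s lo \<le> s' rK \<and>
    s' rK \<le> s hi \<and> p' = s' rK \<and> vrep ?m (test_vec w ?i (s' rK - 1)) s'"
  have loop: "wp w B ?L ?K s1 p1 out"
    if "?Inv s1 p1 out" for s1 p1
  proof (rule wp_upto[where Inv = ?Inv])
    show "?Inv s1 p1 out" by (rule that)
  next
    fix s2 p2 out2
    assume I: "?Inv s2 p2 out2" and lt: "s2 rK < s2 hi"
    have hi: "s2 hi = s hi" using I lev by (simp add: agree_def)
    let ?k = "s2 rK - 1"
    let ?R = "\<lambda>s' p' out'. ?Inv s' p' out' \<and> s' rK = Suc (s2 rK) \<and> s' hi = s2 hi"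
    have k: "?i \<le> ?k" "?k < n" "1 \<le> p2" "p2 \<le> n" "?k < ?j" "p2 = Suc ?k"
      using I lt hi lohi by auto
    have "wp w B (act_prog (iv (w ! ?k))) (wp w B (Act GoRight None) (wp w B (inc rK)
        ?R)) s2 p2 out2"
    proof (rule wp_act_prog)
      show "vrep ?m (test_vec w ?i ?k) s2" using I by simp
      show "s2 rZ = 0" using I z by blast
      show "iv (w ! ?k) \<in> X" using nth_X k by simp
    next
      fix s3 assume 3: "agree 1 s2 s3" "vrep ?m (act (iv (w ! ?k)) (test_vec w ?i ?k)) s3"
      have eqs: "s3 rK = s2 rK" "s3 rE = s2 rE" "s3 rZ = 0" "s3 hi = s2 hi"
        using agreeD[OF 3(1)] I z[of s2] lev by simp_all
      have "agree 2 s s3" using I by (intro agree_trans[OF _ 3(1)]) auto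
      moreover have "test_vec w ?i (Suc ?k) = act (iv (w ! ?k)) (test_vec w ?i ?k)"
        by (rule test_vec_Suc) (use k in auto)
      ultimately show "wp w B (Act GoRight None) (wp w B (inc rK)
          ?R) s3 p2 out2"
        using I lt hi lohi k eqs 3(2) B_ge ne by (auto simp: vrep_def)
    qed (use m in auto)
    then show "wp w B (seqs [on_letter (\<lambda>x. act_prog (iv x)), Act GoRight None, inc rK])
        ?R s2 p2 out2"
      using k I by (simp only: wp_seqs wp_on_letter)
  next
    fix s2 p2 out2
    assume I: "?Inv s2 p2 out2" and ge: "\<not> s2 rK < s2 hi"
    have "s2 hi = s hi" using I lev by (simp add: agree_def)
    then have k: "s2 rK = s hi" using I ge by simp
    have "wp w B (cmp_prog (w ! ?j)) (wp w B (inc rM) Q) s2 p2 out2"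
    proof (rule wp_cmp_prog)
      show "vrep ?m (test_vec w ?i ?j) s2" using I k by simp
      show "w ! ?j \<in> X" using nth_X lohi by simp
    next
      fix s3
      let ?e = "if \<forall>b \<in> X. int ?m dvd defect (test_vec w ?i ?j) (w ! ?j) b
        then s2 rE else 0"
      assume 3: "agree 1 (s2(rE := ?e)) s3"
      have a: "agree 2 s (s2(rE := ?e))" using I by simp
      have a3: "agree 2 s s3" by (rule agree_trans[OF a 3]) auto
      have eqs: "s3 rM = ?m" "s3 rE = ?e" "s3 rZ = 0"
        using agreeD[OF 3, of rM] agreeD[OF 3, of rE] z[OF a3] I by (simp_all add: vrep_def)
      have "Q (s3(rM := Suc ?m)) p2 out"
        by (rule Q) (use a3 eqs I k lohi in auto)
      then show "wp w B (inc rM) Q s3 p2 out2"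
        using I eqs m B_ge by simp
    qed (use m in auto)
    then show "wp w B (on_letter cmp_prog) (wp w B (inc rM) Q) s2 p2 out2"
      using I k lohi by (simp only: wp_on_letter)
  qed
  have "wp w B (init_prog (w ! ?i)) (wp w B (copy rK lo) (wp w B ?L ?K)) (s(rG := s lo)) (s lo) out"
  proof (rule wp_init_prog)
    fix s1 assume 1: "agree 1 (s(rG := s lo)) s1" "vrep ((s(rG := s lo)) rM) (rho (w ! ?i)) s1"
    have a: "agree 2 s (s(rG := s lo))" by simp
    have a1: "agree 2 s s1" by (rule agree_trans[OF a 1(1)]) auto
    have eqs: "s1 lo = s lo" "s1 rE = s rE" "s1 rZ = 0"
      using agreeD[OF a1 lev(1)] agreeD[OF 1(1), of rE] z[OF a1] by simp_all
    have "wp w B ?L ?K (s1(rK := s lo)) (s lo) out"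
      by (rule loop) (use a1 eqs 1(2) lohi in \<open>auto simp: vrep_def test_vec_start\<close>)
    then show "wp w B (copy rK lo) (wp w B ?L ?K)
        s1 (s lo) out"
      using eqs lohi B_ge by simp
  qed (use base m in \<open>auto simp: base_def\<close>)
  then have "wp w B (on_letter init_prog) (wp w B (copy rK lo) (wp w B ?L ?K)) (s(rG := s lo)) (s lo) out"
    using lohi by (simp only: wp_on_letter)
  then show ?thesis
    unfolding test_body_def wp_seqs using base lohi B_ge p ne
    by (intro wp_goto) (auto simp: base_def)
qed

lemma wp_test_prog:
  assumes base: "base s" and lev: "2 \<le> level lo" "2 \<le> level hi"
    and lohi: "1 \<le> s lo" "s lo < s hi" "s hi \<le> n" and p: "p \<le> n + 1"
    and Q: "\<And>s' p'. agree 2 s s' \<Longrightarrow> p' \<le> n + 1 \<Longrightarrow>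
      s' rE = of_bool (sim (walls w ! (s lo - 1)) (walls w ! (s hi - 1))) \<Longrightarrow> Q s' p' out"
  shows "wp w B (test_prog lo hi) Q s p out"
proof -
  let ?i = "s lo - 1" and ?j = "s hi - 1"
  let ?P = "\<lambda>m. \<forall>b \<in> X. int m dvd defect (test_vec w ?i ?j) (w ! ?j) b"
  let ?Inv = "\<lambda>s' p' out'. agree 2 s s' \<and> out' = out \<and> p' \<le> n + 1 \<and> 4 \<le> s' rM \<and> s' rM \<le> bd \<and>
    s' rE = of_bool (\<forall>m. 4 \<le> m \<longrightarrow> m < s' rM \<longrightarrow> ?P m)"
  have z: "s rZ = 0" using base by (simp add: base_def)
  have "wp w B (Loop (Less rM rB) (test_body lo hi)) Q (s(rE := 1, rM := 4)) p out"
  proof (rule wp_upto[where Inv = ?Inv])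
    show "?Inv (s(rE := 1, rM := 4)) p out" using p bd_ge by simp
  next
    fix s1 p1 out1 assume I: "?Inv s1 p1 out1" and lt: "s1 rM < s1 rB"
    then have a: "agree 2 s s1" by blast
    have b1: "base s1" by (rule base_agree[OF a _ base]) simp
    have eqs: "s1 lo = s lo" "s1 hi = s hi" using agreeD[OF a] lev by auto
    have lt': "s1 rM < bd" using lt b1 by (simp add: base_def)
    show "wp w B (test_body lo hi)
      (\<lambda>s' p' out'. ?Inv s' p' out' \<and> s' rM = Suc (s1 rM) \<and> s' rB = s1 rB) s1 p1 out1"
    proof (rule wp_test_body[OF b1 lev])
      fix s2 p2
      assume 2: "agree 2 s1 s2" "p2 \<le> n + 1" "s2 rM = Suc (s1 rM)"
        "s2 rE = (if \<forall>b \<in> X. int (s1 rM) dvd defect (test_vec w (s1 lo - 1) (s1 hi - 1)) (w ! (s1 hi - 1)) b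
          then s1 rE else 0)"
      have "s2 rE = (if ?P (s1 rM) then s1 rE else 0)" using 2(4) unfolding eqs .
      also have "\<dots> = of_bool (\<forall>m. 4 \<le> m \<longrightarrow> m < Suc (s1 rM) \<longrightarrow> ?P m)"
        using I unfolding less_Suc_eq by (auto split: if_splits)
      finally have "s2 rE = of_bool (\<forall>m. 4 \<le> m \<longrightarrow> m < s2 rM \<longrightarrow> ?P m)" unfolding 2(3) .
      moreover have "agree 2 s s2" by (rule agree_trans[OF a 2(1)]) auto
      moreover have "s2 rB = s1 rB" using agreeD[OF 2(1), of rB] by simp
      ultimately show "?Inv s2 p2 out1 \<and> s2 rM = Suc (s1 rM) \<and> s2 rB = s1 rB"
        using I 2 lt' by simp
    qed (use I lohi eqs lt' in auto)
  next
    fix s1 p1 out1 assume I: "?Inv s1 p1 out1" and ge: "\<not> s1 rM < s1 rB"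
    then have a: "agree 2 s s1" by blast
    have "base s1" by (rule base_agree[OF a _ base]) simp
    then have M: "s1 rM = bd" using ge I by (simp add: base_def)
    have "sim (walls w ! ?i) (walls w ! ?j) \<longleftrightarrow> (\<forall>m. 4 \<le> m \<longrightarrow> m < bd \<longrightarrow> ?P m)"
      by (rule sim_walls_iff_dvd[OF w]) (use lohi in auto)
    then have "s1 rE = of_bool (sim (walls w ! ?i) (walls w ! ?j))" using I M by simp
    then show "Q s1 p1 out1" using Q[OF a] I by simp
  qed
  moreover have "s(rE := 1, rM := 4) = s(rE := Suc 0, rM := Suc (Suc (Suc (Suc 0))))"
    by (simp add: eval_nat_numeral)
  ultimately show ?thesis
    using z B_ge(4) by (simp add: test_prog_def)
qed

lemma wp_kept_prog:
  assumes base: "base s" and i: "1 \<le> s rI" "s rI \<le> n" and p: "p \<le> n + 1"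
    and Q: "\<And>s' p'. agree 3 s s' \<Longrightarrow> p' \<le> n + 1 \<Longrightarrow>
      s' rQ = of_bool (kept_pos w (s rI - 1)) \<Longrightarrow> Q s' p' out"
  shows "wp w B kept_prog Q s p out"
proof -
  let ?i = "s rI - 1"
  \<comment> \<open>\<open>A\<close> and \<open>E\<close> are the two halves of
    \<open>kept_pos\<close> cut off at \<open>k\<close>; the first loop maintains \<open>A\<close>
    in \<open>rQ\<close>, the second one the parity of \<open>E\<close> in
    \<open>rP\<close>.\<close>
  define A where "A k \<longleftrightarrow> (\<forall>j<k. \<not> sim (walls w ! j) (walls w ! ?i))" for k
  define E where "E k = length (filter (\<lambda>j. sim (walls w ! ?i) (walls w ! j)) [Suc ?i..<k])" for k
  have A_0: "A 0" and A_Suc: "A (Suc k) \<longleftrightarrow> A k \<and> \<not> sim (walls w ! k) (walls w ! ?i)" for k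
    by (auto simp: A_def less_Suc_eq)
  have E_start: "E (Suc ?i) = 0"
    and E_Suc: "Suc ?i \<le> k \<Longrightarrow> E (Suc k) = E k + of_bool (sim (walls w ! ?i) (walls w ! k))" for k
    by (simp_all add: E_def)
  have kp: "kept_pos w ?i \<longleftrightarrow> A ?i \<and> even (E n)" by (simp add: kept_pos_def A_def E_def)
  let ?L1 = "Loop (Less rJ rI) (seqs [test_prog rJ rI, Cond (Less rZ rE) (clr rQ) skip, inc rJ])"
  let ?L2 = "Loop (Less rJ rN) (seqs [test_prog rI rJ,
      Cond (Less rZ rE) (Cond (Less rZ rP) (clr rP) (set1 rP)) skip, inc rJ])"
  let ?end = "Cond (Less rZ rP) (clr rQ) skip"
  let ?K = "wp w B (inc rJ) (wp w B ?L2 (wp w B ?end Q))"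
  let ?Inv1 = "\<lambda>s' p' out'. agree 3 s s' \<and> out' = out \<and> p' \<le> n + 1 \<and> 1 \<le> s' rJ \<and>
    s' rJ \<le> s rI \<and> s' rP = 0 \<and> s' rQ = of_bool (A (s' rJ - 1))"
  let ?Inv2 = "\<lambda>s' p' out'. agree 3 s s' \<and> out' = out \<and> p' \<le> n + 1 \<and> s rI < s' rJ \<and>
    s' rJ \<le> Suc n \<and> s' rP = of_bool (odd (E (s' rJ - 1))) \<and> s' rQ = of_bool (A ?i)"
  have z: "s rZ = 0" using base by (simp add: base_def)
  have fix3: "base s'" "s' rI = s rI" "s' rZ = 0" "s' rN = Suc n" if "agree 3 s s'" for s'
    using base_agree[OF that _ base] agreeD[OF that, of rI] by (simp_all add: base_def)
  have loop2: "wp w B ?L2 (wp w B ?end Q) s1 p1 out" if I1: "?Inv2 s1 p1 out" for s1 p1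
  proof (rule wp_upto[where Inv = ?Inv2])
    show "?Inv2 s1 p1 out" by (rule I1)
  next
    fix s2 p2 out2 assume I: "?Inv2 s2 p2 out2" and lt: "s2 rJ < s2 rN"
    then have a: "agree 3 s s2" by blast
    note f = fix3[OF a]
    let ?R = "\<lambda>s' p' out'. ?Inv2 s' p' out' \<and> s' rJ = Suc (s2 rJ) \<and> s' rN = s2 rN"
    show "wp w B (seqs [test_prog rI rJ,
        Cond (Less rZ rE) (Cond (Less rZ rP) (clr rP) (set1 rP)) skip, inc rJ])
      ?R s2 p2 out2"
      unfolding wp_seqs(2)[of _ _ "test_prog rI rJ"]
    proof (rule wp_test_prog[OF f(1)])
      fix s3 p3
      assume 3: "agree 2 s2 s3" "p3 \<le> n + 1"
        "s3 rE = of_bool (sim (walls w ! (s2 rI - 1)) (walls w ! (s2 rJ - 1)))"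
      have a3: "agree 3 s s3" by (rule agree_trans[OF a 3(1)]) auto
      note f3 = fix3[OF a3]
      have eqs: "s3 rJ = s2 rJ" "s3 rP = s2 rP" "s3 rQ = s2 rQ" using agreeD[OF 3(1)] by simp_all
      obtain k where k: "s2 rJ = Suc k" "Suc ?i \<le> k" "k < n"
        using I lt f i by (cases "s2 rJ") auto
      note E = E_Suc[OF k(2)]
      have P: "s2 rP = of_bool (odd (E k))" and Q2: "s2 rQ = of_bool (A ?i)" using I k by simp_all
      have sE: "s3 rE = of_bool (sim (walls w ! ?i) (walls w ! k))" using 3(3) f k by simp
      show "wp w B (seqs [Cond (Less rZ rE) (Cond (Less rZ rP) (clr rP) (set1 rP)) skip, inc rJ])
        ?R s3 p3 out2"
        using I k 3(2) f f3 eqs a3 E P Q2 sE B_ge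
        by (cases "sim (walls w ! ?i) (walls w ! k)"; cases "odd (E k)") simp_all
    qed (use I lt f i in auto)
  next
    fix s2 p2 out2 assume I: "?Inv2 s2 p2 out2" and ge: "\<not> s2 rJ < s2 rN"
    then have a: "agree 3 s s2" by blast
    note f = fix3[OF a]
    have J: "s2 rJ = Suc n" using I ge f by simp
    have P: "s2 rP = of_bool (odd (E n))" and Q2: "s2 rQ = of_bool (A ?i)" using I J by simp_all
    show "wp w B ?end Q s2 p2 out2"
    proof (cases "even (E n)")
      case True
      have "Q s2 p2 out" by (rule Q[OF a]) (use I Q2 kp True in auto)
      then show ?thesis using I P f True by simp
    next
      case False
      have "Q (s2(rQ := 0)) p2 out" by (rule Q) (use a I kp False in auto)
      then show ?thesis using I P f False by simp
    qed
  qed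
  have loop1: "wp w B ?L1 ?K s1 p1 out"
    if I1: "?Inv1 s1 p1 out" for s1 p1
  proof (rule wp_upto[where Inv = ?Inv1])
    show "?Inv1 s1 p1 out" by (rule I1)
  next
    fix s2 p2 out2 assume I: "?Inv1 s2 p2 out2" and lt: "s2 rJ < s2 rI"
    then have a: "agree 3 s s2" by blast
    note f = fix3[OF a]
    let ?R = "\<lambda>s' p' out'. ?Inv1 s' p' out' \<and> s' rJ = Suc (s2 rJ) \<and> s' rI = s2 rI"
    show "wp w B (seqs [test_prog rJ rI, Cond (Less rZ rE) (clr rQ) skip, inc rJ])
      ?R s2 p2 out2"
      unfolding wp_seqs(2)[of _ _ "test_prog rJ rI"]
    proof (rule wp_test_prog[OF f(1)])
      fix s3 p3
      assume 3: "agree 2 s2 s3" "p3 \<le> n + 1"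
        "s3 rE = of_bool (sim (walls w ! (s2 rJ - 1)) (walls w ! (s2 rI - 1)))"
      have a3: "agree 3 s s3" by (rule agree_trans[OF a 3(1)]) auto
      note f3 = fix3[OF a3]
      have eqs: "s3 rJ = s2 rJ" "s3 rP = s2 rP" "s3 rQ = s2 rQ" using agreeD[OF 3(1)] by simp_all
      obtain k where k: "s2 rJ = Suc k" using I by (cases "s2 rJ") auto
      have Q2: "s2 rQ = of_bool (A k)" using I k by simp
      have sE: "s3 rE = of_bool (sim (walls w ! k) (walls w ! ?i))" using 3(3) f k by simp
      show "wp w B (seqs [Cond (Less rZ rE) (clr rQ) skip, inc rJ])
        ?R s3 p3 out2"
        using I lt k 3(2) f f3 eqs a3 A_Suc Q2 sE B_ge i
        by (cases "sim (walls w ! k) (walls w ! ?i)") simp_all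
    qed (use I lt f i in auto)
  next
    fix s2 p2 out2 assume I: "?Inv1 s2 p2 out2" and ge: "\<not> s2 rJ < s2 rI"
    then have a: "agree 3 s s2" by blast
    note f = fix3[OF a]
    have J: "s2 rJ = s rI" using I ge f by simp
    have "wp w B ?L2 (wp w B ?end Q) (s2(rJ := Suc (s rI))) p2 out"
      by (rule loop2) (use I J a i E_start in auto)
    then show "wp w B (inc rJ) (wp w B ?L2 (wp w B ?end Q)) s2 p2 out2"
      using I J f B_ge i by simp
  qed
  have "wp w B ?L1 ?K
      (s(rQ := 1, rP := 0, rJ := 1)) p out"
    by (rule loop1) (use p i A_0 in auto)
  then show ?thesis using z B_ge by (simp add: kept_prog_def)
qed

lemma wp_clr_list:
  assumes "Q (\<lambda>r. if r \<in> set rs then 0 else s r) p out"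
  shows "wp w B (seqs (map (\<lambda>r. clr r) rs)) Q s p out"
  using assms
proof (induction rs arbitrary: s)
  case (Cons r rs)
  have eq: "(\<lambda>a. if a \<in> set rs then 0 else (s(r := 0)) a) = (\<lambda>a. if a \<in> set (r # rs) then 0 else s a)"
    by auto
  have "wp w B (seqs (map (\<lambda>r. clr r) rs)) Q (s(r := 0)) p out"
    by (rule Cons.IH) (use Cons.prems in \<open>simp only: eq\<close>)
  then show ?case by simp
qed simp

definition kept_word :: "nat \<Rightarrow> 'x list" where
  "kept_word k = map ((!) w) (filter (kept_pos w) [0..<k])"

lemma kept_word_simps:
  "kept_word 0 = []"
  "kept_word (Suc k) = kept_word k @ (if kept_pos w k then [w ! k] else [])"
  "kept_word n = red w"
  by (simp_all add: kept_word_def red_eq_kept[OF w])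

abbreviation pending :: "('x reg \<Rightarrow> nat) \<Rightarrow> 'x list \<Rightarrow> 'x list" where
  "pending s \<equiv> drop_cnt (\<lambda>y. s (rC y))"

lemma wp_visit_prog:
  assumes z: "s rZ = 0" and y: "y \<in> X" and x: "x \<in> X"
    and C: "s (rC y) \<le> n + 1"
    and S: "\<forall>y \<in> X. s (rS y) = min (s (rC y)) (count_list u y)"
    and F: "s rF = of_bool (\<exists>z \<in> set (pending s u). (x, z) \<notin> J)"
    and D: "s rD = of_bool (front x (pending s u))"
    and Q: "\<And>s'. (\<forall>r. r \<notin> rS ` X \<longrightarrow> r \<noteq> rF \<longrightarrow> r \<noteq> rD \<longrightarrow> s' r = s r) \<Longrightarrow>
      \<forall>z \<in> X. s' (rS z) = min (s (rC z)) (count_list (u @ [y]) z) \<Longrightarrow>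
      s' rF = of_bool (\<exists>z \<in> set (pending s (u @ [y])). (x, z) \<notin> J) \<Longrightarrow>
      s' rD = of_bool (front x (pending s (u @ [y]))) \<Longrightarrow> Q s' p out"
  shows "wp w B (visit_prog x y) Q s p out"
proof -
  let ?d = "pending s u" and ?d' = "pending s (u @ [y])"
  have less: "s (rS y) < s (rC y) \<longleftrightarrow> count_list u y < s (rC y)" using S y by auto
  show ?thesis
  proof (cases "count_list u y < s (rC y)")
    case True
    have d: "?d' = ?d" using True by (simp add: drop_cnt_snoc)
    have "Q (s(rS y := Suc (s (rS y)))) p out"
    proof (rule Q)
      show "\<forall>z \<in> X. (s(rS y := Suc (s (rS y)))) (rS z) = min (s (rC z)) (count_list (u @ [y]) z)"
        using S y True by auto
    qed (use F D y d in auto)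
    moreover have "s (rS y) + 1 \<le> B" using less True C B_ge by linarith
    ultimately show ?thesis using True less z by (simp add: visit_prog_def)
  next
    case False
    have d: "?d' = ?d @ [y]" using False by (simp add: drop_cnt_snoc)
    have nless: "\<not> s (rS y) < s (rC y)" using False less by simp
    have S': "\<forall>z \<in> X. s (rS z) = min (s (rC z)) (count_list (u @ [y]) z)"
      using S False by auto
    have fr: "front x ?d' \<longleftrightarrow> front x ?d \<or> s rF = 0 \<and> x = y"
      unfolding d front_snoc using F by auto
    have ff: "(\<exists>z \<in> set ?d'. (x, z) \<notin> J) \<longleftrightarrow> s rF \<noteq> 0 \<or> (x, y) \<notin> J"
      unfolding d using F by auto
    consider "(x, y) \<in> J" | "(x, y) \<notin> J" "s rF \<noteq> 0" | "(x, y) \<notin> J" "s rF = 0" "x \<noteq> y"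
      | "s rF = 0" "x = y" by auto
    then show ?thesis
    proof cases
      case 1
      have "x \<noteq> y" using 1 by auto
      have "Q s p out" by (rule Q) (use S' F D fr ff 1 \<open>x \<noteq> y\<close> in auto)
      then show ?thesis using nless 1 by (simp add: visit_prog_def)
    next
      case 2
      have "Q s p out" by (rule Q) (use S' F D fr ff 2 in auto)
      then show ?thesis using nless 2 z by (simp add: visit_prog_def)
    next
      case 3
      have "Q (s(rF := 1)) p out" by (rule Q) (use S' F D fr ff 3 in auto)
      then show ?thesis using nless 3 z B_ge by (simp add: visit_prog_def)
    next
      case 4
      have "Q (s(rF := 1, rD := 1)) p out" by (rule Q) (use S' F D fr ff 4 in auto)
      then show ?thesis using nless 4 z B_ge by (simp add: visit_prog_def)
    qed
  qed
qed

lemma wp_scan_prog: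
  assumes base: "base s" and x: "x \<in> X" and p: "p \<le> n + 1"
    and C: "\<forall>y. s (rC y) \<le> n + 1"
    and Q: "\<And>s' p'. agree 4 s s' \<Longrightarrow> p' \<le> n + 1 \<Longrightarrow>
      s' rD = of_bool (front x (pending s (red w))) \<Longrightarrow> Q s' p' out"
  shows "wp w B (scan_prog x) Q s p out"
proof -
  define d where "d k = pending s (kept_word k)" for k
  let ?Inv = "\<lambda>s' p' out'. agree 4 s s' \<and> out' = out \<and> p' \<le> n + 1 \<and> 1 \<le> s' rI \<and> s' rI \<le> Suc n \<and>
    (\<forall>y \<in> X. s' (rS y) = min (s (rC y)) (count_list (kept_word (s' rI - 1)) y)) \<and>
    s' rF = of_bool (\<exists>z \<in> set (d (s' rI - 1)). (x, z) \<notin> J) \<and>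
    s' rD = of_bool (front x (d (s' rI - 1)))"
  let ?visit = "Seq (goto rI) (on_letter (visit_prog x))"
  let ?L = "Loop (Less rI rN) (seqs [kept_prog, Cond (Less rZ rQ) ?visit skip, inc rI])"
  have fix4: "base s'" "s' rZ = 0" "s' rN = Suc n" "s' (rC y) = s (rC y)" if "agree 4 s s'" for s' y
    using base_agree[OF that _ base] agreeD[OF that, of "rC y"] by (simp_all add: base_def)
  have loop: "wp w B ?L Q s1 p1 out" if I1: "?Inv s1 p1 out" for s1 p1
  proof (rule wp_upto[where Inv = ?Inv])
    show "?Inv s1 p1 out" by (rule I1)
  next
    fix s2 p2 out2 assume I: "?Inv s2 p2 out2" and lt: "s2 rI < s2 rN"
    then have a: "agree 4 s s2" by blast
    note f = fix4[OF a]
    obtain k where k: "s2 rI = Suc k" "k < n" using I lt f by (cases "s2 rI") auto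
    let ?R = "\<lambda>s' p' out'. ?Inv s' p' out' \<and> s' rI = Suc (s2 rI) \<and> s' rN = s2 rN"
    have inv2: "\<forall>y \<in> X. s2 (rS y) = min (s (rC y)) (count_list (kept_word k) y)"
      "s2 rF = of_bool (\<exists>z \<in> set (d k). (x, z) \<notin> J)" "s2 rD = of_bool (front x (d k))" "out2 = out"
      using I k by simp_all
    show "wp w B (seqs [kept_prog, Cond (Less rZ rQ) ?visit skip, inc rI]) ?R s2 p2 out2"
      unfolding wp_seqs(2)[of _ _ kept_prog]
    proof (rule wp_kept_prog[OF f(1)])
      fix s3 p3 assume 3: "agree 3 s2 s3" "p3 \<le> n + 1" "s3 rQ = of_bool (kept_pos w (s2 rI - 1))"
      have a3: "agree 4 s s3" by (rule agree_trans[OF a 3(1)]) auto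
      note f3 = fix4[OF a3]
      have eqs: "s3 rI = Suc k" "\<And>y. s3 (rS y) = s2 (rS y)" "s3 rF = s2 rF" "s3 rD = s2 rD"
        using agreeD[OF 3(1)] k by simp_all
      have fin: "wp w B (inc rI) ?R s4 p4 out" if "agree 4 s s4" "s4 rI = Suc k" "p4 \<le> n + 1"
        "\<forall>y \<in> X. s4 (rS y) = min (s (rC y)) (count_list (kept_word (Suc k)) y)"
        "s4 rF = of_bool (\<exists>z \<in> set (d (Suc k)). (x, z) \<notin> J)"
        "s4 rD = of_bool (front x (d (Suc k)))" for s4 p4
        using that fix4(2,3)[OF that(1)] k f(3) B_ge by simp
      show "wp w B (seqs [Cond (Less rZ rQ) ?visit skip, inc rI]) ?R s3 p3 out2"
      proof (cases "kept_pos w k")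
        case False
        then have "kept_word (Suc k) = kept_word k" by (simp add: kept_word_simps)
        then have "wp w B (inc rI) ?R s3 p3 out"
          using a3 eqs 3(2) inv2 by (intro fin) (simp_all add: d_def)
        then show ?thesis using False 3(3) k f3 inv2 by simp
      next
        case True
        then have K: "kept_word (Suc k) = kept_word k @ [w ! k]" by (simp add: kept_word_simps)
        let ?s = "s3(rG := s3 rI)"
        have "wp w B (visit_prog x (w ! k)) (wp w B (inc rI) ?R) ?s (Suc k) out"
        proof (rule wp_visit_prog)
          show "w ! k \<in> X" using nth_X k by simp
          show "?s (rC (w ! k)) \<le> n + 1" using C f3(4) by simp
          show "\<forall>y \<in> X. ?s (rS y) = min (?s (rC y)) (count_list (kept_word k) y)"
            using eqs inv2 f3(4) by simp
          show "?s rF = of_bool (\<exists>z \<in> set (pending ?s (kept_word k)). (x, z) \<notin> J)"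
            "?s rD = of_bool (front x (pending ?s (kept_word k)))"
            using eqs inv2 f3(4) by (simp_all add: d_def)
        next
          fix s4 assume 4: "\<forall>r. r \<notin> rS ` X \<longrightarrow> r \<noteq> rF \<longrightarrow> r \<noteq> rD \<longrightarrow> s4 r = ?s r"
            "\<forall>z \<in> X. s4 (rS z) = min (?s (rC z)) (count_list (kept_word k @ [w ! k]) z)"
            "s4 rF = of_bool (\<exists>z \<in> set (pending ?s (kept_word k @ [w ! k])). (x, z) \<notin> J)"
            "s4 rD = of_bool (front x (pending ?s (kept_word k @ [w ! k])))"
          have "agree 4 ?s s4"
            unfolding agree_def
          proof (intro allI impI)
            fix r :: "'x reg" assume "4 \<le> level r"
            then have "r \<notin> rS ` X" "r \<noteq> rF" "r \<noteq> rD" by auto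
            then show "s4 r = ?s r" using 4(1) by blast
          qed
          then have a4: "agree 4 s s4" by (rule agree_trans[of 4 _ ?s, rotated]) (use a3 in auto)
          show "wp w B (inc rI) ?R s4 (Suc k) out"
            by (rule fin) (use 4 a4 eqs f3(4) k in \<open>auto simp: K d_def\<close>)
        qed (use f3 x in auto)
        then have "wp w B (goto rI) (wp w B (on_letter (visit_prog x)) (wp w B (inc rI) ?R)) s3 p3 out"
          using k eqs f3 3(2) B_ge by (intro wp_goto) (simp_all add: wp_on_letter del: wp_Add)
        then show ?thesis using True 3(3) k f3 inv2 by (simp del: wp_Add)
      qed
    qed (use I k in auto)
  next
    fix s2 p2 out2 assume I: "?Inv s2 p2 out2" and ge: "\<not> s2 rI < s2 rN"
    then have a: "agree 4 s s2" by blast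
    have "s2 rI = Suc n" using I ge fix4[OF a] by simp
    then have "s2 rD = of_bool (front x (d n))" using I by simp
    then show "Q s2 p2 out2" using Q[OF a] I by (simp add: d_def kept_word_simps)
  qed
  let ?rs = "map rS xs"
  let ?s = "\<lambda>r. if r \<in> set ?rs then 0 else (s(rF := 0, rD := 0)) r"
  have "wp w B ?L Q (?s(rI := 1)) p out"
  proof (rule loop)
    have "agree 4 s (?s(rI := 1))" by (auto simp: agree_def)
    then show "?Inv (?s(rI := 1)) p out"
      using p set_xs by (auto simp: kept_word_simps d_def)
  qed
  moreover have "?s rZ = 0" using base by (auto simp: base_def)
  ultimately have "wp w B (set1 rI) (wp w B ?L Q) ?s p out"
    using B_ge by simp
  then have "wp w B (seqs (map (\<lambda>r. clr r) ?rs)) (wp w B (set1 rI) (wp w B ?L Q)) (s(rF := 0, rD := 0)) p out"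
    by (rule wp_clr_list)
  then show ?thesis by (simp add: scan_prog_def o_def del: wp_Add)
qed

lemma wp_emit_prog:
  fixes s :: "'x reg \<Rightarrow> nat"
  defines "u \<equiv> pending s (red w)"
  assumes base: "base s" and ys: "set ys \<subseteq> X" and p: "p \<le> n + 1"
    and C: "\<forall>y. s (rC y) \<le> n + 1"
    and None: "\<And>s' p'. find (\<lambda>x. front x u) ys = None \<Longrightarrow> agree 4 s s' \<Longrightarrow> p' \<le> n + 1 \<Longrightarrow> Q s' p' out"
    and Some: "\<And>x s' p'. find (\<lambda>x. front x u) ys = Some x \<Longrightarrow>
      agree 4 (s(rC x := Suc (s (rC x)))) s' \<Longrightarrow> p' \<le> n + 1 \<Longrightarrow> Q s' p' (out @ [x])"
  shows "wp w B (emit_prog ys) Q s p out"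
  using ys base p C None Some unfolding u_def
proof (induction ys arbitrary: s p)
  case Nil
  then show ?case by (simp add: emit_prog_def)
next
  case (Cons x ys)
  let ?u = "\<lambda>s. pending s (red w)"
  have "wp w B (scan_prog x) (wp w B (Cond (Less rZ rD) (Seq (Act Stay (Some x)) (inc (rC x)))
      (emit_prog ys)) Q) s p out"
  proof (rule wp_scan_prog[OF Cons.prems(2)])
    fix s1 p1 assume 1: "agree 4 s s1" "p1 \<le> n + 1" "s1 rD = of_bool (front x (?u s))"
    have b1: "base s1" by (rule base_agree[OF 1(1) _ Cons.prems(2)]) simp
    have z: "s1 rZ = 0" using b1 by (simp add: base_def)
    have C1: "s1 (rC y) = s (rC y)" for y using agreeD[OF 1(1), of "rC y"] by simp
    have u1: "?u s1 = ?u s" using C1 by simp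
    show "wp w B (Cond (Less rZ rD) (Seq (Act Stay (Some x)) (inc (rC x))) (emit_prog ys)) Q s1 p1 out"
    proof (cases "front x (?u s)")
      case True
      have "agree 4 (s(rC x := Suc (s (rC x)))) (s1(rC x := Suc (s (rC x))))"
        using 1(1) by (simp add: agree_def)
      then have "Q (s1(rC x := Suc (s (rC x)))) p1 (out @ [x])"
        by (intro Cons.prems(6)) (use True 1(2) in \<open>simp_all del: fun_upd_apply\<close>)
      moreover have "Suc (s (rC x)) \<le> B" using spec[OF Cons.prems(4), of x] B_ge by linarith
      ultimately show ?thesis using True 1(2,3) z C1 by simp
    next
      case False
      have "wp w B (emit_prog ys) Q s1 p1 out"
      proof (rule Cons.IH)
        show "set ys \<subseteq> X" using Cons.prems(1) by simp
        show "\<forall>y. s1 (rC y) \<le> n + 1" using Cons.prems(4) C1 by simp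
        show "Q s' p' out" if "find (\<lambda>x. front x (?u s1)) ys = None" "agree 4 s1 s'" "p' \<le> n + 1" for s' p'
          by (rule Cons.prems(5)) (use that False u1 1(1) in \<open>auto simp: agree_def\<close>)
        show "Q s' p' (out @ [y])" if "find (\<lambda>x. front x (?u s1)) ys = Some y"
          "agree 4 (s1(rC y := Suc (s1 (rC y)))) s'" "p' \<le> n + 1" for s' p' y
        proof (rule Cons.prems(6))
          show "find (\<lambda>x. front x (?u s)) (x # ys) = Some y" using that(1) False u1 by simp
          show "agree 4 (s(rC y := Suc (s (rC y)))) s'"
            using that(2) 1(1) by (simp add: agree_def C1)
        qed (rule that(3))
      qed (rule b1, rule 1(2))
      then show ?thesis using False 1(3) z by simp
    qed
  qed (use Cons.prems in auto)
  then show ?case by (simp add: emit_prog_def)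
qed

lemma wp_length:
  assumes "s rZ = 0" "s rN = p" "p \<le> n + 1" "Q (s(rN := n + 1)) (n + 1) out"
  shows "wp w B (Loop (Cell (\<lambda>x. x \<noteq> RightEnd)) (seqs [Act GoRight None, inc rN])) Q s p out"
  using assms
proof (induction "n + 1 - p" arbitrary: s p)
  case 0
  then have p: "p = n + 1" by simp
  then have "s(rN := n + 1) = s" using 0 by auto
  then show ?case using 0 p by (subst wp_Loop) (simp add: input_at_def)
next
  case (Suc k)
  then have p: "p < n + 1" by simp
  have "input_at w p \<noteq> RightEnd" using p by (auto simp: input_at_def)
  moreover have "wp w B (Loop (Cell (\<lambda>x. x \<noteq> RightEnd)) (seqs [Act GoRight None, inc rN])) Q
      (s(rN := Suc p)) (Suc p) out"
    by (rule Suc.hyps(1)) (use Suc p in auto)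
  ultimately show ?case
    using Suc p B_ge by (subst wp_Loop) simp
qed

lemma wp_add_N:
  assumes "s rB + k * s rN \<le> B" "Q (s(rB := s rB + k * s rN)) p out"
  shows "wp w B (seqs (replicate k (Add rB rB rN False))) Q s p out"
  using assms
proof (induction k arbitrary: s)
  case (Suc k)
  have "wp w B (seqs (replicate k (Add rB rB rN False))) Q (s(rB := s rB + s rN)) p out"
    by (rule Suc.IH)
      (use Suc.prems in \<open>simp_all add: add.assoc fun_upd_same fun_upd_other del: fun_upd_apply\<close>)
  then show ?case using Suc.prems(1) by simp
qed simp

lemma wp_nf_prog: "wp w B nf_prog (\<lambda>s p out. out = lexnf xs (Suc n) (red w)) (\<lambda>_. 0) 0 []"
proof -
  let ?Q = "\<lambda>s p out. out = lexnf xs (Suc n) (red w)"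
  let ?L = "Loop (Less rR rN) (seqs [emit_prog xs, inc rR])"
  let ?u = "\<lambda>s. pending s (red w)"
  \<comment> \<open>The output followed by the greedy word of the pending letters stays constant.
    The bound \<open>s (rC y) \<le> s rR\<close> keeps the counters within the register
    bound.\<close>
  let ?Inv = "\<lambda>s p out. base s \<and> p \<le> n + 1 \<and> s rR \<le> Suc n \<and> (\<forall>y. s (rC y) \<le> s rR) \<and>
    out @ lexnf xs (Suc n - s rR) (?u s) = lexnf xs (Suc n) (red w)"
  have "wp w B ?L ?Q s1 p1 []" if I1: "?Inv s1 p1 []" for s1 p1
  proof (rule wp_upto[where Inv = ?Inv])
    show "?Inv s1 p1 []" by (rule I1)
  next
    fix s2 p2 out2 assume I: "?Inv s2 p2 out2" and lt: "s2 rR < s2 rN"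
    have b: "base s2" and R: "s2 rR < Suc n" using I lt by (auto simp: base_def)
    then obtain k where k: "Suc n - s2 rR = Suc k" by (metis Suc_diff_Suc)
    then have k': "Suc n - Suc (s2 rR) = k" by simp
    have C2: "\<forall>y. s2 (rC y) \<le> s2 rR" using I by blast
    have out2: "out2 @ lexnf xs (Suc k) (?u s2) = lexnf xs (Suc n) (red w)" using I k by simp
    let ?R = "\<lambda>s' p' out'. ?Inv s' p' out' \<and> s' rR = Suc (s2 rR) \<and> s' rN = s2 rN"
    have fin: "wp w B (inc rR) ?R s3 p3 out3"
      if "base s3" "s3 rR = s2 rR" "p3 \<le> n + 1" "\<forall>y. s3 (rC y) \<le> Suc (s2 rR)"
        "out3 @ lexnf xs k (?u s3) = lexnf xs (Suc n) (red w)" for s3 p3 out3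
      using that k' R B_ge b by (simp add: base_def)
    show "wp w B (seqs [emit_prog xs, inc rR]) ?R s2 p2 out2"
      unfolding wp_seqs
    proof (rule wp_emit_prog[OF b])
      fix s3 p3 assume 3: "find (\<lambda>x. front x (?u s2)) xs = None" "agree 4 s2 s3" "p3 \<le> n + 1"
      have C3: "s3 (rC y) = s2 (rC y)" for y using agreeD[OF 3(2), of "rC y"] by simp
      \<comment> \<open>Without an accessible letter the remaining greedy word is empty for every
        amount of fuel, so an idle round keeps the invariant.\<close>
      have "lexnf xs k (?u s2) = []" using 3(1) by (cases k) simp_all
      then show "wp w B (inc rR) ?R s3 p3 out2"
        using base_agree[OF 3(2) _ b] agreeD[OF 3(2), of rR] 3 C2 C3 out2
        by (intro fin) (auto simp: le_Suc_eq)
    next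
      fix x s3 p3 assume 3: "find (\<lambda>x. front x (?u s2)) xs = Some x"
        "agree 4 (s2(rC x := Suc (s2 (rC x)))) s3" "p3 \<le> n + 1"
      have C3: "s3 (rC y) = ((\<lambda>y. s2 (rC y))(x := Suc (s2 (rC x)))) y" for y
        using agreeD[OF 3(2), of "rC y"] by simp
      have "base (s2(rC x := Suc (s2 (rC x))))" using b by (simp add: base_def)
      from base_agree[OF 3(2) _ this] have b3: "base s3" by simp
      have f: "front x (?u s2)" using 3(1) by (auto simp: find_Some_iff)
      have "?u s3 = remove1 x (?u s2)"
        unfolding C3 by (rule drop_cnt_Suc[OF front_in_set[OF f]])
      then have "(out2 @ [x]) @ lexnf xs k (?u s3) = lexnf xs (Suc n) (red w)"
        using out2 3(1) by simp
      moreover have "\<forall>y. s3 (rC y) \<le> Suc (s2 rR)" using C2 C3 by (simp add: le_SucI)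
      ultimately show "wp w B (inc rR) ?R s3 p3 (out2 @ [x])"
        using b3 agreeD[OF 3(2), of rR] 3(3) by (intro fin) simp_all
    next
      have "s2 (rC y) \<le> n + 1" for y using spec[OF C2, of y] R by linarith
      then show "\<forall>y. s2 (rC y) \<le> n + 1" by blast
    qed (use I set_xs in auto)
  next
    fix s2 p2 out2 assume "?Inv s2 p2 out2" "\<not> s2 rR < s2 rN"
    then show "out2 = lexnf xs (Suc n) (red w)" by (auto simp: base_def)
  qed
  then have loop: "wp w B ?L ?Q ((\<lambda>_. 0)(rN := n + 1, rB := bd)) (n + 1) []"
    by (simp add: base_def)
  let ?k = "8 * card X + 16"
  have bd: "bd = ?k * (n + 1)" by (simp add: modulus_bound_def)
  have "wp w B (seqs (replicate ?k (Add rB rB rN False))) (wp w B ?L ?Q) ((\<lambda>_. 0)(rN := n + 1)) (n + 1) []"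
    by (rule wp_add_N) (use loop bd B_ge in simp_all)
  then have "wp w B (Loop (Cell (\<lambda>x. x \<noteq> RightEnd)) (seqs [Act GoRight None, inc rN]))
      (wp w B (seqs (replicate ?k (Add rB rB rN False))) (wp w B ?L ?Q)) (\<lambda>_. 0) 0 []"
    by (intro wp_length) simp_all
  then show ?thesis by (simp only: nf_prog_def wp_seqs_append wp_seqs)
qed

end

section \<open>Finitely many registers, and the resulting transducer\<close>

context nf_program
begin

lemma com_ok_goto [simp]: "com_ok A Y Rs (goto r) \<longleftrightarrow> {rG, rZ, r} \<subseteq> Rs"
  by (auto simp: goto_def)

lemma com_ok_modadd [simp]: "com_ok A Y Rs (modadd r) \<longleftrightarrow> {rT, rM, r} \<subseteq> Rs"
  by (auto simp: modadd_def)

lemma com_ok_on_letter: "(\<And>x. x \<in> A \<Longrightarrow> com_ok A Y Rs (f x)) \<Longrightarrow> com_ok A Y Rs (on_letter f)"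
  by (auto simp: on_letter_def cells_def)

lemma registers_simps [simp]:
  "{rT, rM, rK, rG, rE, rJ, rP, rQ, rI, rF, rD, rR, rZ, rN, rB} \<subseteq> registers"
  "rV x \<in> registers \<longleftrightarrow> x \<in> X" "rS x \<in> registers \<longleftrightarrow> x \<in> X" "rC x \<in> registers \<longleftrightarrow> x \<in> X"
  by (auto simp: registers_def)

lemma com_ok_reflect_prog: "b \<in> X \<Longrightarrow> com_ok X X registers (reflect_prog b)"
  using registers_simps(1) by (auto simp: set_xs reflect_prog_def)

lemma com_ok_act_prog: "x \<in> X \<Longrightarrow> com_ok X X registers (act_prog x)"
  by (simp add: act_prog_def com_ok_reflect_prog)

lemma com_ok_test_prog:
  assumes "lo \<in> registers" "hi \<in> registers"
  shows "com_ok X X registers (test_prog lo hi)"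
proof -
  have 1: "com_ok X X registers (init_prog x)" for x
    using registers_simps(1) by (auto simp: set_xs init_prog_def)
  have 2: "com_ok X X registers (cmp_prog x)" if "x \<in> X" for x
    using registers_simps(1) that by (auto simp: set_xs cmp_prog_def)
  show ?thesis
    using assms registers_simps(1)
    by (auto simp: test_prog_def test_body_def intro!: com_ok_on_letter 1 2 com_ok_act_prog)
qed

lemma com_ok_scan_prog: "x \<in> X \<Longrightarrow> com_ok X X registers (scan_prog x)"
proof -
  assume x: "x \<in> X"
  have 1: "com_ok X X registers kept_prog"
    using registers_simps(1) by (auto simp: kept_prog_def intro!: com_ok_test_prog)
  have 2: "com_ok X X registers (visit_prog x y)" if "y \<in> X" for y
    using x that registers_simps(1) by (auto simp: visit_prog_def)
  show ?thesis
    using registers_simps(1) by (auto simp: set_xs scan_prog_def intro!: com_ok_on_letter 1 2)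
qed

lemma com_ok_emit_prog: "set ys \<subseteq> X \<Longrightarrow> com_ok X X registers (emit_prog ys)"
  using registers_simps(1) by (induction ys) (auto simp: emit_prog_def com_ok_scan_prog)

lemma com_ok_nf_prog: "com_ok X X registers nf_prog"
  using registers_simps(1) by (auto simp: set_xs nf_prog_def com_ok_emit_prog)

theorem logspace_lexnf:
  "\<exists>M :: ('x, 'x) transducer. logspace_transducer X X M \<and>
    computes M X (\<lambda>w. lexnf xs (Suc (length w)) (red w))"
proof (rule logspace_program[OF finite_X finite_X finite_registers com_ok_nf_prog])
  \<comment> \<open>Chosen to dominate \<open>2 * modulus_bound (length w) + 4\<close>: sums before
    a modular reduction can approach twice the modulus.\<close>
  let ?k = "2 * (8 * card X + 16) + 4"
  fix w assume "w \<in> lists X"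
  then have "set w \<subseteq> X" by auto
  then interpret nf_run X iv J xs w "?k * Suc (length w)"
    by unfold_locales (simp_all add: modulus_bound_def)
  show "\<exists>s p. exec w (?k * Suc (length w)) nf_prog (\<lambda>_. 0) 0 [] s p (lexnf xs (Suc (length w)) (red w))"
    using wp_nf_prog unfolding wp_def by blast
qed simp

end

section \<open>Shortlex normal forms\<close>

lemma ex_sorted_list:
  assumes X: "finite X" and ord: "linear_order_on X ord"
  obtains xs where "set xs = X" "distinct xs" "sorted_wrt (\<lambda>a b. (a, b) \<in> ord - Id) xs"
proof -
  have o: "refl_on X ord" "trans ord" "antisym ord" "total_on X ord"
    using ord by (auto simp: linear_order_on_def partial_order_on_def preorder_on_def)
  \<comment> \<open>The rank in \<open>ord\<close> serves as a numerical sort key.\<close>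
  define f where "f x = card {y \<in> X. (y, x) \<in> ord}" for x
  obtain ys where ys: "set ys = X" "distinct ys" using finite_distinct_list[OF X] by blast
  define xs where "xs = sort_key f ys"
  have xs: "set xs = X" "distinct xs" "sorted (map f xs)" using ys by (auto simp: xs_def)
  have "(xs ! i, xs ! j) \<in> ord - Id" if ij: "i < j" "j < length xs" for i j
  proof -
    let ?a = "xs ! i" and ?b = "xs ! j"
    have ab: "?a \<in> X" "?b \<in> X" "?a \<noteq> ?b"
      using ij xs nth_eq_iff_index_eq[OF xs(2), of i j] by auto
    have "(?b, ?a) \<notin> ord"
    proof
      assume ba: "(?b, ?a) \<in> ord"
      have "{y \<in> X. (y, ?b) \<in> ord} \<subset> {y \<in> X. (y, ?a) \<in> ord}"
      proof
        show "{y \<in> X. (y, ?b) \<in> ord} \<subseteq> {y \<in> X. (y, ?a) \<in> ord}"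
          using ba o(2) by (auto dest: transD)
        have "?a \<in> {y \<in> X. (y, ?a) \<in> ord}" using ab o(1) by (auto dest: refl_onD)
        moreover have "?a \<notin> {y \<in> X. (y, ?b) \<in> ord}" using ab ba o(3) by (auto dest: antisymD)
        ultimately show "{y \<in> X. (y, ?b) \<in> ord} \<noteq> {y \<in> X. (y, ?a) \<in> ord}" by blast
      qed
      then have "f ?b < f ?a" unfolding f_def using X by (intro psubset_card_mono) auto
      moreover have "f ?a \<le> f ?b" using sorted_nth_mono[OF xs(3), of i j] ij by simp
      ultimately show False by simp
    qed
    then show ?thesis using o(4) ab by (auto simp: total_on_def)
  qed
  then have "sorted_wrt (\<lambda>a b. (a, b) \<in> ord - Id) xs" by (simp add: sorted_wrt_iff_nth_less)
  then show thesis using that xs by blast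
qed

text \<open>What each group has to provide: cancellation and commutation hold in it, and conversely
  equal values imply equivalent reductions. The converse is the substantial part; it is proved for
  each group by induction over its defining congruence.\<close>

locale alphabet_group = inv_alphabet X iv J for X :: "'x set" and iv J +
  fixes G :: "('g, 'b) monoid_scheme" and \<phi> :: "'x \<Rightarrow> 'g"
  assumes value_cancel: "x \<in> X \<Longrightarrow> u \<in> lists X \<Longrightarrow>
      word_value G \<phi> (x # iv x # u) = word_value G \<phi> u"
    and value_swap: "(x, y) \<in> J \<Longrightarrow> u \<in> lists X \<Longrightarrow>
      word_value G \<phi> (x # y # u) = word_value G \<phi> (y # x # u)"
    and value_eq_imp_teq: "u \<in> lists X \<Longrightarrow> v \<in> lists X \<Longrightarrow>
      word_value G \<phi> u = word_value G \<phi> v \<Longrightarrow> teq (red u) (red v)"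
begin

abbreviation val :: "'x list \<Rightarrow> 'g" where
  "val \<equiv> word_value G \<phi>"

lemma word_value_Cons: "val (x # u) = \<phi> x \<otimes>\<^bsub>G\<^esub> val u"
  by (simp add: word_value_def)

lemma remove1_lists: "u \<in> lists X \<Longrightarrow> remove1 x u \<in> lists X"
  using set_remove1_subset[of x u] by (auto simp: lists_eq_set)

lemma value_front:
  "front x u \<Longrightarrow> u \<in> lists X \<Longrightarrow> val (x # remove1 x u) = val u"
proof (induction u)
  case (Cons z u)
  show ?case
  proof (cases "z = x")
    case False
    with Cons.prems have J: "(x, z) \<in> J" and f: "front x u" and u: "u \<in> lists X" by auto
    have "val (x # z # remove1 x u) = val (z # x # remove1 x u)"
      by (rule value_swap[OF J remove1_lists[OF u]])
    also have "\<dots> = val (z # u)"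
      using Cons.IH[OF f u] by (simp add: word_value_Cons)
    finally show ?thesis using False by simp
  qed simp
qed simp

lemma value_teq:
  "teq u v \<Longrightarrow> u \<in> lists X \<Longrightarrow> v \<in> lists X \<Longrightarrow> val u = val v"
proof (induction u arbitrary: v)
  case Nil
  then have "v = []" using teq_imp_length by fastforce
  then show ?case by simp
next
  case (Cons x u)
  have f: "front x v" using teq_front[OF Cons.prems(1), of x] by simp
  have "teq u (remove1 x v)" using teq_remove1[OF Cons.prems(1), of x] by simp
  then have "val u = val (remove1 x v)"
    using Cons.prems remove1_lists by (intro Cons.IH) auto
  then show ?case using value_front[OF f] Cons.prems by (simp add: word_value_Cons)
qed

lemma red_lists: "u \<in> lists X \<Longrightarrow> red u \<in> lists X"
  using set_red[of u] by (auto simp: lists_eq_set)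

lemma value_ins:
  assumes "x \<in> X" "u \<in> lists X"
  shows "val (ins x u) = val (x # u)"
proof (cases "front (iv x) u")
  case True
  have "val (x # u) = val (x # iv x # remove1 (iv x) u)"
    using value_front[OF True assms(2)] by (simp add: word_value_Cons)
  also have "\<dots> = val (remove1 (iv x) u)"
    using assms by (intro value_cancel remove1_lists)
  finally show ?thesis using True by (simp add: ins_def)
qed (simp add: ins_def)

lemma value_red: "u \<in> lists X \<Longrightarrow> val (red u) = val u"
proof (induction u)
  case (Cons x u)
  then show ?case using value_ins[of x "red u"] red_lists[of u] by (simp add: word_value_Cons)
qed simp

text \<open>A geodesic is reduced, since \<open>red\<close> shortens any other word without changing
  its value, and being reduced it is \<open>teq\<close> to \<open>red w\<close>. So all geodesics
  are linearizations of the same trace, among which \<open>lexnf\<close> picks the first.\<close>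

lemma shortlex_nf_eq_lexnf:
  assumes ord: "linear_order_on X ord"
    and xs: "set xs = X" "sorted_wrt (\<lambda>a b. (a, b) \<in> ord - Id) xs" and w: "w \<in> lists X"
  shows "shortlex_nf G X \<phi> ord (val w) = lexnf xs (Suc (length w)) (red w)"
proof -
  let ?g = "val w" and ?u = "lexnf xs (Suc (length w)) (red w)"
  have redX: "red w \<in> lists X" by (rule red_lists[OF w])
  have sub: "set (red w) \<subseteq> set xs" using redX xs(1) by auto
  have len: "length (red w) \<le> Suc (length w)" using length_red_le[of w] by simp
  have u: "teq ?u (red w)" by (rule teq_lexnf[OF sub len])
  have uX: "?u \<in> lists X" using teq_imp_set[OF u] redX by (auto simp: lists_eq_set)
  have ug: "val ?u = ?g" using value_teq[OF u uX redX] value_red[OF w] by simp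
  have red_v: "teq (red v) (red w)" if "v \<in> lists X" "val v = ?g" for v
    by (rule value_eq_imp_teq[OF that(1) w that(2)])
  have geo: "?u \<in> geodesics G X \<phi> ?g"
    unfolding geodesics_def
  proof (intro CollectI conjI ballI impI uX ug)
    fix v assume "v \<in> lists X" "val v = ?g"
    from teq_imp_length[OF red_v[OF this]] show "length ?u \<le> length v"
      using teq_imp_length[OF u] length_red_le[of v] by simp
  qed
  have "(?u, v) \<in> lexord (ord - Id)" if v: "v \<in> geodesics G X \<phi> ?g" "v \<noteq> ?u" for v
  proof -
    have vX: "v \<in> lists X" "val v = ?g" using v(1) by (auto simp: geodesics_def)
    have "length v \<le> length (red v)"
      using v(1) red_lists[OF vX(1)] value_red[OF vX(1)] vX(2) by (simp add: geodesics_def)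
    then have "reduced v" using length_red_less[of v] by auto
    then have "teq v (red w)" using red_v[OF vX] by (simp add: red_reduced)
    then show ?thesis by (rule lexnf_least[OF xs(2) sub len]) (rule v(2))
  qed
  then have nf: "is_shortlex_nf G X \<phi> ord ?g ?u" using geo by (simp add: is_shortlex_nf_def)
  show ?thesis
    unfolding shortlex_nf_def
    by (rule the1_equality[OF ex1_shortlex_nf[OF finite_X ord w HOL.refl] nf])
qed

theorem logspace_shortlex_nf:
  assumes ord: "linear_order_on X ord"
  shows "\<exists>M :: ('x, 'x) transducer. logspace_transducer X X M \<and>
    computes M X (\<lambda>w. shortlex_nf G X \<phi> ord (word_value G \<phi> w))"
proof -
  obtain xs where xs: "set xs = X" "distinct xs" "sorted_wrt (\<lambda>a b. (a, b) \<in> ord - Id) xs"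
    by (rule ex_sorted_list[OF finite_X ord])
  interpret nf_program X iv J xs by unfold_locales (use xs in auto)
  obtain M :: "('x, 'x) transducer" where M: "logspace_transducer X X M"
    "computes M X (\<lambda>w. lexnf xs (Suc (length w)) (red w))"
    using logspace_lexnf by blast
  have "computes M X (\<lambda>w. shortlex_nf G X \<phi> ord (word_value G \<phi> w))"
    using M(2) by (simp add: computes_def shortlex_nf_eq_lexnf[OF ord xs(1,3)])
  then show ?thesis using M(1) by blast
qed

end

section \<open>Graph groups and right-angled Coxeter groups as instances\<close>

lemma word_value_presented_group:
  "w \<in> lists (letters S) \<Longrightarrow>
    word_value (presented_group S R) (\<lambda>x. word_class S R [x]) w = word_class S R w"
proof (induction w)
  case (Cons x w)
  then have "word_class S R [x] \<otimes>\<^bsub>presented_group S R\<^esub> word_class S R w = word_class S R ([x] @ w)"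
    by (intro mult_word_class) auto
  then show ?case using Cons by (simp add: word_value_def)
qed (simp add: word_value_def one_presented_group)

fun generator :: "'a letter \<Rightarrow> 'a" where
  "generator (Inl a) = a"
| "generator (Inr a) = a"

abbreviation letter_indep :: "('a \<times> 'a) set \<Rightarrow> ('a letter \<times> 'a letter) set" where
  "letter_indep I \<equiv> {(x, y). (generator x, generator y) \<in> I}"

lemma generator_bar [simp]: "generator (bar x) = generator x"
  by (cases x) auto

lemma generator_letters [simp]: "generator x \<in> S \<longleftrightarrow> x \<in> letters S"
  by (cases x) (auto simp: letters_def)

text \<open>The presentation states commutation for positive letters only. It passes to inverses by
  \<open>bar x y = bar x y x bar x = bar x x y bar x = y bar x\<close>.\<close>

lemma commute_bar:
  assumes xy: "([x, y], [y, x]) \<in> pres_cong S R"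
  shows "([bar x, y], [y, bar x]) \<in> pres_cong S R"
proof -
  have l: "x \<in> letters S" "y \<in> letters S" using pres_cong_lists[OF xy] by auto
  have "([bar x, y] @ [x, bar x] @ [], [bar x, y] @ []) \<in> pres_cong S R"
    using l by (intro pres_cong.cancel) auto
  moreover have "([bar x] @ [y, x] @ [bar x], [bar x] @ [x, y] @ [bar x]) \<in> pres_cong S R"
    using l by (intro pres_cong_context pres_cong.sym[OF xy]) auto
  moreover have "([] @ [bar x, bar (bar x)] @ [y, bar x], [] @ [y, bar x]) \<in> pres_cong S R"
    using l by (intro pres_cong.cancel) auto
  ultimately show ?thesis by (auto intro: pres_cong.sym pres_cong.trans)
qed

lemma commute_letters:
  assumes I: "I \<subseteq> S \<times> S" and R: "commutations I \<subseteq> R"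
    and xy: "(generator x, generator y) \<in> I"
  shows "([x, y], [y, x]) \<in> pres_cong S R"
proof -
  have *: "([Inl a, Inl b], [Inl b, Inl a]) \<in> pres_cong S R" if "(a, b) \<in> I" for a b
    using pres_cong.relation[of "[]" S "[]" "[Inl a, Inl b]" "[Inl b, Inl a]" R] that I R
    by (auto simp: commutations_def letters_def)
  have **: "([x, Inl b], [Inl b, x]) \<in> pres_cong S R" if "(generator x, b) \<in> I" for x b
    using *[of _ b] commute_bar[OF *[of _ b]] that by (cases x) auto
  show ?thesis
  proof (cases y)
    case (Inl b)
    then show ?thesis using **[of x b] xy by simp
  next
    case (Inr b)
    then have "([Inl b, x], [x, Inl b]) \<in> pres_cong S R"
      using **[of x b] xy by (auto intro: pres_cong.sym)
    from commute_bar[OF this] show ?thesis using Inr by (auto intro: pres_cong.sym)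
  qed
qed

lemma inv_alphabet_letters:
  assumes "independence_alphabet S I"
  shows "inv_alphabet (letters S) bar (letter_indep I)"
proof
  have I: "finite S" "I \<subseteq> S \<times> S" "irrefl I" "sym I"
    using assms by (auto simp: independence_alphabet_def)
  show "finite (letters S)" using I(1) by (simp add: letters_def)
  show "letter_indep I \<subseteq> letters S \<times> letters S"
  proof clarify
    fix x y assume "(generator x, generator y) \<in> I"
    then have "generator x \<in> S" "generator y \<in> S" using I(2) by auto
    then show "x \<in> letters S \<and> y \<in> letters S" by simp
  qed
qed (use assms in \<open>auto simp: independence_alphabet_def irrefl_def dest: symD\<close>)

lemma alphabet_group_graph_group:
  assumes "independence_alphabet S I"
  shows "alphabet_group (letters S) bar (letter_indep I)
    (graph_group S I) (graph_gen S I)"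
proof -
  let ?val = "word_value (graph_group S I) (graph_gen S I)"
  let ?R = "commutations I" and ?J = "letter_indep I"
  interpret inv_alphabet "letters S" bar ?J by (rule inv_alphabet_letters[OF assms])
  have I: "I \<subseteq> S \<times> S" using assms by (simp add: independence_alphabet_def)
  have gen: "graph_gen S I = (\<lambda>x. word_class S ?R [x])" by (simp add: fun_eq_iff graph_gen_def)
  have val: "?val w = word_class S ?R w"
    if "w \<in> lists (letters S)" for w
    unfolding gen graph_group_def by (rule word_value_presented_group[OF that])
  have teq: "teq (red u) (red v)" if "(u, v) \<in> pres_cong S ?R" for u v
    using that
  proof (induction rule: pres_cong.induct)
    case (cancel u v x)
    show ?case by (rule red_cancel)
  next
    case (relation u v l r)
    then obtain a b where "l = [Inl a, Inl b]" "r = [Inl b, Inl a]" "(a, b) \<in> I"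
      by (auto simp: commutations_def)
    then show ?case using red_swap[of "Inl a" "Inl b" u v] by simp
  qed (auto intro: teq_sym teq_trans)
  show ?thesis
  proof
    fix x u assume x: "x \<in> letters S" and u: "u \<in> lists (letters S)"
    have "([] @ [x, bar x] @ u, [] @ u) \<in> pres_cong S ?R"
      using x u by (intro pres_cong.cancel) auto
    then show "?val (x # bar x # u) =
        ?val u"
      using x u by (simp add: val word_class_eq_iff)
  next
    fix x y u assume xy: "(x, y) \<in> ?J" and u: "u \<in> lists (letters S)"
    have l: "x \<in> letters S" "y \<in> letters S" using xy J_X by auto
    have "([] @ [x, y] @ u, [] @ [y, x] @ u) \<in> pres_cong S ?R"
      using xy u by (intro pres_cong_context commute_letters[OF I]) auto
    then show "?val (x # y # u) =
        ?val (y # x # u)"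
      using l u by (simp add: val word_class_eq_iff)
  next
    fix u v assume uv: "u \<in> lists (letters S)" "v \<in> lists (letters S)"
      and eq: "?val u = ?val v"
    then have "(u, v) \<in> pres_cong S ?R" by (simp add: val word_class_eq_iff)
    then show "teq (red u) (red v)" by (rule teq)
  qed
qed

lemma inv_alphabet_id:
  assumes "independence_alphabet S I"
  shows "inv_alphabet S id I"
  using assms by unfold_locales (auto simp: independence_alphabet_def irrefl_def dest: symD)

lemma alphabet_group_coxeter_group:
  assumes "independence_alphabet S I"
  shows "alphabet_group S id I (coxeter_group S I) (coxeter_gen S I)"
proof -
  let ?val = "word_value (coxeter_group S I) (coxeter_gen S I)"
  let ?R = "involutions S \<union> commutations I"
  interpret inv_alphabet S id I by (rule inv_alphabet_id[OF assms])
  have I: "I \<subseteq> S \<times> S" using assms by (simp add: independence_alphabet_def)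
  have lists: "map Inl w \<in> lists (letters S)" if "w \<in> lists S" for w
    using that by (auto simp: letters_def)
  have gen: "coxeter_gen S I = (\<lambda>x. word_class S ?R [x]) \<circ> Inl"
    by (simp add: fun_eq_iff coxeter_gen_def)
  have "word_value G (f \<circ> g) w = word_value G f (map g w)" for G f g and w :: "'a list"
    by (simp add: word_value_def foldr_map o_def)
  then have val: "?val w = word_class S ?R (map Inl w)"
    if "w \<in> lists S" for w
    unfolding gen coxeter_group_def using word_value_presented_group[OF lists[OF that]] by metis
  \<comment> \<open>Forgetting the bars turns free cancellation and the relations
    \<open>a a = 1\<close> alike into cancellation of a letter against itself, which is the
    cancellation built into \<open>red\<close> when the involution is \<open>id\<close>.\<close>
  have teq: "teq (red (map generator u)) (red (map generator v))" if "(u, v) \<in> pres_cong S ?R" for u v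
    using that
  proof (induction rule: pres_cong.induct)
    case (cancel u v x)
    show ?case
      using red_cancel[of "map generator u" "generator x" "map generator v"]
      by (simp add: id_def)
  next
    case (relation u v l r)
    then consider a where "l = [Inl a, Inl a]" "r = []"
      | a b where "l = [Inl a, Inl b]" "r = [Inl b, Inl a]" "(a, b) \<in> I"
      by (auto simp: commutations_def involutions_def)
    then show ?case
    proof cases
      case 1
      then show ?thesis
        using red_cancel[of "map generator u" a "map generator v"] by (simp add: id_def)
    next
      case 2
      then show ?thesis
        using red_swap[of a b "map generator u" "map generator v"] by (simp add: id_def)
    qed
  qed (auto intro: teq_sym teq_trans)
  show ?thesis
  proof
    fix x u assume x: "x \<in> S" and u: "u \<in> lists S"
    have "([] @ [Inl x, Inl x] @ map Inl u, [] @ [] @ map Inl u) \<in> pres_cong S ?R"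
      using x lists[OF u] by (intro pres_cong.relation) (auto simp: letters_def involutions_def)
    then show "?val (x # id x # u) =
        ?val u"
      using x u lists[of u] lists[of "x # x # u"] by (simp add: val word_class_eq_iff)
  next
    fix x y u assume xy: "(x, y) \<in> I" and u: "u \<in> lists S"
    have l: "x \<in> S" "y \<in> S" using xy I by auto
    have "([] @ [Inl x, Inl y] @ map Inl u, [] @ [Inl y, Inl x] @ map Inl u) \<in> pres_cong S ?R"
      using xy lists[OF u] by (intro pres_cong_context commute_letters[OF I]) auto
    then show "?val (x # y # u) =
        ?val (y # x # u)"
      using l u lists[of "x # y # u"] lists[of "y # x # u"] by (simp add: val word_class_eq_iff)
  next
    fix u v assume uv: "u \<in> lists S" "v \<in> lists S"
      and eq: "?val u = ?val v"
    then have "(map Inl u, map Inl v) \<in> pres_cong S ?R"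
      using lists[of u] lists[of v] by (simp add: val word_class_eq_iff)
    from teq[OF this] show "teq (red u) (red v)" by (simp add: o_def)
  qed
qed

theorem theorem7:
  fixes Sig :: "'a set" and I :: "('a \<times> 'a) set"
  assumes "independence_alphabet Sig I"
  shows "(\<forall>ord. linear_order_on (letters Sig) ord \<longrightarrow>
      (\<exists>M :: ('a letter, 'a letter) transducer.
        logspace_transducer (letters Sig) (letters Sig) M \<and>
        computes M (letters Sig)
          (\<lambda>w. shortlex_nf (graph_group Sig I) (letters Sig) (graph_gen Sig I) ord
            (word_value (graph_group Sig I) (graph_gen Sig I) w)))) \<and>
    (\<forall>ord. linear_order_on Sig ord \<longrightarrow>
      (\<exists>M :: ('a, 'a) transducer.
        logspace_transducer Sig Sig M \<and>
        computes M Sig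
          (\<lambda>w. shortlex_nf (coxeter_group Sig I) Sig (coxeter_gen Sig I) ord
            (word_value (coxeter_group Sig I) (coxeter_gen Sig I) w))))"
  using alphabet_group.logspace_shortlex_nf[OF alphabet_group_graph_group[OF assms]]
    alphabet_group.logspace_shortlex_nf[OF alphabet_group_coxeter_group[OF assms]]
  by blast

end
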